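(* Let $D\subset\mathbb{C}$ be a bounded Jordan domain containing $0$. Then for every integer $n\ge 1$, $$\log Z_n(D)=\log \frac{\pi^n}{n!} + n(n+1) \log r_\infty(D) + \log \det(I-P_nBB^*P_n)_{\ell^2(\mathbb{Z}_+)} .$$
   Context: Write $\mathbb{D}^*=\{z:|z|>1\}\cup\{\infty\}$ and $D^*=\hat{\mathbb{C}}\smallsetminus\overline{D}$. The partition function is $$Z_n(D)=\frac1{n!}\int_{D^n}\prod_{1\le k<\ell\le n}|z_k-z_\ell|^2\prod_{k=1}^n d^2z_k,$$ where $d^2z$ is two-dimensional Lebesgue measure. The exterior conformal map $g:\mathbb{D}^*\to D^*$ is the conformal map with expansion $g(z)=r_\infty z+\sum_{k\ge0}g_kz^{-k}$ near $\infty$, $r_\infty=r_\infty(D)>0$ (the capacity of $D$). The Grunsky coefficients $a_{k\ell}$, $k,\ell\ge1$, are defined by $$\log\frac{g(\zeta)-g(z)}{\zeta-z}=\log r_\infty-\sum_{k,\ell=1}^\infty a_{k\ell}\zeta^{-k}z^{-\ell},\qquad |z|,|\zeta|>1,$$ and $b_{k\ell}=\sqrt{k\ell}\,a_{k\ell}$. The Grunsky operator $B=(b_{k\ell})_{k,\ell\ge1}$ acts on $\ell^2(\mathbb{Z}_+)$, and $P_n$ is the projection onto the first $n$ coordinates of $\ell^2(\mathbb{Z}_+)$.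
   Formalization: The formal statement also assumes that the boundary of D has zero area; for Jordan domains whose boundary has positive area the formula fails, since its right side equals log Z_n of the closure of D, which is strictly larger than log Z_n(D). *)

theory Defs
  imports "HOL-Complex_Analysis.Complex_Analysis" "Jordan_Normal_Form.Determinant"
begin

definition bounded_Jordan_domain :: "complex set \<Rightarrow> bool" where
  "bounded_Jordan_domain D \<longleftrightarrow>
     open D \<and> connected D \<and> bounded D \<and>
     (\<exists>\<gamma>. simple_path \<gamma> \<and> pathfinish \<gamma> = pathstart \<gamma> \<and> frontier D = path_image \<gamma>)"

(* The integral is over the open domain; a Jordan curve can have positive area, in which case
   integrating over closure D would give a different value. *)
definition partition_function :: "nat \<Rightarrow> complex set \<Rightarrow> real" where
  "partition_function n D =
     1 / fact n *
     (LINT z : Pi\<^sub>E {1..n} (\<lambda>_. D) | Pi\<^sub>M {1..n} (\<lambda>_. lborel).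
        (\<Prod>(k, l) \<in> {(k, l). 1 \<le> k \<and> k < l \<and> l \<le> n}. (cmod (z k - z l))\<^sup>2))"

(* The Riemann sphere is avoided: g is given on the finite part of the exterior disc, and the
   expansion says that g extends to infinity with a simple pole there, i.e. it fixes infinity. *)
definition exterior_conformal_map :: "complex set \<Rightarrow> (complex \<Rightarrow> complex) \<Rightarrow> real \<Rightarrow> bool" where
  "exterior_conformal_map D g r \<longleftrightarrow>
     g holomorphic_on {z. 1 < cmod z} \<and>
     bij_betw g {z. 1 < cmod z} (- closure D) \<and>
     0 < r \<and>
     (\<exists>c. \<forall>\<^sub>F z in at_infinity. (\<lambda>k. c k / z ^ k) sums (g z - of_real r * z))"

(* The logarithm is the branch that is holomorphic in both variables and tends to log r at infinity.
   Here log r - S is required to be a logarithm of the difference quotient. As S is a convergent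
   double power series in 1/zeta, 1/z without constant term, this fixes the branch and determines
   a k l for all k, l >= 1; the values a 0 l and a k 0 are irrelevant. The diagonal, where the
   quotient means g'(z), follows by continuity. *)
definition Grunsky_coefficients ::
    "(complex \<Rightarrow> complex) \<Rightarrow> real \<Rightarrow> (nat \<Rightarrow> nat \<Rightarrow> complex) \<Rightarrow> bool" where
  "Grunsky_coefficients g r a \<longleftrightarrow>
     (\<forall>\<zeta> z. 1 < cmod \<zeta> \<longrightarrow> 1 < cmod z \<longrightarrow> \<zeta> \<noteq> z \<longrightarrow>
        (\<exists>S. ((\<lambda>(k, l). a k l / (\<zeta> ^ k * z ^ l)) has_sum S) ({1..} \<times> {1..}) \<and>
             exp (of_real (ln r) - S) = (g \<zeta> - g z) / (\<zeta> - z)))"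

(* A vector in l^2 of the positive integers is a function on nat of which only the coordinates
   k >= 1 matter; operators are maps between such functions. *)
type_synonym cseq = "nat \<Rightarrow> complex"

definition unit_seq :: "nat \<Rightarrow> cseq" where
  "unit_seq k = (\<lambda>j. if j = k then 1 else 0)"

definition inner_seq :: "cseq \<Rightarrow> cseq \<Rightarrow> complex" where
  "inner_seq x y = (\<Sum>\<^sub>\<infinity>k\<in>{1..}. x k * cnj (y k))"

(* The k-th coordinate of T* y is <T* y, e_k> = <y, T e_k>. *)
definition adjoint_op :: "(cseq \<Rightarrow> cseq) \<Rightarrow> cseq \<Rightarrow> cseq" where
  "adjoint_op T y = (\<lambda>k. inner_seq y (T (unit_seq k)))"

definition Grunsky_operator :: "(nat \<Rightarrow> nat \<Rightarrow> complex) \<Rightarrow> cseq \<Rightarrow> cseq" where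
  "Grunsky_operator a x =
     (\<lambda>k. \<Sum>\<^sub>\<infinity>l\<in>{1..}. of_real (sqrt (real k * real l)) * a k l * x l)"

definition coord_proj :: "nat \<Rightarrow> cseq \<Rightarrow> cseq" where
  "coord_proj n x = (\<lambda>k. if 1 \<le> k \<and> k \<le> n then x k else 0)"

(* The Fredholm determinant of an operator of the form I + trace class, as the limit of the
   determinants of its finite sections in the standard basis. Row i and column j of the library's
   0-based matrices belong to the coordinates i + 1 and j + 1. *)
definition Fredholm_det :: "(cseq \<Rightarrow> cseq) \<Rightarrow> complex" where
  "Fredholm_det T =
     lim (\<lambda>N. Determinant.det
                (Matrix.mat N N (\<lambda>(i, j). T (unit_seq (Suc j)) (Suc i))))"

end

theory Submission
  imports Defs
begin

text \<open>
  The integrand of the partition function is the squared modulus of a Vandermonde determinant.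
  Column operations do not change it up to leading coefficients, so for any polynomials
  \<open>p 0, \<dots>, p (n - 1)\<close> with \<open>p j\<close> of degree \<open>j\<close> Andreief's identity turns \<open>n!\<close> times the partition
  function into \<open>n!\<close> times the Gram determinant of the \<open>p j\<close> in \<open>L\<^sup>2(D)\<close>, divided by the squared
  moduli of the leading coefficients (\<open>det_Vandermonde_poly\<close>, \<open>Andreief_identity\<close>).

  The Gram matrix becomes explicit for \<open>p j = F (j + 1)'\<close>, where \<open>F m\<close> is the \<open>m\<close>-th Faber polynomial,
  of leading coefficient \<open>r\<^sup>-\<^sup>m\<close>.  Expanding the logarithm that defines the Grunsky coefficients in
  powers of \<open>1 / \<zeta>\<close> alone shows that \<open>F m (g z) = z\<^sup>m + m (\<Sum>l. a m l z\<^sup>-\<^sup>l)\<close>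
  (\<open>Faber_polynomial_exists\<close>).  By Green's theorem the inner product of \<open>F m'\<close> and \<open>F k'\<close> over the
  inside of the level curve \<open>g(|z| = \<rho>)\<close> is the contour integral of
  \<open>(F m \<circ> g)' cnj (F k \<circ> g) / 2\<i>\<close> over \<open>|z| = \<rho>\<close>, and orthogonality of the powers of \<open>z\<close> on circles
  evaluates it.  For \<open>\<rho> \<rightarrow> 1\<close> the insides of the level curves shrink to the closure of \<open>D\<close>, which
  differs from \<open>D\<close> by a null set, and the limit is \<open>\<pi> \<surd>(m k)\<close> times the entry \<open>(m, k)\<close> of \<open>I - B B\<^sup>*\<close>
  (\<open>integral_D_Faber\<close>).  The factors \<open>\<pi> \<surd>(m k)\<close> and the leading coefficients \<open>m r\<^sup>-\<^sup>m\<close> together produce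
  \<open>\<pi>\<^sup>n / n!\<close> and \<open>r\<close> to the power \<open>n (n + 1)\<close>.

  Green's theorem is derived from winding numbers (\<open>Green_winding_number\<close>).  Where a closed curve winds once around the points of \<open>S\<close> and
  not at all around other points, Fubini's theorem turns the area integral of \<open>\<phi>\<close> over \<open>S\<close> into a contour
  integral of the Cauchy transform of \<open>\<phi>\<close>.  When \<open>\<phi>\<close> is a derivative of \<open>\<psi>\<close> with respect to the conjugate
  variable, the Cauchy-Pompeiu formula on a large rectangle says that this transform is a multiple of
  \<open>\<psi>\<close> up to a holomorphic function, which the contour does not see.  The winding numbers of the level
  curves come from the Grunsky series as well: it exhibits \<open>g \<zeta> - g z\<close> as \<open>\<zeta> - z\<close> times the
  exponential of a function that is holomorphic in the exterior disc (\<open>winding_number_g_circle\<close>).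
\<close>

section \<open>Lebesgue measure of the plane and the Cauchy kernel\<close>

lemma AE_lborel_negligible:
  assumes "negligible S"
  shows "AE w in lborel. w \<notin> S"
proof -
  have "AE w in lebesgue. w \<notin> S"
    using assms by (intro AE_not_in) (simp add: negligible_iff_null_sets)
  then show ?thesis unfolding AE_completion_iff .
qed

text \<open>
  This transports Fubini's theorem from the product of two lines to the plane.
\<close>

lemma lborel_complex_eq_distr:
  "(lborel :: complex measure) = distr (lborel \<Otimes>\<^sub>M lborel) borel (\<lambda>(x, y). Complex x y)"
proof (rule lborel_eqI)
  have meas: "(\<lambda>(x, y). Complex x y) \<in> (lborel \<Otimes>\<^sub>M lborel) \<rightarrow>\<^sub>M borel"
    unfolding Complex_eq by measurable
  fix l u :: complex
  assume le: "\<And>b. b \<in> Basis \<Longrightarrow> inner l b \<le> inner u b"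
  have *: "(\<lambda>(x, y). Complex x y) -` box l u = {Re l<..<Re u} \<times> {Im l<..<Im u}"
    by (auto simp: box_def Basis_complex_def)
  have "emeasure (distr (lborel \<Otimes>\<^sub>M lborel) borel (\<lambda>(x, y). Complex x y)) (box l u)
      = emeasure (lborel \<Otimes>\<^sub>M lborel) ({Re l<..<Re u} \<times> {Im l<..<Im u})"
    using meas by (subst emeasure_distr) (auto simp: * space_pair_measure)
  also have "\<dots> = emeasure lborel {Re l<..<Re u} * emeasure lborel {Im l<..<Im u}"
    by (rule lborel.emeasure_pair_measure_Times) auto
  also have "\<dots> = ennreal (prod (inner (u - l)) Basis)"
    using le[of 1] le[of \<i>] by (auto simp: Basis_complex_def ennreal_mult)
  finally show "emeasure (distr (lborel \<Otimes>\<^sub>M lborel) borel (\<lambda>(x, y). Complex x y)) (box l u)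
      = ennreal (prod (inner (u - l)) Basis)" .
qed auto

lemma measurable_Complex_pair [measurable]:
  "(\<lambda>(x, y). Complex x y) \<in> borel_measurable (lborel \<Otimes>\<^sub>M lborel)"
  unfolding Complex_eq by measurable

lemma integrable_lborel_complex_iff:
  fixes f :: "complex \<Rightarrow> 'b :: {banach, second_countable_topology}"
  assumes "f \<in> borel_measurable borel"
  shows "integrable lborel f \<longleftrightarrow> integrable (lborel \<Otimes>\<^sub>M lborel) (\<lambda>(x, y). f (Complex x y))"
  using assms by (subst lborel_complex_eq_distr, subst integrable_distr_eq)
    (auto simp: case_prod_unfold)

lemma integral_lborel_complex:
  fixes f :: "complex \<Rightarrow> 'b :: {banach, second_countable_topology}"
  assumes f: "integrable lborel f"
  shows "integral\<^sup>L lborel f = (LBINT y. LBINT x. f (Complex x y))"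
proof -
  have m: "f \<in> borel_measurable borel"
    using borel_measurable_integrable[OF f] by simp
  have i: "integrable (lborel \<Otimes>\<^sub>M lborel) (case_prod (\<lambda>x y. f (Complex x y)))"
    using f integrable_lborel_complex_iff[OF m] by simp
  have e: "integral\<^sup>L lborel f = integral\<^sup>L (lborel \<Otimes>\<^sub>M lborel) (case_prod (\<lambda>x y. f (Complex x y)))"
    using m by (subst lborel_complex_eq_distr, subst integral_distr) (auto simp: case_prod_unfold)
  show "integral\<^sup>L lborel f = (LBINT y. LBINT x. f (Complex x y))"
    using e lborel_pair.integral_snd[OF i] by simp
qed

lemma integrable_inverse_sqrt_abs:
  "set_integrable lborel {-c..c} (\<lambda>x::real. 1 / sqrt \<bar>x\<bar>)"
proof (cases "0 \<le> c")
  case True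
  have "(\<lambda>x. x powr (-1/2)) absolutely_integrable_on {0..c}"
    using True by (intro nonnegative_absolutely_integrable_1 integrable_on_powr_from_0) auto
  then have 1: "(\<lambda>x. 1 / sqrt \<bar>x\<bar>) absolutely_integrable_on {0..c}"
    by (rule set_integrable_cong[THEN iffD1, rotated -1])
      (auto simp: powr_minus powr_half_sqrt field_simps)
  then have 2: "(\<lambda>x. 1 / sqrt \<bar>x\<bar>) absolutely_integrable_on {-c..0}"
    by (subst absolutely_integrable_reflect_real[symmetric]) simp
  have "{-c..c} = {-c..0} \<union> {0..c}"
    using True by auto
  with set_integrable_Un[OF 2 1] have "(\<lambda>x. 1 / sqrt \<bar>x\<bar>) absolutely_integrable_on {-c..c}"
    by simp
  then show ?thesis
    unfolding set_integrable_def by (subst (asm) integrable_completion) auto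
qed (simp add: set_integrable_def)

text \<open>
  The inequality \<open>2 |x y| \<le> x\<^sup>2 + y\<^sup>2\<close> bounds the kernel \<open>1 / |w|\<close> by the product
  \<open>|x|\<^sup>-\<^sup>1\<^sup>/\<^sup>2 |y|\<^sup>-\<^sup>1\<^sup>/\<^sup>2\<close> of two functions of one variable that are integrable near the origin.
\<close>

lemma integrable_Cauchy_kernel:
  fixes \<zeta> :: complex
  assumes "bounded S" "S \<in> sets borel"
  shows "set_integrable lborel S (\<lambda>w. 1 / cmod (w - \<zeta>))"
proof -
  obtain c where c: "\<And>w. w \<in> S \<Longrightarrow> cmod (w - \<zeta>) \<le> c"
    using assms(1) by (metis bounded_any_center dist_commute dist_norm)
  define h where "h = (\<lambda>x::real. indicator {-c..c} x *\<^sub>R (1 / sqrt \<bar>x\<bar>))"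
  have h: "integrable lborel h"
    using integrable_inverse_sqrt_abs[of c] unfolding set_integrable_def h_def .
  have hs: "integrable lborel (\<lambda>x. h (x - t))" for t
    using lborel_integrable_real_affine[OF h, of 1 "-t"] by simp
  have hn: "h x \<ge> 0" for x by (auto simp: h_def)
  have m: "h \<in> borel_measurable borel" unfolding h_def by measurable
  have "integrable (lborel \<Otimes>\<^sub>M lborel) (\<lambda>(x, y). h (x - Re \<zeta>) * h (y - Im \<zeta>))"
    by (rule lborel_pair.Fubini_integrable) (use m hs in \<open>auto simp: abs_mult hn\<close>)
  then have "integrable (lborel \<Otimes>\<^sub>M lborel)
      (\<lambda>(x, y). (\<lambda>w. h (Re (w - \<zeta>)) * h (Im (w - \<zeta>))) (Complex x y))"
    by simp
  then have H: "integrable lborel (\<lambda>w. h (Re (w - \<zeta>)) * h (Im (w - \<zeta>)))"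
    by (subst integrable_lborel_complex_iff) (use m in auto)
  show ?thesis
    unfolding set_integrable_def
  proof (rule Bochner_Integration.integrable_bound[OF H])
    show "(\<lambda>w. indicator S w *\<^sub>R (1 / cmod (w - \<zeta>))) \<in> borel_measurable lborel"
      using assms by measurable
    have "norm (indicator S w *\<^sub>R (1 / cmod (w - \<zeta>))) \<le> norm (h (Re (w - \<zeta>)) * h (Im (w - \<zeta>)))"
      if "Re w \<noteq> Re \<zeta>" "Im w \<noteq> Im \<zeta>" for w
    proof (cases "w \<in> S")
      case True
      define p q where "p = \<bar>Re (w - \<zeta>)\<bar>" and "q = \<bar>Im (w - \<zeta>)\<bar>"
      have pq: "p > 0" "q > 0" using that by (auto simp: p_def q_def)
      have "p \<le> c" "q \<le> c"
        using c[OF True] abs_Re_le_cmod[of "w - \<zeta>"] abs_Im_le_cmod[of "w - \<zeta>"]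
        by (auto simp: p_def q_def)
      then have hh: "h (Re (w - \<zeta>)) * h (Im (w - \<zeta>)) = 1 / sqrt (p * q)"
        unfolding h_def p_def q_def by (auto simp: indicator_def real_sqrt_mult abs_le_iff)
      have "p * q \<le> p\<^sup>2 + q\<^sup>2"
        using sum_squares_bound[of p q] pq mult_pos_pos[OF pq] by linarith
      then have "sqrt (p * q) \<le> cmod (w - \<zeta>)"
        unfolding cmod_def p_def q_def by (simp add: power2_eq_square)
      moreover have "sqrt (p * q) > 0" using pq by simp
      ultimately have "1 / cmod (w - \<zeta>) \<le> 1 / sqrt (p * q)"
        by (intro divide_left_mono mult_pos_pos) linarith+
      then show ?thesis using True hh pq by simp
    qed simp
    moreover have "AE w in lborel. Re w \<noteq> Re \<zeta> \<and> Im w \<noteq> Im \<zeta>"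
    proof -
      have "negligible {w::complex. inner w 1 = Re \<zeta>}" "negligible {w::complex. inner w \<i> = Im \<zeta>}"
        by (rule negligible_standard_hyperplane; simp add: Basis_complex_def)+
      then have "negligible ({w. Re w = Re \<zeta>} \<union> {w. Im w = Im \<zeta>})"
        by (simp add: inner_complex_def)
      then have "AE w in lborel. w \<notin> {w. Re w = Re \<zeta>} \<union> {w. Im w = Im \<zeta>}"
        by (rule AE_lborel_negligible)
      then show ?thesis by simp
    qed
    ultimately show "AE w in lborel. norm (indicator S w *\<^sub>R (1 / cmod (w - \<zeta>)))
        \<le> norm (h (Re (w - \<zeta>)) * h (Im (w - \<zeta>)))"
      by (elim eventually_mono) blast
  qed
qed

text \<open>
  Translating the singularity to the origin moves \<open>S\<close> into one ball, whatever \<open>\<zeta>\<close> is.  The uniformity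
  in \<open>\<zeta>\<close> is what makes Fubini's theorem applicable in \<open>Green_winding_number\<close>.
\<close>

lemma Cauchy_kernel_integral_bounded:
  assumes "bounded S" "S \<in> sets borel" "bounded T"
  obtains K where "\<And>\<zeta>. \<zeta> \<in> T \<Longrightarrow> (LINT w : S | lborel. 1 / cmod (w - \<zeta>)) \<le> K"
proof -
  obtain c where c: "\<And>w \<zeta>. w \<in> S \<Longrightarrow> \<zeta> \<in> T \<Longrightarrow> cmod (w - \<zeta>) \<le> c"
  proof -
    obtain a b where "\<And>w. w \<in> S \<Longrightarrow> cmod w \<le> a" "\<And>w. w \<in> T \<Longrightarrow> cmod w \<le> b"
      using assms by (meson bounded_iff)
    then have "cmod (w - \<zeta>) \<le> a + b" if "w \<in> S" "\<zeta> \<in> T" for w \<zeta>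
      using that by (meson add_mono norm_triangle_le_diff)
    then show ?thesis using that by blast
  qed
  have "(LINT w : S | lborel. 1 / cmod (w - \<zeta>)) \<le> (LINT w : cball 0 c | lborel. 1 / cmod w)"
    if T: "\<zeta> \<in> T" for \<zeta>
  proof -
    have i: "set_integrable lborel (cball 0 c) (\<lambda>w::complex. 1 / cmod w)"
      using integrable_Cauchy_kernel[of "cball 0 c" 0] by simp
    have i': "integrable lborel (\<lambda>w. indicator (cball 0 c) (w - \<zeta>) *\<^sub>R (1 / cmod (w - \<zeta>)))"
      using integrable_Cauchy_kernel[of "cball \<zeta> c" \<zeta>] unfolding set_integrable_def
      by (simp add: indicator_def dist_norm norm_minus_commute)
    have "(LINT w : S | lborel. 1 / cmod (w - \<zeta>))
        \<le> (LINT w | lborel. indicator (cball 0 c) (w - \<zeta>) *\<^sub>R (1 / cmod (w - \<zeta>)))"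
      unfolding set_lebesgue_integral_def
      using integrable_Cauchy_kernel[OF assms(1,2), of \<zeta>, unfolded set_integrable_def] i'
    proof (rule integral_mono)
      show "indicator S w *\<^sub>R (1 / cmod (w - \<zeta>))
          \<le> indicator (cball 0 c) (w - \<zeta>) *\<^sub>R (1 / cmod (w - \<zeta>))" for w
        using c[OF _ T, of w] by (auto simp: indicator_def)
    qed
    also have "\<dots> = (LINT w : cball 0 c | lborel. 1 / cmod w)"
    proof -
      have "lborel = distr lborel borel (\<lambda>w. - \<zeta> + w)"
        using lborel_distr_plus[of "-\<zeta>"] by (rule sym)
      then have "(LINT w : cball 0 c | lborel. 1 / cmod w)
         = (LINT w : cball 0 c | distr lborel borel (\<lambda>w. - \<zeta> + w). 1 / cmod w)" by simp
      also have "\<dots> = (LINT w | lborel. indicator (cball 0 c) (w - \<zeta>) *\<^sub>R (1 / cmod (w - \<zeta>)))"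
        unfolding set_lebesgue_integral_def
        using borel_measurable_integrable[OF i[unfolded set_integrable_def]]
        by (subst integral_distr) auto
      finally show ?thesis by simp
    qed
    finally show ?thesis .
  qed
  then show ?thesis using that by blast
qed

section \<open>Integration over a rectangle\<close>

text \<open>
  A rotation by a quarter turn reduces this to the vertical case.
\<close>

lemma contour_integral_linepath_same_Im:
  assumes "Im z = c" "Im z' = c" "Re z = a" "Re z' = b" "a < b"
  shows "contour_integral (linepath z z') f = integral {a..b} (\<lambda>x. f (Complex x c))"
proof -
  have "contour_integral (linepath z z') f
      = contour_integral (linepath (\<i> * z) (\<i> * z')) (\<lambda>w. f (- \<i> * w)) / \<i>"
  proof -
    have lp: "linepath (\<i> * z) (\<i> * z') x = \<i> * linepath z z' x" for x
      by (simp add: linepath_def algebra_simps)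
    have ci: "contour_integral (linepath p q) k = (q - p) * integral {0..1} (\<lambda>x. k (linepath p q x))"
      for p q :: complex and k
      by (simp add: contour_integral_integral)
    show ?thesis
      unfolding ci by (simp add: lp field_simps)
  qed
  also have "\<dots> = integral {a..b} (\<lambda>x. f (- \<i> * Complex (-c) x))"
    using assms by (subst contour_integral_linepath_same_Re[of _ "-c" _ a b]) auto
  also have "(\<lambda>x. - \<i> * Complex (-c) x) = (\<lambda>x. Complex x c)"
    by (auto simp: complex_eq_iff)
  then have "integral {a..b} (\<lambda>x. f (- \<i> * Complex (-c) x)) = integral {a..b} (\<lambda>x. f (Complex x c))"
    by metis
  finally show ?thesis .
qed

lemma contour_integral_rectpath:
  assumes ab: "Re a < Re b" "Im a < Im b"
    and f: "continuous_on (path_image (rectpath a b)) f"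
  shows "contour_integral (rectpath a b) f =
      integral {Re a..Re b} (\<lambda>x. f (Complex x (Im a))) - integral {Re a..Re b} (\<lambda>x. f (Complex x (Im b)))
    + \<i> * (integral {Im a..Im b} (\<lambda>y. f (Complex (Re b) y)) - integral {Im a..Im b} (\<lambda>y. f (Complex (Re a) y)))"
proof -
  define p where "p = Complex (Re b) (Im a)"
  define q where "q = Complex (Re a) (Im b)"
  have pi: "path_image (rectpath a b)
      = closed_segment a p \<union> closed_segment p b \<union> closed_segment b q \<union> closed_segment q a"
    unfolding rectpath_def Let_def p_def q_def by (simp add: path_image_join Un_assoc)
  have c: "f contour_integrable_on linepath a p" "f contour_integrable_on linepath p b"
      "f contour_integrable_on linepath b q" "f contour_integrable_on linepath q a"
    by (rule contour_integrable_continuous_linepath, rule continuous_on_subset[OF f], use pi in blast)+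
  have r: "contour_integral (linepath b q) f = - contour_integral (linepath q b) f"
      "contour_integral (linepath q a) f = - contour_integral (linepath a q) f"
    using contour_integral_reversepath[of "linepath q b" f] contour_integral_reversepath[of "linepath a q" f]
    by simp_all
  have "contour_integral (rectpath a b) f = contour_integral (linepath a p) f
      + (contour_integral (linepath p b) f + (contour_integral (linepath b q) f + contour_integral (linepath q a) f))"
    using c unfolding rectpath_def Let_def p_def[symmetric] q_def[symmetric] by simp
  then show ?thesis
    unfolding r
    using contour_integral_linepath_same_Im[of a "Im a" p "Re a" "Re b" f]
      contour_integral_linepath_same_Im[of q "Im b" b "Re a" "Re b" f]
      contour_integral_linepath_same_Re[of p "Re b" b "Im a" "Im b" f]
      contour_integral_linepath_same_Re[of a "Re a" q "Im a" "Im b" f] ab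
    by (simp add: p_def q_def algebra_simps)
qed

text \<open>
  This is the fundamental theorem of calculus on horizontal lines followed by Fubini's theorem.
  The exceptional point \<open>\<zeta>\<close>, where \<open>h\<close> may have a singularity, affects one line only, and the
  integrability of \<open>p\<close> takes care of the rest.
\<close>

lemma integral_box_partial_Re:
  fixes h p :: "complex \<Rightarrow> complex"
  assumes ab: "Re a < Re b" "Im a < Im b" and z: "\<zeta> \<in> box a b"
    and d: "\<And>w. w \<in> cbox a b - {\<zeta>} \<Longrightarrow>
      ((\<lambda>t. h (Complex t (Im w))) has_vector_derivative p w) (at (Re w))"
    and p: "continuous_on (cbox a b - {\<zeta>}) p"
    and h: "continuous_on (cbox a b - {\<zeta>}) h"
    and int: "set_integrable lborel (cbox a b) p"
  shows "(LINT w : cbox a b | lborel. p w) =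
      integral {Im a..Im b} (\<lambda>y. h (Complex (Re b) y)) - integral {Im a..Im b} (\<lambda>y. h (Complex (Re a) y))"
proof -
  have z': "Re a < Re \<zeta>" "Re \<zeta> < Re b" using z by (auto simp: in_box_complex_iff)
  have c: "continuous_on {Im a..Im b} (\<lambda>y. h (Complex r y))" if "r = Re a \<or> r = Re b" for r
    by (rule continuous_on_compose2[OF h])
      (use that z' ab in \<open>auto simp: Complex_eq in_cbox_complex_iff complex_eq_iff intro!: continuous_intros\<close>)
  define F where "F = (\<lambda>y. LBINT x. indicator (cbox a b) (Complex x y) *\<^sub>R p (Complex x y))"
  define G where "G = (\<lambda>y. indicator {Im a..Im b} y *\<^sub>R (h (Complex (Re b) y) - h (Complex (Re a) y)))"
  have int': "integrable lborel (\<lambda>w. indicator (cbox a b) w *\<^sub>R p w)"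
    using int unfolding set_integrable_def .
  have G: "integrable lborel G"
    using borel_integrable_atLeastAtMost'[of "Im a" "Im b" "\<lambda>y. h (Complex (Re b) y) - h (Complex (Re a) y)"]
      continuous_on_diff[OF c[of "Re b"] c[of "Re a"]]
    unfolding set_integrable_def G_def by simp
  have FG: "F y = G y" if y: "y \<noteq> Im \<zeta>" for y
  proof (cases "y \<in> {Im a..Im b}")
    case True
    have cb: "Complex x y \<in> cbox a b - {\<zeta>} \<longleftrightarrow> x \<in> {Re a..Re b}" for x
      using True y by (auto simp: in_cbox_complex_iff)
    have "Complex x y \<in> cbox a b \<longleftrightarrow> x \<in> {Re a..Re b}" for x
      using True by (simp add: in_cbox_complex_iff)
    then have "indicator (cbox a b) (Complex x y) = (indicator {Re a..Re b} x :: real)" for x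
      by (simp only: indicator_def)
    then have "F y = (LBINT x. indicator {Re a..Re b} x *\<^sub>R p (Complex x y))"
      unfolding F_def by simp
    also have "\<dots> = h (Complex (Re b) y) - h (Complex (Re a) y)"
    proof (rule integral_FTC_Icc)
      show "continuous_on {Re a..Re b} (\<lambda>x. p (Complex x y))"
      proof (rule continuous_on_compose2[OF p])
        show "continuous_on {Re a..Re b} (\<lambda>x. Complex x y)"
          unfolding Complex_eq by (intro continuous_intros)
      qed (use cb in blast)
      show "((\<lambda>x. h (Complex x y)) has_vector_derivative p (Complex x y)) (at x within {Re a..Re b})"
        if "Re a \<le> x" "x \<le> Re b" for x
      proof (rule has_vector_derivative_at_within)
        have "Complex x y \<in> cbox a b - {\<zeta>}"
          unfolding cb using that by simp
        from d[OF this] show "((\<lambda>x. h (Complex x y)) has_vector_derivative p (Complex x y)) (at x)"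
          by simp
      qed
    qed (use ab in simp)
    finally show ?thesis using True by (simp add: G_def)
  next
    case False
    then have "indicator (cbox a b) (Complex x y) = (0::real)" for x
      by (auto simp: indicator_def in_cbox_complex_iff)
    then show ?thesis using False by (simp add: F_def G_def)
  qed
  have "integrable (lborel \<Otimes>\<^sub>M lborel) (\<lambda>(x, y). indicator (cbox a b) (Complex x y) *\<^sub>R p (Complex x y))"
    using int' integrable_lborel_complex_iff[of "\<lambda>w. indicator (cbox a b) w *\<^sub>R p w"]
      borel_measurable_integrable[OF int'] by simp
  then have F: "integrable lborel F"
    unfolding F_def by (rule lborel_pair.integrable_snd)
  have "(LINT w : cbox a b | lborel. p w) = integral\<^sup>L lborel F"
    unfolding set_lebesgue_integral_def F_def by (rule integral_lborel_complex[OF int'])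
  also have "\<dots> = integral\<^sup>L lborel G"
  proof (rule integral_cong_AE)
    show "AE y in lborel. F y = G y"
      using AE_lborel_singleton[of "Im \<zeta>"] by eventually_elim (rule FG)
  qed (use F G in auto)
  also have "\<dots> = integral {Im a..Im b} (\<lambda>y. h (Complex (Re b) y) - h (Complex (Re a) y))"
    using G unfolding G_def
    by (subst set_borel_integral_eq_integral(2)[symmetric])
      (simp_all add: set_integrable_def set_lebesgue_integral_def)
  also have "\<dots> = integral {Im a..Im b} (\<lambda>y. h (Complex (Re b) y)) - integral {Im a..Im b} (\<lambda>y. h (Complex (Re a) y))"
    using c by (intro integral_diff integrable_continuous_real) auto
  finally show ?thesis .
qed

text \<open>
  The reflection in the diagonal exchanges the roles of the real and the imaginary direction, which
  yields \<open>integral_box_partial_Im\<close> from \<open>integral_box_partial_Re\<close>.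
\<close>

lemma lborel_complex_reflection: "(lborel :: complex measure) = distr lborel borel (\<lambda>w. \<i> * cnj w)"
proof (rule lborel_eqI)
  fix l u :: complex
  assume le: "\<And>b. b \<in> Basis \<Longrightarrow> inner l b \<le> inner u b"
  have *: "(\<lambda>w. \<i> * cnj w) -` box l u = box (\<i> * cnj l) (\<i> * cnj u)"
    by (auto simp: in_box_complex_iff)
  show "emeasure (distr lborel borel (\<lambda>w. \<i> * cnj w)) (box l u) = ennreal (prod (inner (u - l)) Basis)"
    using le[of 1] le[of \<i>]
    by (subst emeasure_distr)
      (auto simp: * emeasure_lborel_box_eq Basis_complex_def algebra_simps
        intro!: borel_measurable_continuous_onI continuous_intros)
qed auto

lemma integral_box_partial_Im:
  fixes h p :: "complex \<Rightarrow> complex"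
  assumes ab: "Re a < Re b" "Im a < Im b" and z: "\<zeta> \<in> box a b"
    and d: "\<And>w. w \<in> cbox a b - {\<zeta>} \<Longrightarrow>
      ((\<lambda>t. h (Complex (Re w) t)) has_vector_derivative p w) (at (Im w))"
    and p: "continuous_on (cbox a b - {\<zeta>}) p"
    and h: "continuous_on (cbox a b - {\<zeta>}) h"
    and int: "set_integrable lborel (cbox a b) p"
  shows "(LINT w : cbox a b | lborel. p w) =
      integral {Re a..Re b} (\<lambda>x. h (Complex x (Im b))) - integral {Re a..Re b} (\<lambda>x. h (Complex x (Im a)))"
proof -
  define s where "s = (\<lambda>w. \<i> * cnj w)"
  have s: "Re (s w) = Im w" "Im (s w) = Re w" "s (s w) = w" for w by (auto simp: s_def)
  have sc: "s (Complex x y) = Complex y x" for x y by (simp add: complex_eq_iff s)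
  have scb: "w \<in> cbox (s a) (s b) \<longleftrightarrow> s w \<in> cbox a b" for w
    by (auto simp: in_cbox_complex_iff s)
  have simg: "s w \<in> cbox a b - {\<zeta>}" if "w \<in> cbox (s a) (s b) - {s \<zeta>}" for w
    using that scb s(3) by (metis DiffD1 DiffD2 DiffI singletonD singletonI)
  have cs: "continuous_on A s" for A unfolding s_def by (intro continuous_intros)
  have ms: "s \<in> borel_measurable borel" using cs by (rule borel_measurable_continuous_onI)
  have ls: "lborel = distr lborel borel s"
    using lborel_complex_reflection by (simp add: s_def)
  have ind: "indicator (cbox a b) (s w) = (indicator (cbox (s a) (s b)) w :: real)" for w
    using scb by (simp add: indicator_def)
  have int1: "integrable lborel (\<lambda>w. indicator (cbox a b) w *\<^sub>R p w)"
    using int unfolding set_integrable_def .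
  then have int2: "integrable (distr lborel borel s) (\<lambda>w. indicator (cbox a b) w *\<^sub>R p w)"
    using ls by simp
  have "(LINT w : cbox a b | lborel. p w)
      = integral\<^sup>L (distr lborel borel s) (\<lambda>w. indicator (cbox a b) w *\<^sub>R p w)"
    using ls by (simp add: set_lebesgue_integral_def)
  also have "\<dots> = (LINT w : cbox (s a) (s b) | lborel. p (s w))"
    unfolding set_lebesgue_integral_def
    using borel_measurable_integrable[OF int1] ms by (subst integral_distr) (auto simp: ind)
  also have "\<dots> = integral {Im (s a)..Im (s b)} (\<lambda>y. h (s (Complex (Re (s b)) y)))
      - integral {Im (s a)..Im (s b)} (\<lambda>y. h (s (Complex (Re (s a)) y)))"
  proof (rule integral_box_partial_Re[where \<zeta> = "s \<zeta>"])
    show "((\<lambda>t. h (s (Complex t (Im w)))) has_vector_derivative p (s w)) (at (Re w))"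
      if "w \<in> cbox (s a) (s b) - {s \<zeta>}" for w
      using d[OF simg[OF that]] by (simp add: s sc)
    show "continuous_on (cbox (s a) (s b) - {s \<zeta>}) (\<lambda>w. p (s w))"
      using simg by (intro continuous_on_compose2[OF p cs]) blast
    show "continuous_on (cbox (s a) (s b) - {s \<zeta>}) (\<lambda>w. h (s w))"
      using simg by (intro continuous_on_compose2[OF h cs]) blast
    show "set_integrable lborel (cbox (s a) (s b)) (\<lambda>w. p (s w))"
      using int2 borel_measurable_integrable[OF int1] ms unfolding set_integrable_def
      by (subst (asm) integrable_distr_eq) (auto simp: ind)
  qed (use ab z in \<open>auto simp: s in_box_complex_iff\<close>)
  finally show ?thesis by (simp add: s sc)
qed

section \<open>The Cauchy-Pompeiu formula\<close>

lemma contour_integrable_rectpath_continuous: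
  assumes "continuous_on (path_image (rectpath a b)) f"
  shows "f contour_integrable_on rectpath a b"
  using assms unfolding rectpath_def Let_def
  by (intro contour_integrable_joinI contour_integrable_continuous_linepath)
    (auto simp: path_image_join intro: continuous_on_subset)

lemma has_vector_derivative_partial_Re:
  assumes "(f has_derivative (\<lambda>v. Re v *\<^sub>R px + Im v *\<^sub>R py)) (at w)"
  shows "((\<lambda>t. f (Complex t (Im w))) has_vector_derivative px) (at (Re w))"
proof -
  have "((\<lambda>t. Complex t (Im w)) has_derivative (\<lambda>t. Complex t 0)) (at (Re w))"
    unfolding Complex_eq by (auto intro!: derivative_eq_intros)
  moreover have "(f has_derivative (\<lambda>v. Re v *\<^sub>R px + Im v *\<^sub>R py)) (at (Complex (Re w) (Im w)))"
    using assms by simp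
  ultimately have "((\<lambda>t. f (Complex t (Im w))) has_derivative (\<lambda>t. t *\<^sub>R px)) (at (Re w))"
    by (auto dest: has_derivative_compose)
  then show ?thesis by (simp add: has_vector_derivative_def)
qed

lemma has_vector_derivative_partial_Im:
  assumes "(f has_derivative (\<lambda>v. Re v *\<^sub>R px + Im v *\<^sub>R py)) (at w)"
  shows "((\<lambda>t. f (Complex (Re w) t)) has_vector_derivative py) (at (Im w))"
proof -
  have "((\<lambda>t. Complex (Re w) t) has_derivative (\<lambda>t. Complex 0 t)) (at (Im w))"
    unfolding Complex_eq by (auto intro!: derivative_eq_intros)
  moreover have "(f has_derivative (\<lambda>v. Re v *\<^sub>R px + Im v *\<^sub>R py)) (at (Complex (Re w) (Im w)))"
    using assms by simp
  ultimately have "((\<lambda>t. f (Complex (Re w) t)) has_derivative (\<lambda>t. t *\<^sub>R py)) (at (Im w))"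
    by (auto dest: has_derivative_compose)
  then show ?thesis by (simp add: has_vector_derivative_def)
qed

lemma set_integrable_kernel_bound:
  fixes f :: "complex \<Rightarrow> complex"
  assumes S: "bounded S" "S \<in> sets borel" and f: "f \<in> borel_measurable borel"
    and le: "\<And>w. w \<in> S \<Longrightarrow> cmod (f w) \<le> M / cmod (w - \<zeta>)"
  shows "set_integrable lborel S f"
proof (rule set_integrable_bound)
  show "set_integrable lborel S (\<lambda>w. M * (1 / cmod (w - \<zeta>)))"
    using integrable_Cauchy_kernel[OF S] by (rule set_integrable_mult_right)
  show "set_borel_measurable lborel S f"
    using S f unfolding set_borel_measurable_def by auto
  have "norm (f x) \<le> norm (M * (1 / cmod (x - \<zeta>)))" if "x \<in> S" for x
    using order_trans[OF le[OF that] abs_ge_self] by simp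
  then show "AE x in lborel. x \<in> S \<longrightarrow> norm (f x) \<le> norm (M * (1 / cmod (x - \<zeta>)))"
    by (intro AE_I2 impI)
qed

text \<open>
  Green's theorem applies to the difference quotient \<open>h = (\<psi> w - \<psi> \<zeta>) / (w - \<zeta>)\<close> on the
  whole box: since \<open>\<psi>\<close> is Lipschitz, both partial derivatives of \<open>h\<close> are bounded by a multiple of
  \<open>1 / |w - \<zeta>|\<close> and hence integrable.  In the combination \<open>\<partial>\<^sub>x h + \<i> \<partial>\<^sub>y h\<close> the holomorphic factor
  \<open>1 / (w - \<zeta>)\<close> is not differentiated.  The constant \<open>\<psi> \<zeta>\<close> contributes the winding number of the
  boundary around \<open>\<zeta>\<close>.
\<close>

lemma Cauchy_Pompeiu_box:
  fixes \<psi> px py :: "complex \<Rightarrow> complex"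
  assumes ab: "Re a < Re b" "Im a < Im b" and z: "\<zeta> \<in> box a b"
    and d: "\<And>w. (\<psi> has_derivative (\<lambda>v. Re v *\<^sub>R px w + Im v *\<^sub>R py w)) (at w)"
    and px: "continuous_on UNIV px" and py: "continuous_on UNIV py"
  shows "(LINT w : cbox a b | lborel. (px w + \<i> * py w) / (w - \<zeta>)) =
      - \<i> * contour_integral (rectpath a b) (\<lambda>w. \<psi> w / (w - \<zeta>)) - 2 * pi * \<psi> \<zeta>"
proof -
  define h where "h = (\<lambda>w. (\<psi> w - \<psi> \<zeta>) * (1 / (w - \<zeta>)))"
  define hx where "hx = (\<lambda>w. (\<psi> w - \<psi> \<zeta>) * (- 1 / (w - \<zeta>)\<^sup>2) + px w * (1 / (w - \<zeta>)))"
  define hy where "hy = (\<lambda>w. (\<psi> w - \<psi> \<zeta>) * (- \<i> / (w - \<zeta>)\<^sup>2) + py w * (1 / (w - \<zeta>)))"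
  have c\<psi>: "continuous_on A \<psi>" for A
    using d by (intro has_derivative_continuous_on) (blast intro: has_derivative_at_withinI)
  have cp: "continuous_on A px" "continuous_on A py" for A
    using px py continuous_on_subset by blast+
  have dk: "((\<lambda>w. 1 / (w - \<zeta>)) has_derivative
      (\<lambda>v. Re v *\<^sub>R (- 1 / (w - \<zeta>)\<^sup>2) + Im v *\<^sub>R (- \<i> / (w - \<zeta>)\<^sup>2))) (at w)" if "w \<noteq> \<zeta>" for w
  proof -
    have "((\<lambda>w. 1 / (w - \<zeta>)) has_field_derivative - 1 / (w - \<zeta>)\<^sup>2) (at w)"
      using that by (auto intro!: derivative_eq_intros simp: power2_eq_square)
    then have "((\<lambda>w. 1 / (w - \<zeta>)) has_derivative (\<lambda>v. (- 1 / (w - \<zeta>)\<^sup>2) * v)) (at w)"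
      unfolding has_field_derivative_def .
    moreover have "(\<lambda>v. (- 1 / (w - \<zeta>)\<^sup>2) * v)
        = (\<lambda>v. Re v *\<^sub>R (- 1 / (w - \<zeta>)\<^sup>2) + Im v *\<^sub>R (- \<i> / (w - \<zeta>)\<^sup>2))"
    proof
      fix v :: complex
      have "(- 1 / (w - \<zeta>)\<^sup>2) * (of_real (Re v) + \<i> * of_real (Im v))
        = Re v *\<^sub>R (- 1 / (w - \<zeta>)\<^sup>2) + Im v *\<^sub>R (- \<i> / (w - \<zeta>)\<^sup>2)"
        by (simp add: scaleR_conv_of_real algebra_simps add_divide_distrib)
      then show "(- 1 / (w - \<zeta>)\<^sup>2) * v = Re v *\<^sub>R (- 1 / (w - \<zeta>)\<^sup>2) + Im v *\<^sub>R (- \<i> / (w - \<zeta>)\<^sup>2)"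
        by (simp flip: complex_eq)
    qed
    ultimately show ?thesis by simp
  qed
  have dh: "(h has_derivative (\<lambda>v. Re v *\<^sub>R hx w + Im v *\<^sub>R hy w)) (at w)" if "w \<noteq> \<zeta>" for w
    unfolding h_def
    by (rule has_derivative_eq_rhs[OF has_derivative_mult[OF has_derivative_diff[OF d has_derivative_const] dk[OF that]]])
      (simp add: hx_def hy_def fun_eq_iff scaleR_conv_of_real algebra_simps)
  have ch: "continuous_on (cbox a b - {\<zeta>}) h" "continuous_on (cbox a b - {\<zeta>}) hx"
      "continuous_on (cbox a b - {\<zeta>}) hy"
    unfolding h_def hx_def hy_def by (intro continuous_intros c\<psi> cp; simp)+
  obtain L where L: "\<And>w. w \<in> cbox a b \<Longrightarrow> cmod (px w) \<le> L" "\<And>w. w \<in> cbox a b \<Longrightarrow> cmod (py w) \<le> L"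
  proof -
    have "bounded (px ` cbox a b \<union> py ` cbox a b)"
      using compact_continuous_image[OF cp(1) compact_cbox] compact_continuous_image[OF cp(2) compact_cbox]
      by (simp add: compact_imp_bounded)
    then show ?thesis unfolding bounded_iff using that by (metis UnI1 UnI2 imageI)
  qed
  \<comment> \<open>The total derivative has operator norm at most \<open>|px| + |py|\<close>.\<close>
  have lip: "cmod (\<psi> w - \<psi> \<zeta>) \<le> (2 * L) * cmod (w - \<zeta>)" if w: "w \<in> cbox a b" for w
  proof (rule differentiable_bound[of "cbox a b" \<psi> "\<lambda>u v. Re v *\<^sub>R px u + Im v *\<^sub>R py u"])
    show "onorm (\<lambda>v. Re v *\<^sub>R px u + Im v *\<^sub>R py u) \<le> 2 * L" if u: "u \<in> cbox a b" for u
    proof (rule onorm_le)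
      fix v
      have "cmod (Re v *\<^sub>R px u + Im v *\<^sub>R py u) \<le> \<bar>Re v\<bar> * cmod (px u) + \<bar>Im v\<bar> * cmod (py u)"
        by (metis norm_scaleR norm_triangle_ineq)
      also have "\<dots> \<le> cmod v * L + cmod v * L"
        using L[OF u] abs_Re_le_cmod[of v] abs_Im_le_cmod[of v] by (intro add_mono mult_mono) auto
      finally show "cmod (Re v *\<^sub>R px u + Im v *\<^sub>R py u) \<le> 2 * L * cmod v" by (simp add: algebra_simps)
    qed
  qed (use d w z box_subset_cbox in \<open>auto intro: has_derivative_at_withinI\<close>)
  have m: "\<psi> \<in> borel_measurable borel" "px \<in> borel_measurable borel" "py \<in> borel_measurable borel"
    using c\<psi> px py by (auto intro: borel_measurable_continuous_onI)
  have bd: "cmod (\<psi> w - \<psi> \<zeta>) * cmod (c / (w - \<zeta>)\<^sup>2) \<le> 2 * L / cmod (w - \<zeta>)"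
    if "w \<in> cbox a b" "cmod c = 1" for w c
  proof (cases "w = \<zeta>")
    case False
    have "cmod (\<psi> w - \<psi> \<zeta>) * (1 / cmod (w - \<zeta>) ^ 2) \<le> 2 * L * cmod (w - \<zeta>) * (1 / cmod (w - \<zeta>) ^ 2)"
      using lip[OF that(1)] by (rule mult_right_mono) simp
    also have "\<dots> = 2 * L / cmod (w - \<zeta>)"
      using False by (simp add: power2_eq_square)
    finally show ?thesis by (simp add: norm_divide norm_power that(2))
  qed simp
  have ints: "set_integrable lborel (cbox a b) hx" "set_integrable lborel (cbox a b) hy"
  proof -
    have "cmod (hx w) \<le> (3 * L) / cmod (w - \<zeta>)" if w: "w \<in> cbox a b" for w
    proof -
      have "cmod (hx w) \<le> cmod (\<psi> w - \<psi> \<zeta>) * cmod (- 1 / (w - \<zeta>)\<^sup>2) + cmod (px w) * cmod (1 / (w - \<zeta>))"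
        unfolding hx_def by (metis norm_mult norm_triangle_ineq)
      also have "\<dots> \<le> 2 * L / cmod (w - \<zeta>) + L / cmod (w - \<zeta>)"
        using bd[OF w, of "-1"] L(1)[OF w] by (intro add_mono) (auto simp: norm_divide divide_right_mono)
      finally show ?thesis by (simp flip: add_divide_distrib)
    qed
    then show "set_integrable lborel (cbox a b) hx"
      using m by (intro set_integrable_kernel_bound[where M = "3 * L" and \<zeta> = \<zeta>]) (auto simp: hx_def)
    have "cmod (hy w) \<le> (3 * L) / cmod (w - \<zeta>)" if w: "w \<in> cbox a b" for w
    proof -
      have "cmod (hy w) \<le> cmod (\<psi> w - \<psi> \<zeta>) * cmod (- \<i> / (w - \<zeta>)\<^sup>2) + cmod (py w) * cmod (1 / (w - \<zeta>))"
        unfolding hy_def by (metis norm_mult norm_triangle_ineq)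
      also have "\<dots> \<le> 2 * L / cmod (w - \<zeta>) + L / cmod (w - \<zeta>)"
        using bd[OF w, of "-\<i>"] L(2)[OF w] by (intro add_mono) (auto simp: norm_divide divide_right_mono)
      finally show ?thesis by (simp flip: add_divide_distrib)
    qed
    then show "set_integrable lborel (cbox a b) hy"
      using m by (intro set_integrable_kernel_bound[where M = "3 * L" and \<zeta> = \<zeta>]) (auto simp: hy_def)
  qed
  have zr: "\<zeta> \<notin> path_image (rectpath a b)"
    using z ab path_image_rectpath_inter_box[of a b] by auto
  have rsub: "path_image (rectpath a b) \<subseteq> cbox a b - {\<zeta>}"
    using path_image_rectpath_subset_cbox[of a b] ab zr by auto
  have hint: "h contour_integrable_on rectpath a b" "(\<lambda>w. \<psi> w / (w - \<zeta>)) contour_integrable_on rectpath a b"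
    "(\<lambda>w. 1 / (w - \<zeta>)) contour_integrable_on rectpath a b"
    by (intro contour_integrable_rectpath_continuous ab continuous_on_subset[OF ch(1) rsub]
        continuous_intros c\<psi>; use zr in auto)+
  have "(LINT w : cbox a b | lborel. (px w + \<i> * py w) / (w - \<zeta>))
      = (LINT w : cbox a b | lborel. hx w + \<i> * hy w)"
    by (rule arg_cong[where f = "\<lambda>f. set_lebesgue_integral lborel (cbox a b) f"])
      (auto simp: hx_def hy_def algebra_simps add_divide_distrib diff_divide_distrib)
  also have "\<dots> = (LINT w : cbox a b | lborel. hx w) + \<i> * (LINT w : cbox a b | lborel. hy w)"
    using ints by (subst set_integral_add(2)) auto
  also have "\<dots> = - \<i> * contour_integral (rectpath a b) h"
  proof -
    have 1: "(LINT w : cbox a b | lborel. hx w) = integral {Im a..Im b} (\<lambda>y. h (Complex (Re b) y))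
        - integral {Im a..Im b} (\<lambda>y. h (Complex (Re a) y))"
      by (rule integral_box_partial_Re[OF ab z _ ch(2,1) ints(1)])
        (use dh has_vector_derivative_partial_Re in blast)
    have 2: "(LINT w : cbox a b | lborel. hy w) = integral {Re a..Re b} (\<lambda>x. h (Complex x (Im b)))
        - integral {Re a..Re b} (\<lambda>x. h (Complex x (Im a)))"
      by (rule integral_box_partial_Im[OF ab z _ ch(3,1) ints(2)])
        (use dh has_vector_derivative_partial_Im in blast)
    show ?thesis
      unfolding 1 2 contour_integral_rectpath[OF ab continuous_on_subset[OF ch(1) rsub]]
      by (simp add: algebra_simps)
  qed
  also have "contour_integral (rectpath a b) h
      = contour_integral (rectpath a b) (\<lambda>w. \<psi> w / (w - \<zeta>) - \<psi> \<zeta> * (1 / (w - \<zeta>)))"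
    by (simp add: h_def algebra_simps diff_divide_distrib)
  also have "\<dots> = contour_integral (rectpath a b) (\<lambda>w. \<psi> w / (w - \<zeta>))
      - \<psi> \<zeta> * contour_integral (rectpath a b) (\<lambda>w. 1 / (w - \<zeta>))"
    using hint contour_integrable_lmul[OF hint(3), of "\<psi> \<zeta>"] contour_integral_lmul[OF hint(3), of "\<psi> \<zeta>"]
    by (subst contour_integral_diff) simp_all
  also have "contour_integral (rectpath a b) (\<lambda>w. 1 / (w - \<zeta>)) = 2 * pi * \<i>"
    using winding_number_rectpath[of \<zeta> a b] z winding_number_valid_path[OF valid_path_rectpath zr]
    by (simp add: field_simps)
  finally show ?thesis by (simp add: algebra_simps)
qed

section \<open>Green's theorem through winding numbers\<close>

lemma holomorphic_Cauchy_linepath: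
  assumes f: "continuous_on (closed_segment a b) f"
  shows "(\<lambda>z. contour_integral (linepath a b) (\<lambda>u. f u / (u - z))) holomorphic_on - closed_segment a b"
proof -
  have "((\<lambda>z. contour_integral (linepath a b) (\<lambda>u. f u / (u - z))) has_field_derivative
      (1 * contour_integral (linepath a b) (\<lambda>u. f u / (u - z) ^ Suc 1))) (at z)"
    if "z \<in> - closed_segment a b" for z
  proof -
    have "((\<lambda>u. f u / (u - w) ^ 1) has_contour_integral
        contour_integral (linepath a b) (\<lambda>u. f u / (u - w))) (linepath a b)"
      if "w \<in> UNIV - path_image (linepath a b)" for w
      using that by (simp add: f has_contour_integral_integral contour_integrable_continuous_linepath continuous_intros)
         (auto intro!: has_contour_integral_integral contour_integrable_continuous_linepath continuous_intros f)
    from Cauchy_next_derivative(2)[of "linepath a b" f "cmod (b - a)" UNIV 1, OF _ _ this] f that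
    show ?thesis by (simp add: vector_derivative_linepath_at)
  qed
  then show ?thesis
    unfolding holomorphic_on_def field_differentiable_def by (blast intro: has_field_derivative_at_within)
qed

text \<open>
  The path is not smooth at the corners, so the four sides are treated one by one; each of them
  contributes a Cauchy integral that is holomorphic off that side.
\<close>

lemma holomorphic_Cauchy_rectpath:
  assumes ab: "Re a \<le> Re b" "Im a \<le> Im b" and f: "continuous_on (path_image (rectpath a b)) f"
  shows "(\<lambda>z. contour_integral (rectpath a b) (\<lambda>u. f u / (u - z))) holomorphic_on box a b"
proof -
  define p where "p = Complex (Re b) (Im a)"
  define q where "q = Complex (Re a) (Im b)"
  have r: "rectpath a b = linepath a p +++ linepath p b +++ linepath b q +++ linepath q a"
    unfolding rectpath_def Let_def p_def q_def by simp
  have pi: "path_image (rectpath a b)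
      = closed_segment a p \<union> closed_segment p b \<union> closed_segment b q \<union> closed_segment q a"
    unfolding r by (simp add: path_image_join Un_assoc)
  have disj: "path_image (rectpath a b) \<inter> box a b = {}"
    using path_image_rectpath_inter_box ab by blast
  have sub: "closed_segment a p \<inter> box a b = {}" "closed_segment p b \<inter> box a b = {}"
      "closed_segment b q \<inter> box a b = {}" "closed_segment q a \<inter> box a b = {}"
    using disj pi by blast+
  have c: "continuous_on (closed_segment a p) f" "continuous_on (closed_segment p b) f"
      "continuous_on (closed_segment b q) f" "continuous_on (closed_segment q a) f"
    by (rule continuous_on_subset[OF f], use pi in blast)+
  have split: "contour_integral (rectpath a b) (\<lambda>u. f u / (u - z))
      = contour_integral (linepath a p) (\<lambda>u. f u / (u - z))
      + (contour_integral (linepath p b) (\<lambda>u. f u / (u - z))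
      + (contour_integral (linepath b q) (\<lambda>u. f u / (u - z))
      + contour_integral (linepath q a) (\<lambda>u. f u / (u - z))))" if "z \<in> box a b" for z
  proof -
    have i: "(\<lambda>u. f u / (u - z)) contour_integrable_on linepath s t"
      if "continuous_on (closed_segment s t) f" "closed_segment s t \<inter> box a b = {}" for s t
      using that \<open>z \<in> box a b\<close>
      by (intro contour_integrable_continuous_linepath continuous_intros) auto
    show ?thesis
      unfolding r using i[OF c(1) sub(1)] i[OF c(2) sub(2)] i[OF c(3) sub(3)] i[OF c(4) sub(4)] by simp
  qed
  have "(\<lambda>z. contour_integral (linepath s t) (\<lambda>u. f u / (u - z))) holomorphic_on box a b"
    if "continuous_on (closed_segment s t) f" "closed_segment s t \<inter> box a b = {}" for s t
    by (rule holomorphic_on_subset[OF holomorphic_Cauchy_linepath]) (use that in auto)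
  then have "(\<lambda>z. contour_integral (linepath a p) (\<lambda>u. f u / (u - z))
      + (contour_integral (linepath p b) (\<lambda>u. f u / (u - z))
      + (contour_integral (linepath b q) (\<lambda>u. f u / (u - z))
      + contour_integral (linepath q a) (\<lambda>u. f u / (u - z))))) holomorphic_on box a b"
    using c sub by (intro holomorphic_intros) auto
  then show ?thesis
    by (rule holomorphic_transform) (simp add: split)
qed

text \<open>
  Integrating the Cauchy-Pompeiu formula in \<open>\<zeta>\<close> along \<open>\<gamma>\<close> kills the holomorphic boundary term, because
  \<open>\<gamma>\<close> stays in a convex box, and leaves a multiple of the contour integral of \<open>\<psi>\<close>.  Exchanging the
  order of integration on the other side produces the integral of \<open>1 / (w - \<zeta>)\<close> along \<open>\<gamma>\<close>, that is, the
  winding number around \<open>w\<close>, for all \<open>w\<close> outside the image of \<open>\<gamma>\<close>, which is a null set.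
\<close>

lemma Green_winding_number:
  fixes \<psi> px py :: "complex \<Rightarrow> complex" and \<gamma> \<gamma>' :: "real \<Rightarrow> complex"
  assumes d: "\<And>w. (\<psi> has_derivative (\<lambda>v. Re v *\<^sub>R px w + Im v *\<^sub>R py w)) (at w)"
    and px: "continuous_on UNIV px" and py: "continuous_on UNIV py"
    and d\<gamma>: "\<And>t. (\<gamma> has_vector_derivative \<gamma>' t) (at t)" and c\<gamma>': "continuous_on UNIV \<gamma>'"
    and loop: "pathfinish \<gamma> = pathstart \<gamma>"
    and sub: "path_image \<gamma> \<subseteq> box a b"
    and S: "S \<in> sets borel" "S \<subseteq> cbox a b"
    and wind: "\<And>w. w \<notin> path_image \<gamma> \<Longrightarrow> winding_number \<gamma> w = indicator S w"
  shows "(LINT w : S | lborel. px w + \<i> * py w)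
      = - \<i> * contour_integral \<gamma> \<psi>"
proof -
  have "\<gamma> 0 \<in> box a b" using sub by (auto simp: path_image_def)
  then have ab: "Re a < Re b" "Im a < Im b" by (auto simp: in_box_complex_iff)
  have c\<gamma>: "continuous_on A \<gamma>" for A
    using d\<gamma> by (meson continuous_at_imp_continuous_on has_vector_derivative_continuous)
  have "\<gamma> C1_differentiable_on {0..1}"
    using d\<gamma> continuous_on_subset[OF c\<gamma>'] unfolding C1_differentiable_on_def by blast
  then have vp: "valid_path \<gamma>"
    unfolding valid_path_def by (rule C1_differentiable_imp_piecewise)
  have vd: "vector_derivative \<gamma> (at t) = \<gamma>' t" for t
    using d\<gamma> by (rule vector_derivative_at)
  have ci: "contour_integral \<gamma> f = integral {0..1} (\<lambda>t. f (\<gamma> t) * \<gamma>' t)" for f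
    by (simp add: contour_integral_integral vd)
  have cint: "f contour_integrable_on \<gamma>" if "continuous_on (path_image \<gamma>) f" for f
    unfolding contour_integrable_on vd
    by (intro integrable_continuous_real continuous_intros continuous_on_compose2[OF that c\<gamma>]
        continuous_on_subset[OF c\<gamma>']) (auto simp: path_image_def)
  have c\<psi>: "continuous_on A \<psi>" for A
    using d by (intro has_derivative_continuous_on) (blast intro: has_derivative_at_withinI)
  define q where "q = (\<lambda>w. px w + \<i> * py w)"
  have cq: "continuous_on A q" for A
    unfolding q_def using continuous_on_subset[OF px] continuous_on_subset[OF py]
    by (intro continuous_intros) auto
  have m: "q \<in> borel_measurable borel" "\<gamma> \<in> borel_measurable borel" "\<gamma>' \<in> borel_measurable borel"
    using cq c\<gamma> c\<gamma>' by (auto intro: borel_measurable_continuous_onI)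
  \<comment> \<open>The Cauchy transform of \<open>q\<close>; its contour integral along \<open>\<gamma>\<close> is computed in two ways.\<close>
  define K where "K = (\<lambda>\<zeta>. LINT w : cbox a b | lborel. q w / (w - \<zeta>))"
  define H where "H = (\<lambda>\<zeta>. contour_integral (rectpath a b) (\<lambda>w. \<psi> w / (w - \<zeta>)))"
  have K: "K \<zeta> = - \<i> * H \<zeta> - 2 * pi * \<psi> \<zeta>" if "\<zeta> \<in> box a b" for \<zeta>
    using Cauchy_Pompeiu_box[OF ab that d px py] by (simp add: K_def H_def q_def)
  have H: "H holomorphic_on box a b"
    unfolding H_def using ab by (intro holomorphic_Cauchy_rectpath c\<psi>) auto
  have H0: "(H has_contour_integral 0) \<gamma>"
    using Cauchy_theorem_convex_simple[OF H convex_box(2) vp sub loop] .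
  have "contour_integral \<gamma> K = contour_integral \<gamma> (\<lambda>\<zeta>. - \<i> * H \<zeta> - 2 * pi * \<psi> \<zeta>)"
    by (rule contour_integral_eq) (use K sub in auto)
  also have "\<dots> = - 2 * pi * contour_integral \<gamma> \<psi>"
  proof -
    have "((\<lambda>\<zeta>. - \<i> * H \<zeta> - 2 * pi * \<psi> \<zeta>) has_contour_integral
        - \<i> * 0 - 2 * pi * contour_integral \<gamma> \<psi>) \<gamma>"
      by (intro has_contour_integral_diff has_contour_integral_lmul H0 has_contour_integral_integral cint c\<psi>)
    then show ?thesis by (simp add: contour_integral_unique)
  qed
  finally have 1: "contour_integral \<gamma> K = - 2 * pi * contour_integral \<gamma> \<psi>" .

  define F where "F = (\<lambda>t w. indicator {0..1} t *\<^sub>R indicator (cbox a b) w *\<^sub>R (\<gamma>' t * (q w / (w - \<gamma> t))))"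
  have mF: "case_prod F \<in> borel_measurable (lborel \<Otimes>\<^sub>M lborel)"
    unfolding F_def case_prod_unfold using m by measurable
  obtain Q where Q: "\<And>w. w \<in> cbox a b \<Longrightarrow> cmod (q w) \<le> Q"
    using compact_imp_bounded[OF compact_continuous_image[OF cq compact_cbox[of a b]]]
    unfolding bounded_iff by blast
  have Q0: "Q \<ge> 0"
    using ab by (intro order_trans[OF norm_ge_zero Q[of a]]) (auto simp: in_cbox_complex_iff)
  obtain G where G: "\<And>t. t \<in> {0..1} \<Longrightarrow> cmod (\<gamma>' t) \<le> G"
    using compact_imp_bounded[OF compact_continuous_image[OF continuous_on_subset[OF c\<gamma>'] compact_Icc[of 0 1]]]
    unfolding bounded_iff by blast
  have G0: "G \<ge> 0" by (intro order_trans[OF norm_ge_zero G[of 0]]) simp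
  have bS: "bounded (cbox a b)" "cbox a b \<in> sets borel" by auto
  have "bounded (path_image \<gamma>)" using vp valid_path_imp_path bounded_path_image by blast
  from Cauchy_kernel_integral_bounded[OF bS this] obtain C where
    C: "\<And>\<zeta>. \<zeta> \<in> path_image \<gamma> \<Longrightarrow> (LINT w : cbox a b | lborel. 1 / cmod (w - \<zeta>)) \<le> C" by blast
  have kb: "cmod (q w / (w - \<zeta>)) \<le> Q / cmod (w - \<zeta>)" if "w \<in> cbox a b" for w \<zeta>
    using Q[OF that] by (simp add: norm_divide divide_right_mono)
  have iK: "set_integrable lborel (cbox a b) (\<lambda>w. q w / (w - \<zeta>))" for \<zeta>
    using m kb by (intro set_integrable_kernel_bound[where M = Q and \<zeta> = \<zeta>]) auto
  have iF: "integrable lborel (F t)" for t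
  proof -
    have "integrable lborel (\<lambda>w. indicator {0..1} t *\<^sub>R (\<gamma>' t * (indicator (cbox a b) w *\<^sub>R (q w / (w - \<gamma> t)))))"
      using iK[of "\<gamma> t"] unfolding set_integrable_def by (intro integrable_scaleR_right integrable_mult_right) auto
    then show ?thesis unfolding F_def by simp
  qed
  have nF: "(LBINT w. norm (F t w)) \<le> indicator {0..1} t * (G * (Q * C))" for t
  proof (cases "t \<in> {0..1}")
    case True
    have "(LBINT w. norm (F t w)) \<le> (LBINT w. (G * Q) * (indicator (cbox a b) w *\<^sub>R (1 / cmod (w - \<gamma> t))))"
    proof (rule integral_mono)
      show "integrable lborel (\<lambda>w. norm (F t w))" using iF by (rule integrable_norm)
      show "integrable lborel (\<lambda>w. (G * Q) * (indicator (cbox a b) w *\<^sub>R (1 / cmod (w - \<gamma> t))))"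
        using integrable_Cauchy_kernel[OF bS, of "\<gamma> t"] unfolding set_integrable_def
        by (rule integrable_mult_right)
      show "norm (F t w) \<le> (G * Q) * (indicator (cbox a b) w *\<^sub>R (1 / cmod (w - \<gamma> t)))" for w
      proof (cases "w \<in> cbox a b")
        case w: True
        have "norm (F t w) = cmod (\<gamma>' t) * cmod (q w / (w - \<gamma> t))"
          using True w by (simp add: F_def norm_mult norm_divide)
        also have "\<dots> \<le> G * (Q / cmod (w - \<gamma> t))"
          using kb[OF w] G[OF True] G0 by (intro mult_mono) auto
        finally show ?thesis using w by simp
      qed (simp add: F_def)
    qed
    also have "\<dots> = (G * Q) * (LINT w : cbox a b | lborel. 1 / cmod (w - \<gamma> t))"
      unfolding set_lebesgue_integral_def by (rule integral_mult_right_zero)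
    also have "\<dots> \<le> (G * Q) * C"
      using C[of "\<gamma> t"] True G0 Q0 by (intro mult_left_mono) (auto simp: path_image_def)
    finally show ?thesis using True by (simp add: mult.assoc)
  qed (simp add: F_def)
  have "integrable (lborel \<Otimes>\<^sub>M lborel) (case_prod F)"
  proof (rule lborel_pair.Fubini_integrable[OF mF])
    show "integrable lborel (\<lambda>t. LBINT w. norm (case_prod F (t, w)))"
    proof (rule Bochner_Integration.integrable_bound[where f = "\<lambda>t. indicator {0..1::real} t *\<^sub>R (G * (Q * C))"])
      show "(\<lambda>t. LBINT w. norm (case_prod F (t, w))) \<in> borel_measurable lborel"
        using mF by (intro lborel.borel_measurable_lebesgue_integral) (simp add: case_prod_unfold)
      show "AE t in lborel. norm (LBINT w. norm (case_prod F (t, w))) \<le> norm (indicator {0..1::real} t *\<^sub>R (G * (Q * C)))"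
      proof (intro AE_I2)
        fix t
        have "0 \<le> (LBINT w. norm (F t w))" by (intro integral_nonneg_AE) auto
        then show "norm (LBINT w. norm (case_prod F (t, w))) \<le> norm (indicator {0..1::real} t *\<^sub>R (G * (Q * C)))"
          using nF[of t] by simp
      qed
    qed auto
    show "AE t in lborel. integrable lborel (\<lambda>w. case_prod F (t, w))" using iF by simp
  qed
  note iFF = this
  then have fub: "(LBINT w. LBINT t. F t w) = (LBINT t. LBINT w. F t w)"
    by (rule lborel_pair.Fubini_integral)
  have "(LBINT t. LBINT w. F t w) = (LINT t : {0..1} | lborel. K (\<gamma> t) * \<gamma>' t)"
  proof -
    have "(LBINT w. F t w) = indicator {0..1} t *\<^sub>R (K (\<gamma> t) * \<gamma>' t)" for t
    proof -
      have "F t = (\<lambda>w. (indicator {0..1} t *\<^sub>R \<gamma>' t) * (indicator (cbox a b) w *\<^sub>R (q w / (w - \<gamma> t))))"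
        by (auto simp: F_def fun_eq_iff indicator_def)
      then have "(LBINT w. F t w) = (indicator {0..1} t *\<^sub>R \<gamma>' t) * K (\<gamma> t)"
        unfolding K_def set_lebesgue_integral_def by (simp only: integral_mult_right_zero)
      then show ?thesis by (simp add: mult.commute)
    qed
    then show ?thesis by (simp add: set_lebesgue_integral_def)
  qed
  also have "\<dots> = contour_integral \<gamma> K"
  proof -
    have "continuous_on (box a b) (\<lambda>\<zeta>. - \<i> * H \<zeta> - 2 * pi * \<psi> \<zeta>)"
      by (intro continuous_intros holomorphic_on_imp_continuous_on H c\<psi>)
    then have "continuous_on (box a b) K"
      by (rule continuous_on_eq) (simp add: K)
    then have "continuous_on {0..1} (\<lambda>t. K (\<gamma> t) * \<gamma>' t)"
      using sub by (intro continuous_intros continuous_on_compose2[OF _ c\<gamma>] continuous_on_subset[OF c\<gamma>'])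
        (auto simp: path_image_def)
    then show ?thesis
      unfolding ci by (intro set_borel_integral_eq_integral(2) borel_integrable_atLeastAtMost')
  qed
  finally have 2: "(LBINT t. LBINT w. F t w) = contour_integral \<gamma> K" .
  have "negligible (path_image \<gamma>)"
    unfolding path_image_def
    by (rule negligible_differentiable_image_lowdim)
      (use d\<gamma> in \<open>auto simp: differentiable_on_def intro!: differentiableI_vector intro: has_vector_derivative_at_within\<close>)
  then have "AE w in lborel. w \<notin> path_image \<gamma>"
    by (rule AE_lborel_negligible)
  moreover have "(LBINT t. F t w) = indicator (cbox a b) w *\<^sub>R (- 2 * pi * \<i> * (q w * winding_number \<gamma> w))"
    if w: "w \<notin> path_image \<gamma>" for w
  proof -
    have cc: "continuous_on {0..1} (\<lambda>t. \<gamma>' t * (1 / (w - \<gamma> t)))"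
      using w by (intro continuous_intros c\<gamma> continuous_on_subset[OF c\<gamma>']) (auto simp: path_image_def)
    have "(LBINT t. F t w) = (LINT t : {0..1} | lborel. \<gamma>' t * (1 / (w - \<gamma> t))) * (indicator (cbox a b) w *\<^sub>R q w)"
      unfolding set_lebesgue_integral_def F_def
      by (subst integral_mult_left_zero[symmetric]) (rule Bochner_Integration.integral_cong, auto)
    also have "(LINT t : {0..1} | lborel. \<gamma>' t * (1 / (w - \<gamma> t))) = integral {0..1} (\<lambda>t. \<gamma>' t * (1 / (w - \<gamma> t)))"
      by (intro set_borel_integral_eq_integral(2)) (use borel_integrable_atLeastAtMost'[OF cc] in simp)
    also have "\<dots> = - contour_integral \<gamma> (\<lambda>\<zeta>. 1 / (\<zeta> - w))"
      unfolding ci by (subst integral_neg[symmetric], rule arg_cong[where f = "integral _"])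
        (auto simp: fun_eq_iff minus_divide_right)
    also have "\<dots> = - 2 * pi * \<i> * winding_number \<gamma> w"
      using winding_number_valid_path[OF vp w] by simp
    finally show ?thesis by (simp add: mult_ac)
  qed
  ultimately have "AE w in lborel. (LBINT t. F t w) = indicator S w *\<^sub>R (- 2 * pi * \<i> * q w)"
    using S(2) by (auto elim!: eventually_mono simp: wind indicator_def)
  then have "(LBINT w. LBINT t. F t w) = (LINT w : S | lborel. - 2 * pi * \<i> * q w)"
    unfolding set_lebesgue_integral_def
    using lborel_pair.integrable_snd[OF iFF] m S by (intro integral_cong_AE) auto
  then have "(LINT w : S | lborel. - 2 * pi * \<i> * q w) = - 2 * pi * contour_integral \<gamma> \<psi>"
    using fub 1 2 by simp
  then have "- 2 * pi * \<i> * (LINT w : S | lborel. q w) = - 2 * pi * contour_integral \<gamma> \<psi>"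
    unfolding set_lebesgue_integral_def by (subst integral_mult_right_zero[symmetric]) simp
  then have "\<i> * (LINT w : S | lborel. q w) = contour_integral \<gamma> \<psi>"
    by simp
  then have "- \<i> * (\<i> * (LINT w : S | lborel. q w)) = - \<i> * contour_integral \<gamma> \<psi>"
    by simp
  then show ?thesis by (simp add: q_def flip: mult.assoc)
qed

section \<open>The Grunsky series of an exterior map\<close>

text \<open>
  The shape of the boundary enters through the exterior map, and its size through the vanishing of
  its area, which makes the integrals over \<open>D\<close> and over its closure agree.
\<close>

locale exterior_map =
  fixes D :: "complex set" and g :: "complex \<Rightarrow> complex" and r :: real and a :: "nat \<Rightarrow> nat \<Rightarrow> complex"
  assumes domain: "open D" "connected D" "bounded D" "D \<noteq> {}"
    and null: "negligible (frontier D)"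
    and g: "exterior_conformal_map D g r"
    and a: "Grunsky_coefficients g r a"
begin

lemma r_pos: "0 < r"
  and holo_g: "g holomorphic_on {z. 1 < cmod z}"
  and inj_g: "inj_on g {z. 1 < cmod z}"
  and image_g: "g ` {z. 1 < cmod z} = - closure D"
  using g unfolding exterior_conformal_map_def bij_betw_def by auto

text \<open>
  The series is only known to converge for \<open>\<zeta> \<noteq> z\<close>, but absolute convergence depends on the moduli
  alone; opposite signs of \<open>\<zeta>\<close> and \<open>z\<close> keep them apart.
\<close>

lemma abs_summable_Grunsky:
  assumes "1 < s" "1 < t"
  shows "(\<lambda>(k, l). cmod (a k l) / (s ^ k * t ^ l)) summable_on ({1..} \<times> {1..})"
proof -
  have "(\<lambda>(k, l). a k l / ((- of_real s) ^ k * (of_real t) ^ l)) summable_on ({1..} \<times> {1..})"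
    using a[unfolded Grunsky_coefficients_def, rule_format, of "- of_real s" "of_real t"] assms
    by (auto simp: summable_on_def complex_eq_iff)
  then have "(\<lambda>(k, l). cmod (a k l / ((- of_real s) ^ k * (of_real t) ^ l))) summable_on ({1..} \<times> {1..})"
    unfolding summable_on_iff_abs_summable_on_complex by (simp add: case_prod_unfold)
  then show ?thesis
    using assms by (simp add: norm_divide norm_mult norm_power)
qed

definition Grunsky_row :: "complex \<Rightarrow> nat \<Rightarrow> complex" where
  "Grunsky_row z k = (\<Sum>\<^sub>\<infinity>l\<in>{1..}. a k l / z ^ l)"

lemma abs_summable_Grunsky_row:
  assumes "1 < t" "1 \<le> k"
  shows "(\<lambda>l. cmod (a k l) / t ^ l) summable_on {1..}"
proof -
  have "(\<lambda>l. cmod (a k l) / (2 ^ k * t ^ l)) summable_on {1..}"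
    using summable_on_SigmaD1[OF abs_summable_Grunsky[of 2 t], of k] assms by simp
  then have "(\<lambda>l. 2 ^ k * (cmod (a k l) / (2 ^ k * t ^ l))) summable_on {1..}"
    by (rule summable_on_cmult_right)
  then show ?thesis by simp
qed

lemma has_sum_Grunsky_row:
  assumes "1 < cmod z" "1 \<le> k"
  shows "((\<lambda>l. a k l / z ^ l) has_sum Grunsky_row z k) {1..}"
  unfolding Grunsky_row_def
  using abs_summable_Grunsky_row[OF assms]
  by (intro has_sum_infsum) (simp add: summable_on_iff_abs_summable_on_complex norm_divide norm_power)

text \<open>
  For fixed \<open>z\<close> this is the negative logarithm of \<open>(g \<zeta> - g z) / (r (\<zeta> - z))\<close> as a power series in
  \<open>1 / \<zeta>\<close>.
\<close>

definition Grunsky_fps :: "complex \<Rightarrow> complex fps" where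
  "Grunsky_fps z = Abs_fps (\<lambda>k. if k = 0 then 0 else Grunsky_row z k)"

lemma abs_summable_Grunsky_fps:
  assumes "1 < cmod z" "1 < s"
  shows "summable (\<lambda>k. norm (fps_nth (Grunsky_fps z) k * of_real (1 / s) ^ k))"
proof -
  have "(\<lambda>k. \<Sum>\<^sub>\<infinity>l\<in>{1..}. cmod (a k l) / (s ^ k * cmod z ^ l)) summable_on {1..}"
    using summable_on_SigmaD[OF abs_summable_Grunsky[OF assms(2,1)]] 
      summable_on_SigmaD1[OF abs_summable_Grunsky[OF assms(2,1)]] by simp
  then have "(\<lambda>k. norm (Grunsky_row z k * of_real (1 / s) ^ k)) summable_on {1..}"
  proof (rule Infinite_Sum.abs_summable_on_comparison_test')
    fix k :: nat
    assume k: "k \<in> {1..}"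
    have s: "(\<lambda>l. cmod (a k l) / cmod z ^ l) summable_on {1..}"
      using abs_summable_Grunsky_row[OF assms(1)] k by simp
    have "norm (Grunsky_row z k) \<le> (\<Sum>\<^sub>\<infinity>l\<in>{1..}. cmod (a k l) / cmod z ^ l)"
      unfolding Grunsky_row_def using norm_infsum_bound[of "\<lambda>l. a k l / z ^ l" "{1..}"] s
      by (simp add: norm_divide norm_power)
    then have "norm (Grunsky_row z k) * (1 / s) ^ k \<le> (\<Sum>\<^sub>\<infinity>l\<in>{1..}. cmod (a k l) / cmod z ^ l) * (1 / s) ^ k"
      using assms by (intro mult_right_mono) auto
    also have "\<dots> = (\<Sum>\<^sub>\<infinity>l\<in>{1..}. cmod (a k l) / cmod z ^ l * (1 / s) ^ k)"
      using s by (intro infsum_cmult_left[symmetric])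
    also have "\<dots> = (\<Sum>\<^sub>\<infinity>l\<in>{1..}. cmod (a k l) / (s ^ k * cmod z ^ l))"
      by (simp add: power_divide field_simps)
    finally show "norm (Grunsky_row z k * of_real (1 / s) ^ k) \<le> (\<Sum>\<^sub>\<infinity>l\<in>{1..}. cmod (a k l) / (s ^ k * cmod z ^ l))"
      using assms by (simp add: norm_mult norm_power norm_divide)
  qed
  then have "(\<lambda>k. norm (fps_nth (Grunsky_fps z) k * of_real (1 / s) ^ k)) summable_on {1..}"
    by (rule summable_on_cong[THEN iffD1, rotated]) (auto simp: Grunsky_fps_def)
  then have "(\<lambda>k. norm (fps_nth (Grunsky_fps z) k * of_real (1 / s) ^ k)) summable_on UNIV"
    by (rule summable_on_cong_neutral[THEN iffD1, rotated -1]) (auto simp: Grunsky_fps_def)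
  then show ?thesis by (rule summable_on_imp_summable)
qed

lemma conv_radius_Grunsky_fps:
  assumes "1 < cmod z"
  shows "fps_conv_radius (Grunsky_fps z) \<ge> 1"
proof (rule ccontr)
  assume "\<not> fps_conv_radius (Grunsky_fps z) \<ge> 1"
  then obtain c where c: "fps_conv_radius (Grunsky_fps z) < ereal c" "ereal c < ereal 1"
    using ereal_dense2 by (metis linorder_not_le one_ereal_def)
  have c0: "0 < c"
    using order_le_less_trans[OF conv_radius_nonneg c(1)[unfolded fps_conv_radius_def]] by simp
  have "summable (\<lambda>k. fps_nth (Grunsky_fps z) k * of_real c ^ k)"
    using abs_summable_Grunsky_fps[OF assms, of "1 / c"] c c0 by (auto intro: summable_norm_cancel)
  then have "ereal c \<le> fps_conv_radius (Grunsky_fps z)"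
    unfolding fps_conv_radius_def using conv_radius_geI[of _ "of_real c :: complex"] c0 by simp
  then show False using c(1) by simp
qed

lemma holomorphic_Grunsky_fps:
  assumes "1 < cmod z"
  shows "eval_fps (Grunsky_fps z) holomorphic_on ball 0 1"
proof (rule holomorphic_on_eval_fps)
  show "ball 0 1 \<subseteq> eball 0 (fps_conv_radius (Grunsky_fps z))"
    using order_less_le_trans[OF _ conv_radius_Grunsky_fps[OF assms]] by (auto simp: in_eball_iff one_ereal_def)
qed

text \<open>
  Summing the double series first over \<open>l\<close> and then over \<open>k\<close> gives an identity that also holds on the
  diagonal and whose exponent is holomorphic in \<open>\<zeta>\<close>.
\<close>

lemma difference_quotient_g:
  assumes z: "1 < cmod z" and "1 < cmod \<zeta>"
  shows "g \<zeta> - g z = (\<zeta> - z) * (of_real r * exp (- eval_fps (Grunsky_fps z) (1 / \<zeta>)))"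
proof (cases "\<zeta> = z")
  case False
  obtain S where S: "((\<lambda>(k, l). a k l / (\<zeta> ^ k * z ^ l)) has_sum S) ({1..} \<times> {1..})"
    and e: "exp (of_real (ln r) - S) = (g \<zeta> - g z) / (\<zeta> - z)"
    using a assms False unfolding Grunsky_coefficients_def by blast
  have "((\<lambda>k. Grunsky_row z k / \<zeta> ^ k) has_sum S) {1..}"
  proof (rule has_sum_SigmaD[OF S])
    fix k :: nat
    assume "k \<in> {1..}"
    then have "((\<lambda>l. (1 / \<zeta> ^ k) * (a k l / z ^ l)) has_sum (1 / \<zeta> ^ k) * Grunsky_row z k) {1..}"
      using has_sum_Grunsky_row[OF z, of k] by (intro has_sum_cmult_right) auto
    then show "((\<lambda>l. case (k, l) of (k, l) \<Rightarrow> a k l / (\<zeta> ^ k * z ^ l)) has_sum Grunsky_row z k / \<zeta> ^ k) {1..}"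
      by (simp add: field_simps)
  qed
  then have "((\<lambda>k. fps_nth (Grunsky_fps z) k * (1 / \<zeta>) ^ k) has_sum S) UNIV"
    by (rule has_sum_cong_neutral[THEN iffD1, rotated -1]) (auto simp: Grunsky_fps_def power_divide)
  then have "eval_fps (Grunsky_fps z) (1 / \<zeta>) = S"
    unfolding eval_fps_def by (intro sums_unique[symmetric] has_sum_imp_sums)
  moreover have "exp (of_real (ln r)) = (of_real r :: complex)"
    using r_pos by (simp add: exp_of_real)
  ultimately show ?thesis
    using e False by (simp add: exp_diff exp_minus field_simps)
qed simp

end

section \<open>Level curves of the exterior map\<close>

context exterior_map begin

text \<open>
  The expansion converges at one point, hence in a full neighbourhood of infinity.
\<close>

lemma g_fps_expansion_at_infinity:
  obtains G R where "0 < fps_conv_radius G" "1 < R"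
    "\<And>z. R \<le> cmod z \<Longrightarrow> g z = of_real r * z + eval_fps G (1 / z)"
proof -
  obtain c where c: "\<forall>\<^sub>F z in at_infinity. (\<lambda>k. c k / z ^ k) sums (g z - of_real r * z)"
    using g unfolding exterior_conformal_map_def by blast
  then obtain b where b: "\<And>z. b \<le> cmod z \<Longrightarrow> (\<lambda>k. c k / z ^ k) sums (g z - of_real r * z)"
    unfolding eventually_at_infinity by blast
  define R where "R = max b 2"
  define G where "G = Abs_fps c"
  have s: "(\<lambda>k. fps_nth G k * (1 / z) ^ k) sums (g z - of_real r * z)" if "R \<le> cmod z" for z
    using b[of z] that by (simp add: G_def R_def power_divide)
  have "summable (\<lambda>k. fps_nth G k * (1 / of_real R) ^ k)"
    using s[of "of_real R"] by (auto simp: R_def sums_iff)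
  then have "ereal (norm (1 / of_real R :: complex)) \<le> fps_conv_radius G"
    unfolding fps_conv_radius_def by (rule conv_radius_geI)
  moreover have "0 < ereal (norm (1 / of_real R :: complex))"
    by (simp add: R_def norm_divide)
  ultimately have "0 < fps_conv_radius G" by (rule order_less_le_trans[rotated])
  moreover have "g z = of_real r * z + eval_fps G (1 / z)" if "R \<le> cmod z" for z
    using s[OF that] unfolding eval_fps_def by (simp add: sums_iff)
  ultimately show ?thesis using that[of G R] by (simp add: R_def)
qed

lemma g_near_infinity:
  obtains M R where "\<And>z. R \<le> cmod z \<Longrightarrow> cmod (g z - of_real r * z) \<le> M"
proof -
  obtain G R where G: "0 < fps_conv_radius G" "1 < R"
    "\<And>z. R \<le> cmod z \<Longrightarrow> g z = of_real r * z + eval_fps G (1 / z)"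
    using g_fps_expansion_at_infinity by blast
  have "isCont (eval_fps G) 0"
    using G(1) by (intro continuous_eval_fps) (auto simp: zero_ereal_def)
  then obtain d where d: "d > 0" "\<And>u. cmod u < d \<Longrightarrow> cmod (eval_fps G u - eval_fps G 0) < 1"
    unfolding continuous_at_eps_delta by (auto simp: dist_norm dest!: spec[of _ "1::real"])
  show ?thesis
  proof (rule that)
    fix z :: complex
    assume z: "max R (2 / d) \<le> cmod z"
    then have "0 < cmod z" using G(2) by linarith
    moreover have "1 < d * cmod z"
      using z d(1) mult_left_mono[of "2 / d" "cmod z" d] by simp
    ultimately have "cmod (1 / z) < d" by (simp add: norm_divide field_simps)
    then have "cmod (eval_fps G (1 / z) - eval_fps G 0) < 1" by (rule d(2))
    then have "cmod (eval_fps G (1 / z)) \<le> cmod (eval_fps G 0) + 1"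
      using norm_triangle_ineq[of "eval_fps G (1 / z) - eval_fps G 0" "eval_fps G 0"] by simp
    then show "cmod (g z - of_real r * z) \<le> cmod (eval_fps G 0) + 1"
      using G(3)[of z] z by simp
  qed
qed

text \<open>
  The map \<open>g\<close> is proper because \<open>g z\<close> differs from \<open>r z\<close> by a bounded function near infinity.
\<close>

lemma closed_image_g:
  assumes "1 < \<rho>"
  shows "closed (g ` {z. \<rho> \<le> cmod z})"
  unfolding closed_sequential_limits
proof (intro allI impI, elim conjE)
  fix x l
  assume x: "\<forall>n. x n \<in> g ` {z. \<rho> \<le> cmod z}" and l: "x \<longlonglongrightarrow> l"
  obtain M R where M: "\<And>z. R \<le> cmod z \<Longrightarrow> cmod (g z - of_real r * z) \<le> M"
    using g_near_infinity by blast
  have "\<forall>n. \<exists>w. \<rho> \<le> cmod w \<and> x n = g w"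
    using x by blast
  then obtain z where z: "\<And>n. \<rho> \<le> cmod (z n)" "\<And>n. x n = g (z n)"
    by metis
  obtain B where B: "\<And>n. cmod (x n) \<le> B"
    using convergent_imp_bounded[OF l] unfolding bounded_iff by blast
  have "cmod (z n) \<le> max R ((B + M) / r)" for n
  proof (cases "R \<le> cmod (z n)")
    case True
    have "cmod (of_real r * z n) \<le> cmod (g (z n)) + cmod (g (z n) - of_real r * z n)"
      using norm_triangle_ineq4[of "g (z n)" "g (z n) - of_real r * z n"] by simp
    also have "\<dots> \<le> B + M"
      using B[of n] M[OF True] z(2)[of n] by simp
    finally have "cmod (z n) \<le> (B + M) / r"
      using r_pos by (simp add: norm_mult field_simps)
    then show ?thesis by simp
  qed simp
  then have "bounded (range z)" unfolding bounded_iff by blast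
  then obtain w s where s: "strict_mono s" "(z \<circ> s) \<longlonglongrightarrow> w"
    using bounded_imp_convergent_subsequence by blast
  have w: "\<rho> \<le> cmod w"
    using s(2) z(1) by (intro LIMSEQ_le_const[OF tendsto_norm[OF s(2)]]) auto
  have "open {z::complex. 1 < cmod z}"
    by (intro open_Collect_less continuous_intros)
  then have "isCont g w"
    using holo_g w assms by (intro continuous_on_interior[OF holomorphic_on_imp_continuous_on]) (auto simp: interior_open)
  then have "(\<lambda>n. g (z (s n))) \<longlonglongrightarrow> g w"
    using isCont_tendsto_compose[of w g "z \<circ> s"] s(2) by (simp add: o_def)
  moreover have "(\<lambda>n. g (z (s n))) \<longlonglongrightarrow> l"
    using LIMSEQ_subseq_LIMSEQ[OF l s(1)] z(2) by (simp add: o_def)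
  ultimately have "l = g w" using LIMSEQ_unique by blast
  then show "l \<in> g ` {z. \<rho> \<le> cmod z}" using w by blast
qed

text \<open>
  The inside of the level curve \<open>g(|z| = \<rho>)\<close>.
\<close>

definition region :: "real \<Rightarrow> complex set" where
  "region \<rho> = - g ` {z. \<rho> \<le> cmod z}"

lemma open_region: "1 < \<rho> \<Longrightarrow> open (region \<rho>)"
  using closed_image_g unfolding region_def by auto

lemma closure_subset_region: "1 < \<rho> \<Longrightarrow> closure D \<subseteq> region \<rho>"
  using image_g unfolding region_def by force

lemma g_in_region_iff:
  assumes "1 < \<rho>" "1 < cmod z"
  shows "g z \<in> region \<rho> \<longleftrightarrow> cmod z < \<rho>"
proof
  show "cmod z < \<rho>" if "g z \<in> region \<rho>"
    using that by (auto simp: region_def not_le[symmetric])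
  show "g z \<in> region \<rho>" if "cmod z < \<rho>"
  proof (rule ccontr)
    assume "g z \<notin> region \<rho>"
    then obtain z' where "\<rho> \<le> cmod z'" "g z = g z'" by (auto simp: region_def)
    then show False using inj_onD[OF inj_g, of z z'] assms that by auto
  qed
qed

lemma open_exterior_disc: "open {z::complex. 1 < cmod z}"
  by (intro open_Collect_less continuous_intros)

lemma deriv_g: "1 < cmod z \<Longrightarrow> (g has_field_derivative deriv g z) (at z)"
  using holomorphic_derivI[OF holo_g open_exterior_disc] by simp

lemma has_vector_derivative_g_circle:
  assumes "1 < \<rho>"
  shows "((g \<circ> circlepath 0 \<rho>) has_vector_derivative
    (2 * pi * \<i> * \<rho> * exp (2 * of_real pi * \<i> * t)) * deriv g (circlepath 0 \<rho> t)) (at t)"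
proof -
  have "cmod (circlepath 0 \<rho> t) = \<rho>"
    using assms by (simp add: circlepath norm_mult)
  then have "1 < cmod (circlepath 0 \<rho> t)" using assms by simp
  from field_vector_diff_chain_at[OF has_vector_derivative_circlepath deriv_g[OF this]]
  show ?thesis by simp
qed

lemma contour_integral_g_circle:
  assumes "1 < \<rho>"
  shows "contour_integral (g \<circ> circlepath 0 \<rho>) f = contour_integral (circlepath 0 \<rho>) (\<lambda>z. f (g z) * deriv g z)"
  unfolding contour_integral_integral vector_derivative_at[OF has_vector_derivative_g_circle[OF assms]]
  by (intro integral_cong) (simp add: vector_derivative_circlepath)

lemma valid_path_g_circle: "1 < \<rho> \<Longrightarrow> valid_path (g \<circ> circlepath 0 \<rho>)"
  by (rule valid_path_compose_holomorphic[OF _ holo_g open_exterior_disc]) auto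

lemma path_image_g_circle: "1 < \<rho> \<Longrightarrow> path_image (g \<circ> circlepath 0 \<rho>) = g ` sphere 0 \<rho>"
  by (simp add: path_image_compose)

text \<open>
  By \<open>difference_quotient_g\<close> the logarithmic derivative of \<open>g \<zeta> - g z\<close> is that of \<open>\<zeta> - z\<close> minus the derivative
  of a function holomorphic in the exterior disc, so the winding number agrees with that of the
  circle around \<open>z\<close>.
\<close>

lemma winding_number_g_circle:
  assumes \<rho>: "1 < \<rho>" and z: "1 < cmod z" "cmod z \<noteq> \<rho>"
  shows "winding_number (g \<circ> circlepath 0 \<rho>) (g z) = (if cmod z < \<rho> then 1 else 0)"
proof -
  let ?U = "{\<zeta>::complex. 1 < cmod \<zeta>}"
  let ?\<gamma> = "circlepath 0 \<rho>"
  define M where "M = (\<lambda>\<zeta>. eval_fps (Grunsky_fps z) (1 / \<zeta>))"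
  have hM: "M holomorphic_on ?U"
    unfolding M_def
  proof (rule holomorphic_on_compose_gen[OF _ holomorphic_Grunsky_fps[OF z(1)], unfolded o_def])
    show "(\<lambda>\<zeta>. 1 / \<zeta>) holomorphic_on ?U" by (intro holomorphic_intros) auto
    show "(\<lambda>\<zeta>. 1 / \<zeta>) ` ?U \<subseteq> ball 0 1"
      by (auto simp: norm_divide norm_inverse divide_inverse inverse_less_1_iff)
  qed
  have dM: "(M has_field_derivative deriv M \<zeta>) (at \<zeta>)" if "1 < cmod \<zeta>" for \<zeta>
    using holomorphic_derivI[OF hM open_exterior_disc] that by simp
  have gz: "g \<zeta> - g z = (\<zeta> - z) * (of_real r * exp (- M \<zeta>))" if "1 < cmod \<zeta>" for \<zeta>
    using difference_quotient_g[OF z(1) that] by (simp add: M_def)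
  have dg: "deriv g \<zeta> = of_real r * exp (- M \<zeta>) * (1 - (\<zeta> - z) * deriv M \<zeta>)" if \<zeta>: "1 < cmod \<zeta>" for \<zeta>
  proof -
    have "((\<lambda>\<zeta>. g z + (\<zeta> - z) * (of_real r * exp (- M \<zeta>))) has_field_derivative
        of_real r * exp (- M \<zeta>) * (1 - (\<zeta> - z) * deriv M \<zeta>)) (at \<zeta>)"
      by (rule derivative_eq_intros dM \<zeta> refl | simp add: algebra_simps)+
    then have "(g has_field_derivative of_real r * exp (- M \<zeta>) * (1 - (\<zeta> - z) * deriv M \<zeta>)) (at \<zeta>)"
      by (rule has_field_derivative_transform_within_open[OF _ open_exterior_disc])
        (use \<zeta> gz in \<open>auto simp flip: gz\<close>)
    then show ?thesis by (rule DERIV_imp_deriv)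
  qed
  have on: "1 < cmod \<zeta>" "\<zeta> \<noteq> z" if "\<zeta> \<in> path_image ?\<gamma>" for \<zeta>
    using that \<rho> z by auto
  have zim: "z \<notin> path_image ?\<gamma>" using z \<rho> by auto
  have gzim: "g z \<notin> path_image (g \<circ> ?\<gamma>)"
  proof
    assume "g z \<in> path_image (g \<circ> ?\<gamma>)"
    then obtain z' where "z' \<in> sphere 0 \<rho>" "g z = g z'" using path_image_g_circle[OF \<rho>] by auto
    then show False using inj_onD[OF inj_g, of z z'] z \<rho> by auto
  qed
  have int1: "(\<lambda>\<zeta>. 1 / (\<zeta> - z)) contour_integrable_on ?\<gamma>"
    using zim \<rho> by (intro contour_integrable_continuous_circlepath continuous_intros) auto
  have int2: "(deriv M has_contour_integral 0) ?\<gamma>"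
    by (rule Cauchy_theorem_primitive[of ?U M])
      (use dM \<rho> in \<open>auto intro: has_field_derivative_at_within\<close>)
  have "contour_integral (g \<circ> ?\<gamma>) (\<lambda>w. 1 / (w - g z)) = contour_integral ?\<gamma> (\<lambda>\<zeta>. 1 / (\<zeta> - z) - deriv M \<zeta>)"
    unfolding contour_integral_g_circle[OF \<rho>]
  proof (rule contour_integral_eq)
    fix \<zeta> assume "\<zeta> \<in> path_image ?\<gamma>"
    note \<zeta> = on[OF this]
    show "1 / (g \<zeta> - g z) * deriv g \<zeta> = 1 / (\<zeta> - z) - deriv M \<zeta>"
      unfolding gz[OF \<zeta>(1)] dg[OF \<zeta>(1)] using \<zeta>(2) r_pos by (simp add: field_simps)
  qed
  also have "\<dots> = contour_integral ?\<gamma> (\<lambda>\<zeta>. 1 / (\<zeta> - z))"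
    using has_contour_integral_diff[OF has_contour_integral_integral[OF int1] int2]
    by (simp add: contour_integral_unique)
  finally have "winding_number (g \<circ> ?\<gamma>) (g z) = winding_number ?\<gamma> z"
    using winding_number_valid_path[OF valid_path_g_circle[OF \<rho>] gzim]
      winding_number_valid_path[OF valid_path_circlepath zim] by simp
  also have "\<dots> = (if cmod z < \<rho> then 1 else 0)"
  proof (cases "cmod z < \<rho>")
    case True
    then show ?thesis by (simp add: winding_number_circlepath)
  next
    case False
    have "winding_number ?\<gamma> z = 0"
      by (rule winding_number_zero_outside[of _ "cball 0 \<rho>"]) (use False z \<rho> in auto)
    then show ?thesis using False by simp
  qed
  finally show ?thesis .
qed

text \<open>
  For points outside the closure of \<open>D\<close> this is \<open>winding_number_g_circle\<close>.  The closure of \<open>D\<close> is connected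
  and avoids the curve; as it is neither empty nor the whole plane, it has a boundary point, near
  which there are points \<open>g z\<close> with \<open>1 < |z| < \<rho>\<close>, and the winding number is locally constant.
\<close>

lemma winding_number_g_circle_region:
  assumes \<rho>: "1 < \<rho>" and w: "w \<notin> path_image (g \<circ> circlepath 0 \<rho>)"
  shows "winding_number (g \<circ> circlepath 0 \<rho>) w = indicator (region \<rho>) w"
proof -
  let ?\<gamma> = "g \<circ> circlepath 0 \<rho>"
  have loop: "path ?\<gamma>" "pathfinish ?\<gamma> = pathstart ?\<gamma>"
    using valid_path_g_circle[OF \<rho>] valid_path_imp_path by (auto simp: pathfinish_compose pathstart_compose)
  have outside: "winding_number ?\<gamma> (g z) = indicator (region \<rho>) (g z)"
    if "1 < cmod z" "g z \<notin> path_image ?\<gamma>" for z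
  proof -
    have "cmod z \<noteq> \<rho>" using that path_image_g_circle[OF \<rho>] by auto
    then show ?thesis
      using winding_number_g_circle[OF \<rho> that(1)] g_in_region_iff[OF \<rho> that(1)] by (simp add: indicator_def)
  qed
  have disj: "region \<rho> \<inter> path_image ?\<gamma> = {}"
    using path_image_g_circle[OF \<rho>] by (auto simp: region_def)
  show ?thesis
  proof (cases "w \<in> closure D")
    case False
    then obtain z where "1 < cmod z" "w = g z" using image_g by blast
    then show ?thesis using outside w by blast
  next
    case True
    have "closure D \<noteq> UNIV" using domain(3) bounded_closure not_bounded_UNIV by metis
    moreover have "closure D \<noteq> {}" using True by auto
    ultimately obtain p where p: "p \<in> frontier (closure D)"
      using frontier_not_empty by blast
    then have pD: "p \<in> closure D" using frontier_subset_closed[of "closure D"] by auto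
    then obtain e where e: "e > 0" "ball p e \<subseteq> region \<rho>"
      using open_region[OF \<rho>] closure_subset_region[OF \<rho>] open_contains_ball by blast
    obtain w' where w': "w' \<in> ball p e" "w' \<notin> closure D"
      using p e(1) by (auto simp: frontier_straddle dist_commute)
    then obtain z where z: "1 < cmod z" "w' = g z" using image_g by blast
    have "w' \<in> region \<rho>" using w'(1) e(2) by blast
    then have 1: "winding_number ?\<gamma> w' = 1"
      using outside[OF z(1)] z(2) disj by auto
    have "connected (closure D \<union> ball p e)"
      using domain(2) pD e(1) by (intro connected_Un connected_imp_connected_closure) auto
    then have "winding_number ?\<gamma> w = winding_number ?\<gamma> w'"
      using loop True w'(1) disj e(2) closure_subset_region[OF \<rho>]
      by (intro winding_number_eq[where S = "closure D \<union> ball p e"]) auto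
    then show ?thesis using 1 True closure_subset_region[OF \<rho>] by auto
  qed
qed

text \<open>
  A curve has winding number zero around the points outside a convex set that contains it.
\<close>

lemma region_subset_box:
  assumes "1 < \<rho>" "path_image (g \<circ> circlepath 0 \<rho>) \<subseteq> cbox s t"
  shows "region \<rho> \<subseteq> cbox s t"
proof
  fix w assume w: "w \<in> region \<rho>"
  then have wn: "w \<notin> path_image (g \<circ> circlepath 0 \<rho>)"
    using path_image_g_circle[OF assms(1)] by (auto simp: region_def)
  show "w \<in> cbox s t"
  proof (rule ccontr)
    assume "w \<notin> cbox s t"
    then have "winding_number (g \<circ> circlepath 0 \<rho>) w = 0"
      using valid_path_g_circle[OF assms(1)] assms(2)
      by (intro winding_number_zero_outside[of _ "cbox s t"])
        (auto simp: pathfinish_compose pathstart_compose valid_path_imp_path convex_box)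
    then show False using winding_number_g_circle_region[OF assms(1) wn] w by simp
  qed
qed

end

section \<open>Green's theorem on the level regions\<close>

lemma has_derivative_poly_cnj_poly:
  fixes p q :: "complex poly"
  shows "((\<lambda>w. poly p w * cnj (poly q w)) has_derivative
    (\<lambda>v. Re v *\<^sub>R (poly (pderiv p) w * cnj (poly q w) + poly p w * cnj (poly (pderiv q) w))
       + Im v *\<^sub>R (\<i> * (poly (pderiv p) w * cnj (poly q w)) - \<i> * (poly p w * cnj (poly (pderiv q) w))))) (at w)"
proof -
  have 1: "(poly p has_derivative (\<lambda>v. poly (pderiv p) w * v)) (at w)"
    using poly_DERIV[of p w] by (simp add: has_field_derivative_def)
  have "(poly q has_derivative (\<lambda>v. poly (pderiv q) w * v)) (at w)"
    using poly_DERIV[of q w] by (simp add: has_field_derivative_def)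
  then have 2: "((\<lambda>w. cnj (poly q w)) has_derivative (\<lambda>v. cnj (poly (pderiv q) w * v))) (at w)"
    by (rule has_derivative_cnj)
  show ?thesis
  proof (rule has_derivative_eq_rhs[OF has_derivative_mult[OF 1 2]], rule ext)
    fix v :: complex
    show "poly p w * cnj (poly (pderiv q) w * v) + poly (pderiv p) w * v * cnj (poly q w)
       = Re v *\<^sub>R (poly (pderiv p) w * cnj (poly q w) + poly p w * cnj (poly (pderiv q) w))
       + Im v *\<^sub>R (\<i> * (poly (pderiv p) w * cnj (poly q w)) - \<i> * (poly p w * cnj (poly (pderiv q) w)))"
      by (subst (1 2) complex_eq[of v]) (simp add: scaleR_conv_of_real algebra_simps)
  qed
qed

context exterior_map begin

lemma continuous_deriv_g: "continuous_on {z. 1 < cmod z} (deriv g)"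
  by (intro holomorphic_on_imp_continuous_on holomorphic_deriv holo_g open_exterior_disc)

lemma bounded_g_circle: "1 < \<rho> \<Longrightarrow> bounded (path_image (g \<circ> circlepath 0 \<rho>))"
  by (intro bounded_path_image valid_path_imp_path valid_path_g_circle)

lemma bounded_region: "1 < \<rho> \<Longrightarrow> bounded (region \<rho>)"
  using bounded_subset_cbox_symmetric[OF bounded_g_circle] region_subset_box bounded_subset bounded_cbox
  by metis

text \<open>
  Green's theorem for \<open>\<psi> = p' cnj q\<close>: as \<open>p'\<close> is holomorphic, the derivative of \<open>\<psi>\<close> with respect to the
  conjugate variable is \<open>p' cnj q'\<close>.
\<close>

lemma integral_region_pderiv:
  fixes p q :: "complex poly"
  assumes \<rho>: "1 < \<rho>"
  shows "(LINT w : region \<rho> | lborel. poly (pderiv p) w * cnj (poly (pderiv q) w))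
    = contour_integral (circlepath 0 \<rho>) (\<lambda>z. poly (pderiv p) (g z) * deriv g z * cnj (poly q (g z))) / (2 * \<i>)"
proof -
  let ?\<gamma> = "g \<circ> circlepath 0 \<rho>"
  let ?P = "\<lambda>w. poly (pderiv (pderiv p)) w * cnj (poly q w)"
  let ?Q = "\<lambda>w. poly (pderiv p) w * cnj (poly (pderiv q) w)"
  obtain t where t: "path_image ?\<gamma> \<subseteq> box (- t) t"
    using bounded_subset_box_symmetric[OF bounded_g_circle[OF \<rho>]] by blast
  have im: "circlepath 0 \<rho> x \<in> {z. 1 < cmod z}" for x
    using \<rho> by (simp add: circlepath norm_mult)
  have "(LINT w : region \<rho> | lborel. (?P w + ?Q w) + \<i> * (\<i> * ?P w - \<i> * ?Q w))
      = - \<i> * contour_integral ?\<gamma> (\<lambda>w. poly (pderiv p) w * cnj (poly q w))"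
  proof (rule Green_winding_number[OF has_derivative_poly_cnj_poly _ _ has_vector_derivative_g_circle[OF \<rho>] _ _ t])
    show "region \<rho> \<subseteq> cbox (- t) t"
      using t box_subset_cbox by (intro region_subset_box \<rho>) blast
    show "region \<rho> \<in> sets borel" using open_region[OF \<rho>] by simp
    show "winding_number ?\<gamma> w = indicator (region \<rho>) w" if "w \<notin> path_image ?\<gamma>" for w
      using winding_number_g_circle_region[OF \<rho> that] by (simp add: indicator_def)
    show "continuous_on UNIV (\<lambda>t. 2 * pi * \<i> * \<rho> * exp (2 * of_real pi * \<i> * t) * deriv g (circlepath 0 \<rho> t))"
      by (intro continuous_intros continuous_on_compose2[OF continuous_deriv_g])
        (use im in \<open>auto simp: circlepath intro!: continuous_intros\<close>)
  qed (auto intro!: continuous_intros simp: pathfinish_compose pathstart_compose)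
  moreover have "(?P w + ?Q w) + \<i> * (\<i> * ?P w - \<i> * ?Q w) = 2 * ?Q w" for w
    by (simp add: algebra_simps)
  ultimately have "(LINT w : region \<rho> | lborel. 2 * ?Q w)
      = - \<i> * contour_integral ?\<gamma> (\<lambda>w. poly (pderiv p) w * cnj (poly q w))"
    by simp
  moreover have "(LINT w : region \<rho> | lborel. 2 * ?Q w) = 2 * (LINT w : region \<rho> | lborel. ?Q w)"
    unfolding set_lebesgue_integral_def by (subst integral_mult_right_zero[symmetric]) simp
  ultimately show ?thesis
    unfolding contour_integral_g_circle[OF \<rho>] by (simp add: field_simps)
qed

text \<open>
  The regions decrease to the closure of \<open>D\<close>, and the frontier of \<open>D\<close> is a null set.
\<close>

lemma integral_region_tendsto:
  fixes f :: "complex \<Rightarrow> complex" and \<rho> :: "nat \<Rightarrow> real"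
  assumes f: "continuous_on UNIV f" and \<rho>: "\<And>n. 1 < \<rho> n" "\<And>n. \<rho> n \<le> 2" "\<rho> \<longlonglongrightarrow> 1"
  shows "(\<lambda>n. LINT w : region (\<rho> n) | lborel. f w) \<longlonglongrightarrow> (LINT w : D | lborel. f w)"
proof -
  have mf: "f \<in> borel_measurable borel" using f by (rule borel_measurable_continuous_onI)
  have mono: "region (\<rho> n) \<subseteq> region 2" for n using \<rho>(2)[of n] by (auto simp: region_def)
  obtain t where t: "region 2 \<subseteq> cbox (- t) t"
    using bounded_subset_cbox_symmetric[OF bounded_region[of 2]] by auto
  have int: "integrable lborel (\<lambda>w. indicator (cbox (- t) t) w *\<^sub>R norm (f w))"
    using borel_integrable_compact[of "cbox (-t) t" "\<lambda>w. norm (f w)"] continuous_on_subset[OF f]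
    by (auto simp: set_integrable_def intro!: continuous_intros)
  have "(\<lambda>n. LINT w : region (\<rho> n) | lborel. f w) \<longlonglongrightarrow> (LINT w : closure D | lborel. f w)"
    unfolding set_lebesgue_integral_def
  proof (rule integral_dominated_convergence[OF _ _ int])
    show "AE w in lborel. (\<lambda>n. indicator (region (\<rho> n)) w *\<^sub>R f w) \<longlonglongrightarrow> indicator (closure D) w *\<^sub>R f w"
    proof (intro AE_I2)
      fix w
      show "(\<lambda>n. indicator (region (\<rho> n)) w *\<^sub>R f w) \<longlonglongrightarrow> indicator (closure D) w *\<^sub>R f w"
      proof (cases "w \<in> closure D")
        case True
        then have "w \<in> region (\<rho> n)" for n using closure_subset_region[OF \<rho>(1)] by blast
        then show ?thesis using True by simp
      next
        case False
        then obtain z where z: "1 < cmod z" "w = g z"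
          using image_g by blast
        have "\<forall>\<^sub>F n in sequentially. \<rho> n < cmod z" using order_tendstoD(2)[OF \<rho>(3) z(1)] .
        then have "\<forall>\<^sub>F n in sequentially. indicator (region (\<rho> n)) w *\<^sub>R f w = indicator (closure D) w *\<^sub>R f w"
          by eventually_elim (use False z g_in_region_iff[OF \<rho>(1)] in auto)
        then show ?thesis by (rule tendsto_eventually)
      qed
    qed
    show "AE w in lborel. norm (indicator (region (\<rho> n)) w *\<^sub>R f w) \<le> indicator (cbox (- t) t) w *\<^sub>R norm (f w)" for n
      using mono t by (intro AE_I2) (auto simp: indicator_def)
    show "(\<lambda>w. indicator (region (\<rho> n)) w *\<^sub>R f w) \<in> borel_measurable lborel" for n
      using open_region[OF \<rho>(1)] mf by auto
  qed (use mf in auto)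
  also have "(LINT w : closure D | lborel. f w) = (LINT w : D | lborel. f w)"
    unfolding set_lebesgue_integral_def
  proof (rule integral_cong_AE)
    show "AE w in lborel. indicator (closure D) w *\<^sub>R f w = indicator D w *\<^sub>R f w"
      using AE_lborel_negligible[OF null] 
      by eventually_elim (use domain(1) closure_subset[of D] in \<open>auto simp: frontier_def interior_open indicator_def\<close>)
  qed (use mf domain in auto)
  finally show ?thesis .
qed

end

section \<open>Faber polynomials\<close>

context exterior_map begin

text \<open>
  This is the Laurent series in the exterior disc of \<open>F m \<circ> g\<close>, where \<open>F m\<close> is the \<open>m\<close>-th Faber
  polynomial.
\<close>

definition Faber_pullback :: "nat \<Rightarrow> complex \<Rightarrow> complex" where
  "Faber_pullback m z = z ^ m + of_nat m * Grunsky_row z m"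

text \<open>
  With \<open>u = 1 / \<zeta>\<close>, the identity \<open>difference_quotient_g\<close> becomes \<open>NF = Q W\<close> with \<open>Q = 1 - z u\<close> and \<open>W = exp (- U)\<close>,
  where \<open>NF\<close> is the expansion of \<open>u (g (1 / u) - g z) / r\<close>.  The logarithmic derivative of the right-hand side
  is minus the generating function \<open>T\<close> of the \<open>Faber_pullback (m + 1) z\<close>, and comparing coefficients in
  \<open>NF T = - NF'\<close> gives the recursion.  Its coefficients depend on \<open>z\<close> only through \<open>g z\<close>, which
  enters the first of them linearly.
\<close>

lemma Faber_pullback_recursion:
  obtains N :: "nat \<Rightarrow> complex" where
    "\<And>z j. 1 < cmod z \<Longrightarrow> 1 \<le> j \<Longrightarrow> Faber_pullback j z =
       - of_nat j * (if j = 1 then N 1 - g z / of_real r else N j)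
       - (\<Sum>i = 1..<j. (if i = 1 then N 1 - g z / of_real r else N i) * Faber_pullback (j - i) z)"
proof -
  obtain G R where G: "0 < fps_conv_radius G" "1 < R"
    "\<And>z. R \<le> cmod z \<Longrightarrow> g z = of_real r * z + eval_fps G (1 / z)"
    using g_fps_expansion_at_infinity by blast
  define N where "N = (\<lambda>i. fps_nth G (i - 1) / of_real r)"
  have r0: "complex_of_real r \<noteq> 0" using r_pos by simp
  show ?thesis
  proof (rule that[of N])
    fix z :: complex and j :: nat
    assume z: "1 < cmod z" and j: "1 \<le> j"
    define U where "U = Grunsky_fps z"
    define NF where "NF = 1 + fps_const (1 / of_real r) * (fps_X * (G - fps_const (g z)))"
    define W where "W = fps_exp (-1) oo U"
    define Q where "Q = 1 - fps_const z * fps_X"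
    have U0: "fps_nth U 0 = 0" by (simp add: U_def Grunsky_fps_def)
    have Uexp: "eval_fps U has_fps_expansion U"
      unfolding U_def
      by (intro eval_fps_has_fps_expansion order_less_le_trans[OF _ conv_radius_Grunsky_fps[OF z]]) simp
    have Gexp: "eval_fps G has_fps_expansion G"
      using G(1) by (rule eval_fps_has_fps_expansion)
    have n: "(\<lambda>u. 1 + 1 / of_real r * (u * (eval_fps G u - g z))) has_fps_expansion NF"
      unfolding NF_def by (intro fps_expansion_intros Gexp)
    have "((\<lambda>u. exp (-1 * u)) \<circ> eval_fps U) has_fps_expansion W"
      unfolding W_def by (intro has_fps_expansion_compose has_fps_expansion_exp Uexp U0)
    then have w: "(\<lambda>u. (1 - z * u) * exp (- eval_fps U u)) has_fps_expansion Q * W"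
      unfolding Q_def by (intro fps_expansion_intros) (simp_all add: o_def)
    have "eventually (\<lambda>u. 1 + 1 / of_real r * (u * (eval_fps G u - g z)) = (1 - z * u) * exp (- eval_fps U u)) (nhds 0)"
      unfolding eventually_nhds_metric
    proof (intro exI[of _ "1 / R"] conjI allI impI)
      show "0 < 1 / R" using G(2) by simp
      fix u :: complex assume u: "dist u 0 < 1 / R"
      show "1 + 1 / of_real r * (u * (eval_fps G u - g z)) = (1 - z * u) * exp (- eval_fps U u)"
      proof (cases "u = 0")
        case True
        then show ?thesis using U0 by (simp add: eval_fps_at_0)
      next
        case False
        have "R \<le> cmod (1 / u)" using u False G(2) by (simp add: norm_divide field_simps)
        then have 1: "g (1 / u) = of_real r / u + eval_fps G u" and 2: "1 < cmod (1 / u)"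
          using G(2) G(3)[of "1 / u"] by auto
        from difference_quotient_g[OF z 2]
        have "of_real r / u + eval_fps G u - g z = (1 / u - z) * (of_real r * exp (- eval_fps U u))"
          by (simp add: 1 U_def)
        then have "u * (of_real r / u + eval_fps G u - g z) = u * ((1 / u - z) * (of_real r * exp (- eval_fps U u)))"
          by simp
        then have "of_real r + u * (eval_fps G u - g z) = of_real r * ((1 - u * z) * exp (- eval_fps U u))"
          using False by (simp add: algebra_simps)
        then show ?thesis using r0 by (simp add: field_simps)
      qed
    qed
    then have "(\<lambda>u. 1 + 1 / of_real r * (u * (eval_fps G u - g z))) has_fps_expansion Q * W"
      by (rule has_fps_expansion_cong[THEN iffD2, OF _ refl w])
    then have NW: "NF = Q * W"
      using n fps_expansion_unique_complex by blast
    \<comment> \<open>The geometric series, the inverse of \<open>Q\<close>.\<close>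
    define I where "I = Abs_fps (\<lambda>n. z ^ n)"
    define T where "T = fps_const z * I + fps_deriv U"
    have QI: "Q * I = 1"
    proof (rule fps_ext)
      fix n
      show "fps_nth (Q * I) n = fps_nth 1 n"
        by (cases n) (simp_all add: Q_def I_def left_diff_distrib mult.assoc)
    qed
    have dW: "fps_deriv W = - (W * fps_deriv U)"
      unfolding W_def using U0 by (simp add: fps_compose_deriv fps_compose_uminus flip: fps_const_neg)
    have dQ: "fps_deriv Q = - fps_const z"
      by (simp add: Q_def)
    have "NF * T = fps_const z * (Q * I) * W + Q * W * fps_deriv U"
      by (simp add: NW T_def algebra_simps)
    then have "NF * T = - fps_deriv NF"
      unfolding QI by (simp add: NW dW dQ flip: fps_const_neg)
    then have "fps_nth (NF * T) (j - 1) = fps_nth (- fps_deriv NF) (j - 1)" by simp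
    moreover have Tn: "fps_nth T i = Faber_pullback (Suc i) z" for i
      by (simp add: T_def I_def U_def Grunsky_fps_def Faber_pullback_def)
    moreover have NF: "fps_nth NF i = (if i = 0 then 1 else if i = 1 then N 1 - g z / of_real r else N i)" for i
      by (cases i) (auto simp: NF_def N_def diff_divide_distrib)
    ultimately have "(\<Sum>i = 0..j - 1. fps_nth NF i * Faber_pullback (Suc (j - 1 - i)) z) = - of_nat j * fps_nth NF j"
      using j by (simp add: fps_mult_nth)
    moreover have "{0..j - 1} = insert 0 {1..<j}" using j by auto
    moreover have "(\<Sum>i = 1..<j. fps_nth NF i * Faber_pullback (Suc (j - 1 - i)) z)
        = (\<Sum>i = 1..<j. (if i = 1 then N 1 - g z / of_real r else N i) * Faber_pullback (j - i) z)"
      by (rule sum.cong) (auto simp: NF Suc_diff_Suc)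
    ultimately have "Faber_pullback j z + (\<Sum>i = 1..<j. (if i = 1 then N 1 - g z / of_real r else N i) * Faber_pullback (j - i) z)
       = - of_nat j * fps_nth NF j"
      using j by (simp add: NF)
    then show "Faber_pullback j z = - of_nat j * (if j = 1 then N 1 - g z / of_real r else N j)
       - (\<Sum>i = 1..<j. (if i = 1 then N 1 - g z / of_real r else N i) * Faber_pullback (j - i) z)"
      using j by (simp add: NF eq_diff_eq)
  qed
qed

text \<open>
  The recursion expresses \<open>Faber_pullback j z\<close> as a polynomial in \<open>g z\<close>.  The top degree grows by one at
  each step through the term with \<open>i = 1\<close>, with factor \<open>1 / r\<close>.
\<close>

lemma Faber_polynomial_exists:
  assumes "1 \<le> j"
  shows "\<exists>F. degree F \<le> j \<and> coeff F j = 1 / of_real r ^ j \<and> (\<forall>z. 1 < cmod z \<longrightarrow> poly F (g z) = Faber_pullback j z)"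
proof -
  obtain N where N: "\<And>z j. 1 < cmod z \<Longrightarrow> 1 \<le> j \<Longrightarrow> Faber_pullback j z =
       - of_nat j * (if j = 1 then N 1 - g z / of_real r else N j)
       - (\<Sum>i = 1..<j. (if i = 1 then N 1 - g z / of_real r else N i) * Faber_pullback (j - i) z)"
    using Faber_pullback_recursion by blast
  define n where "n = (\<lambda>i. if i = 1 then [:N 1, - 1 / of_real r:] else [:N i:])"
  have n: "poly (n i) (g z) = (if i = 1 then N 1 - g z / of_real r else N i)" for i z
    by (simp add: n_def)
  have N': "Faber_pullback j z = - of_nat j * poly (n j) (g z) - (\<Sum>i = 1..<j. poly (n i) (g z) * Faber_pullback (j - i) z)"
    if "1 < cmod z" "1 \<le> j" for z j
    using N[OF that] by (simp add: n)
  show ?thesis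
    using assms
  proof (induction j rule: less_induct)
    case (less j)
    then have "\<forall>i\<in>{1..<j}. \<exists>F. degree F \<le> i \<and> coeff F i = 1 / of_real r ^ i \<and>
        (\<forall>z. 1 < cmod z \<longrightarrow> poly F (g z) = Faber_pullback i z)" by auto
    then obtain F where F: "\<And>i. i \<in> {1..<j} \<Longrightarrow> degree (F i) \<le> i"
      "\<And>i. i \<in> {1..<j} \<Longrightarrow> coeff (F i) i = 1 / of_real r ^ i"
      "\<And>i z. i \<in> {1..<j} \<Longrightarrow> 1 < cmod z \<Longrightarrow> poly (F i) (g z) = Faber_pullback i z"
      by metis
    define P where "P = Polynomial.smult (- of_nat j) (n j) - (\<Sum>i = 1..<j. n i * F (j - i))"
    have val: "poly P (g z) = Faber_pullback j z" if "1 < cmod z" for z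
    proof -
      have "(\<Sum>i = 1..<j. poly (n i) (g z) * poly (F (j - i)) (g z))
          = (\<Sum>i = 1..<j. poly (n i) (g z) * Faber_pullback (j - i) z)"
        using F(3) that by (intro sum.cong) auto
      then show ?thesis
        using N'[OF that less.prems] by (simp add: P_def poly_sum)
    qed
    have dn: "degree (n i) \<le> (if i = 1 then 1 else 0)" for i
      by (simp add: n_def)
    \<comment> \<open>Only the term with \<open>i = 1\<close> reaches degree \<open>j\<close>.\<close>
    have hi: "coeff (n i * F (j - i)) k = 0" if "i \<in> {1..<j}" "k \<ge> j" "i \<noteq> 1 \<or> k > j" for i k
    proof (rule coeff_eq_0)
      have "degree (n i * F (j - i)) \<le> (if i = 1 then 1 else 0) + (j - i)"
        using F(1)[of "j - i"] that(1) by (intro order_trans[OF degree_mult_le add_mono[OF dn]]) auto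
      also have "\<dots> < k" using that by auto
      finally show "degree (n i * F (j - i)) < k" .
    qed
    show ?case
    proof (intro exI[of _ P] conjI allI impI val)
      show "degree P \<le> j"
      proof (rule degree_le, intro allI impI)
        fix k assume k: "j < k"
        have "coeff (n j) k = 0" using dn[of j] less.prems k by (intro coeff_eq_0) (auto split: if_splits)
        then show "coeff P k = 0"
          using hi k by (simp add: P_def coeff_sum)
      qed
      show "coeff P j = 1 / of_real r ^ j"
      proof (cases "j = 1")
        case True
        then show ?thesis by (simp add: P_def n_def)
      next
        case False
        then have j: "1 < j" using less.prems by simp
        have "(\<Sum>i = 1..<j. coeff (n i * F (j - i)) j) = coeff (n 1 * F (j - 1)) j"
          using j hi by (subst sum.remove[of _ 1]) auto
        also have "\<dots> = - 1 / of_real r * coeff (F (j - 1)) (j - 1)"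
        proof -
          have "degree (F (j - 1)) \<le> j - 1" using j by (intro F(1)) auto
          then have "coeff (F (j - 1)) j = 0" using j by (intro coeff_eq_0) linarith
          then show ?thesis using j by (cases j) (simp_all add: n_def)
        qed
        also have "\<dots> = - 1 / of_real r ^ j"
          using F(2)[of "j - 1"] j by (cases j) auto
        finally show ?thesis
          using False j by (simp add: P_def coeff_sum n_def[of] coeff_pCons split: nat.splits)
      qed
    qed
  qed
qed

end

section \<open>Laurent coefficients of Faber polynomials on the exterior\<close>

lemma has_contour_integral_circlepath_powi:
  assumes "0 < \<rho>"
  shows "((\<lambda>z. z powi n) has_contour_integral (if n = -1 then 2 * pi * \<i> else 0)) (circlepath 0 \<rho>)"
proof (cases "n = -1")
  case True
  have "((\<lambda>u. 1 / (u - 0)) has_contour_integral 2 * of_real pi * \<i> * 1) (circlepath 0 \<rho>)"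
    using assms by (intro Cauchy_integral_circlepath_simple) auto
  then show ?thesis using True by (simp add: power_int_minus divide_inverse)
next
  case False
  then have n: "of_int (n + 1) \<noteq> (0::complex)" by (metis add.commute add_eq_0_iff2 of_int_eq_0_iff)
  have "((\<lambda>z. z powi n) has_contour_integral 0) (circlepath 0 \<rho>)"
  proof (rule Cauchy_theorem_primitive[of "- {0}" "\<lambda>z. z powi (n + 1) / of_int (n + 1)"])
    fix z :: complex assume z: "z \<in> - {0}"
    have "((\<lambda>z. z powi (n + 1) / of_int (n + 1)) has_field_derivative
        of_int (n + 1) * z powi (n + 1 - 1) * 1 / of_int (n + 1)) (at z within - {0})"
      using z by (intro DERIV_cdivide DERIV_power_int DERIV_ident) auto
    then show "((\<lambda>z. z powi (n + 1) / of_int (n + 1)) has_field_derivative z powi n) (at z within - {0})"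
      using n by simp
  qed (use assms in auto)
  then show ?thesis using False by simp
qed

lemma contour_integral_circlepath_sums:
  fixes h :: "nat \<Rightarrow> complex \<Rightarrow> complex"
  assumes \<rho>: "0 < \<rho>" and c: "\<And>j. continuous_on (sphere 0 \<rho>) (h j)"
    and M: "\<And>j z. cmod z = \<rho> \<Longrightarrow> cmod (h j z) \<le> M j" "summable M"
    and f: "\<And>z. cmod z = \<rho> \<Longrightarrow> (\<lambda>j. h j z) sums f z"
  shows "(\<lambda>j. contour_integral (circlepath 0 \<rho>) (h j)) sums contour_integral (circlepath 0 \<rho>) f"
    and "f contour_integrable_on circlepath 0 \<rho>"
proof -
  have ci: "h j contour_integrable_on circlepath 0 \<rho>" for j
    using c \<rho> by (intro contour_integrable_continuous_circlepath) auto
  have "uniform_limit (sphere 0 \<rho>) (\<lambda>n z. \<Sum>j<n. h j z) (\<lambda>z. suminf (\<lambda>j. h j z)) sequentially"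
    using M by (intro Weierstrass_m_test) auto
  then have u: "uniform_limit (sphere 0 \<rho>) (\<lambda>n z. \<Sum>j<n. h j z) f sequentially"
    by (rule uniform_limit_cong'[THEN iffD1, rotated -1]) (use f in \<open>auto simp: sums_iff\<close>)
  have e: "\<forall>\<^sub>F n in sequentially. (\<lambda>z. \<Sum>j<n. h j z) contour_integrable_on circlepath 0 \<rho>"
    using ci by (intro always_eventually allI contour_integrable_sum) auto
  note lim = contour_integral_uniform_limit_circlepath[OF e u _ \<rho>]
  show "f contour_integrable_on circlepath 0 \<rho>" using lim(1) by simp
  have "contour_integral (circlepath 0 \<rho>) (\<lambda>z. \<Sum>j<n. h j z) = (\<Sum>j<n. contour_integral (circlepath 0 \<rho>) (h j))" for n
    using ci by (intro contour_integral_sum) auto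
  then show "(\<lambda>j. contour_integral (circlepath 0 \<rho>) (h j)) sums contour_integral (circlepath 0 \<rho>) f"
    using lim(2) by (simp add: sums_def)
qed

context exterior_map begin

lemma summable_Grunsky_coeffs:
  assumes "1 < \<rho>" "1 \<le> m"
  shows "summable (\<lambda>j. cmod (a m (Suc j)) / \<rho> ^ Suc j)"
proof -
  have "(\<lambda>l. cmod (a m l) / \<rho> ^ l) summable_on (Suc ` UNIV)"
    using abs_summable_Grunsky_row[OF assms] by (simp add: atLeast_Suc_greaterThan greaterThan_0)
  then have "(\<lambda>j. cmod (a m (Suc j)) / \<rho> ^ Suc j) summable_on UNIV"
    by (subst (asm) summable_on_reindex) (auto simp: o_def)
  then show ?thesis by (rule summable_on_imp_summable)
qed

lemma sums_Grunsky_row: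
  assumes "1 < cmod z" "1 \<le> m"
  shows "(\<lambda>j. a m (Suc j) / z ^ Suc j) sums Grunsky_row z m"
proof -
  have "((\<lambda>l. a m l / z ^ l) has_sum Grunsky_row z m) (Suc ` UNIV)"
    using has_sum_Grunsky_row[OF assms] by (simp add: atLeast_Suc_greaterThan greaterThan_0)
  then have "((\<lambda>j. a m (Suc j) / z ^ Suc j) has_sum Grunsky_row z m) UNIV"
    by (subst (asm) has_sum_reindex) (auto simp: o_def)
  then show ?thesis by (rule has_sum_imp_sums)
qed

lemma holomorphic_Faber_pullback:
  assumes "1 \<le> m"
  shows "Faber_pullback m holomorphic_on {z. 1 < cmod z}"
proof -
  obtain F where F: "\<And>z. 1 < cmod z \<Longrightarrow> poly F (g z) = Faber_pullback m z"
    using Faber_polynomial_exists[OF assms] by blast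
  have "(\<lambda>z. poly F (g z)) holomorphic_on {z. 1 < cmod z}"
    by (intro holomorphic_intros holo_g)
  then show ?thesis by (rule holomorphic_transform) (simp add: F)
qed

text \<open>
  Integration term by term picks out one Laurent coefficient.  The sums are indexed from zero, so that
  index \<open>j\<close> belongs to the power \<open>z\<^sup>-\<^sup>j\<^sup>-\<^sup>1\<close>.
\<close>

lemma has_contour_integral_powi_Faber_pullback:
  assumes \<rho>: "1 < \<rho>" and m: "1 \<le> m"
  shows "((\<lambda>z. z powi q * Faber_pullback m z) has_contour_integral
      2 * pi * \<i> * ((if int m + q = -1 then 1 else 0) + (if 0 \<le> q then of_nat m * a m (Suc (nat q)) else 0)))
    (circlepath 0 \<rho>)"
proof -
  define h where "h = (\<lambda>j z. of_nat m * a m (Suc j) * z powi (q - 1 - int j))"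
  define f where "f = (\<lambda>z. z powi q * (of_nat m * Grunsky_row z m))"
  have \<rho>0: "0 < \<rho>" using \<rho> by simp
  have hf: "(\<lambda>j. h j z) sums f z" if "cmod z = \<rho>" for z
  proof -
    have z: "z \<noteq> 0" "1 < cmod z" using that \<rho> by auto
    have "(\<lambda>j. z powi q * (of_nat m * (a m (Suc j) / z ^ Suc j))) sums f z"
      unfolding f_def by (intro sums_mult sums_Grunsky_row z m)
    moreover have "z powi q * (of_nat m * (a m (Suc j) / z ^ Suc j)) = h j z" for j
    proof -
      have "z powi (q - 1 - int j) = z powi q / z powi (int (Suc j))"
        using z(1) by (subst power_int_diff[symmetric]) (auto simp: algebra_simps)
      then have "z powi (q - 1 - int j) = z powi q / z ^ Suc j" by (simp only: power_int_of_nat)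
      then show ?thesis by (simp add: h_def)
    qed
    ultimately show ?thesis by simp
  qed
  have hM: "cmod (h j z) \<le> \<rho> powi q * of_nat m * (cmod (a m (Suc j)) / \<rho> ^ Suc j)" if "cmod z = \<rho>" for j z
  proof -
    have "\<rho> powi (q - 1 - int j) = \<rho> powi q / \<rho> powi (int (Suc j))"
      using \<rho> by (subst power_int_diff[symmetric]) (auto simp: algebra_simps)
    then have "\<rho> powi (q - 1 - int j) = \<rho> powi q / \<rho> ^ Suc j" by (simp only: power_int_of_nat)
    then show ?thesis using that by (simp add: h_def norm_mult norm_power_int mult_ac)
  qed
  have sM: "summable (\<lambda>j. \<rho> powi q * of_nat m * (cmod (a m (Suc j)) / \<rho> ^ Suc j))"
    by (intro summable_mult summable_Grunsky_coeffs \<rho> m)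
  have ch: "continuous_on (sphere 0 \<rho>) (h j)" for j
    unfolding h_def using \<rho> by (intro continuous_intros) auto
  note S = contour_integral_circlepath_sums[OF \<rho>0 ch hM sM hf]
  have ih: "contour_integral (circlepath 0 \<rho>) (h j) = (if j = nat q then (if 0 \<le> q then 2 * pi * \<i> * (of_nat m * a m (Suc j)) else 0) else 0)" for j
  proof -
    have "contour_integral (circlepath 0 \<rho>) (h j) = of_nat m * a m (Suc j) * (if q - 1 - int j = -1 then 2 * pi * \<i> else 0)"
      unfolding h_def by (intro contour_integral_unique has_contour_integral_lmul has_contour_integral_circlepath_powi \<rho>0)
    then show ?thesis by (auto simp: algebra_simps)
  qed
  have "contour_integral (circlepath 0 \<rho>) f = (if 0 \<le> q then 2 * pi * \<i> * (of_nat m * a m (Suc (nat q))) else 0)"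
    using S(1) unfolding ih by (rule sums_unique2[OF _ sums_single])
  then have "(f has_contour_integral (if 0 \<le> q then 2 * pi * \<i> * (of_nat m * a m (Suc (nat q))) else 0)) (circlepath 0 \<rho>)"
    using has_contour_integral_integral[OF S(2)] by simp
  note sum = has_contour_integral_add[OF has_contour_integral_circlepath_powi[OF \<rho>0, of "int m + q"] this]
  have "(if int m + q = -1 then 2 * pi * \<i> else 0) + (if 0 \<le> q then 2 * pi * \<i> * (of_nat m * a m (Suc (nat q))) else 0)
      = 2 * pi * \<i> * ((if int m + q = -1 then 1 else 0) + (if 0 \<le> q then of_nat m * a m (Suc (nat q)) else 0))"
    by (simp add: algebra_simps)
  from sum[unfolded this] have "((\<lambda>z. z powi (int m + q) + f z) has_contour_integral
    2 * pi * \<i> * ((if int m + q = -1 then 1 else 0) + (if 0 \<le> q then of_nat m * a m (Suc (nat q)) else 0))) (circlepath 0 \<rho>)" .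
  then show ?thesis
  proof (rule has_contour_integral_eq)
    fix z assume "z \<in> path_image (circlepath 0 \<rho>)"
    then have "z \<noteq> 0" using \<rho> by auto
    then show "z powi (int m + q) + f z = z powi q * Faber_pullback m z"
      by (simp add: f_def Faber_pullback_def power_int_add algebra_simps)
  qed
qed

lemma deriv_Faber_pullback:
  assumes "1 \<le> m" "1 < cmod z"
  shows "(Faber_pullback m has_field_derivative deriv (Faber_pullback m) z) (at z)"
  using holomorphic_derivI[OF holomorphic_Faber_pullback[OF assms(1)] open_exterior_disc] assms(2) by simp

text \<open>
  Integration by parts: the derivative of \<open>z\<^sup>p\<close> times the Faber pullback has integral zero.
\<close>

lemma has_contour_integral_powi_deriv_Faber_pullback:
  assumes \<rho>: "1 < \<rho>" and m: "1 \<le> m"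
  shows "((\<lambda>z. z powi p * deriv (Faber_pullback m) z) has_contour_integral
      2 * pi * \<i> * ((if int m = - p then of_nat m else 0) - (if 1 \<le> p then of_int p * of_nat m * a m (nat p) else 0)))
    (circlepath 0 \<rho>)"
proof -
  let ?U = "{z::complex. 1 < cmod z}"
  have "((\<lambda>z. z powi p * deriv (Faber_pullback m) z + of_int p * (z powi (p - 1) * Faber_pullback m z)) has_contour_integral 0) (circlepath 0 \<rho>)"
  proof (rule Cauchy_theorem_primitive[of ?U "\<lambda>z. z powi p * Faber_pullback m z"])
    fix z assume z: "z \<in> ?U"
    have "((\<lambda>z. z powi p * Faber_pullback m z) has_field_derivative
       (of_int p * z powi (p - 1) * 1) * Faber_pullback m z + deriv (Faber_pullback m) z * z powi p) (at z)"
      using z by (intro DERIV_mult DERIV_power_int DERIV_ident deriv_Faber_pullback m) auto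
    then show "((\<lambda>z. z powi p * Faber_pullback m z) has_field_derivative
       z powi p * deriv (Faber_pullback m) z + of_int p * (z powi (p - 1) * Faber_pullback m z)) (at z within ?U)"
      by (rule has_field_derivative_at_within[OF DERIV_cong]) (simp only: mult_1_right mult_1_left ac_simps)
  qed (use \<rho> in auto)
  from has_contour_integral_diff[OF this has_contour_integral_lmul[OF has_contour_integral_powi_Faber_pullback[OF \<rho> m, of "p - 1"], of "of_int p"]]
  have "((\<lambda>z. z powi p * deriv (Faber_pullback m) z) has_contour_integral
      - (of_int p * (2 * pi * \<i> * ((if int m + (p - 1) = -1 then 1 else 0) + (if 0 \<le> p - 1 then of_nat m * a m (Suc (nat (p - 1))) else 0)))))
    (circlepath 0 \<rho>)"
    by simp
  moreover have "- (of_int p * (2 * pi * \<i> * ((if int m + (p - 1) = -1 then 1 else 0) + (if 0 \<le> p - 1 then of_nat m * a m (Suc (nat (p - 1))) else 0))))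
    = 2 * pi * \<i> * ((if int m = - p then of_nat m else 0) - (if 1 \<le> p then of_int p * of_nat m * a m (nat p) else 0))"
  proof (cases "1 \<le> p")
    case True
    then show ?thesis using m by (simp add: algebra_simps Suc_nat_eq_nat_zadd1)
  next
    case False
    show ?thesis
    proof (cases "int m = - p")
      case True
      then have p: "p = - int m" by simp
      show ?thesis using m unfolding p by simp
    next
      case ne: False
      then have "int m + (p - 1) \<noteq> -1" by linarith
      then show ?thesis using ne False by simp
    qed
  qed
  ultimately show ?thesis by (simp only:)
qed

text \<open>
  The series of these terms is the entry \<open>(m, k)\<close> of \<open>B B\<^sup>*\<close> divided by \<open>\<surd>(m k)\<close>; index \<open>j\<close> stands for
  the coordinate \<open>j + 1\<close>.
\<close>

definition Grunsky_term :: "nat \<Rightarrow> nat \<Rightarrow> nat \<Rightarrow> complex" where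
  "Grunsky_term m k j = of_nat (Suc j) * a m (Suc j) * cnj (a k (Suc j))"

text \<open>
  On the circle of radius \<open>\<rho>\<close> one has \<open>cnj z = \<rho>\<^sup>2 / z\<close>.  Hence the conjugated Laurent series becomes a
  series in powers of \<open>z\<close>, which can be integrated term by term against the derivative.
\<close>

lemma sums_contour_integral_Faber_pullback:
  assumes \<rho>: "1 < \<rho>" and m: "1 \<le> m" and k: "1 \<le> k"
  shows "(\<lambda>j. - 2 * pi * \<i> * of_nat m * of_nat k * (Grunsky_term m k j / of_real \<rho> ^ (2 * Suc j))) sums
    (contour_integral (circlepath 0 \<rho>) (\<lambda>z. deriv (Faber_pullback m) z * cnj (Faber_pullback k z))
      - (if m = k then 2 * pi * \<i> * of_nat m * of_real \<rho> ^ (2 * k) else 0))"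
proof -
  have \<rho>0: "0 < \<rho>" using \<rho> by simp
  let ?S = "sphere (0::complex) \<rho>"
  have cd: "continuous_on ?S (deriv (Faber_pullback m))"
    by (rule continuous_on_subset[OF holomorphic_on_imp_continuous_on[OF holomorphic_deriv[OF holomorphic_Faber_pullback[OF m] open_exterior_disc]]])
      (use \<rho> in auto)
  obtain B where B: "\<And>z. cmod z = \<rho> \<Longrightarrow> cmod (deriv (Faber_pullback m) z) \<le> B"
    using compact_imp_bounded[OF compact_continuous_image[OF cd compact_sphere]] unfolding bounded_iff
    by (metis imageI mem_sphere_0)
  define h where "h = (\<lambda>j z. of_nat k * cnj (a k (Suc j)) / of_real \<rho> ^ (2 * Suc j) * (z powi int (Suc j) * deriv (Faber_pullback m) z))"
  define f where "f = (\<lambda>z. of_nat k * cnj (Grunsky_row z k) * deriv (Faber_pullback m) z)"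
  have cnjz: "cnj z = of_real \<rho> ^ 2 / z" if "cmod z = \<rho>" for z
    using that \<rho>0 complex_norm_square[of z] by (auto simp: field_simps)
  have hf: "(\<lambda>j. h j z) sums f z" if z: "cmod z = \<rho>" for z
  proof -
    have z0: "z \<noteq> 0" using z \<rho>0 by auto
    have "(\<lambda>j. cnj (a k (Suc j) / z ^ Suc j)) sums cnj (Grunsky_row z k)"
      using sums_Grunsky_row[of z k] z \<rho> k unfolding sums_cnj by simp
    then have "(\<lambda>j. of_nat k * cnj (a k (Suc j) / z ^ Suc j) * deriv (Faber_pullback m) z) sums f z"
      unfolding f_def by (intro sums_mult sums_mult2)
    moreover have "of_nat k * cnj (a k (Suc j) / z ^ Suc j) * deriv (Faber_pullback m) z = h j z" for j
    proof -
      have "cnj (z ^ Suc j) = of_real \<rho> ^ (2 * Suc j) / z ^ Suc j"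
        using cnjz[OF z] by (simp only: complex_cnj_power power_divide power_mult)
      then show ?thesis using z0 \<rho>0 unfolding h_def power_int_of_nat complex_cnj_divide by simp
    qed
    ultimately show ?thesis by simp
  qed
  have hM: "cmod (h j z) \<le> of_nat k * B * (cmod (a k (Suc j)) / \<rho> ^ Suc j)" if z: "cmod z = \<rho>" for j z
  proof -
    have "cmod (h j z) = of_nat k * (cmod (a k (Suc j)) / \<rho> ^ Suc j) * cmod (deriv (Faber_pullback m) z)"
      unfolding h_def power_int_of_nat
      using z \<rho>0 by (simp add: norm_mult norm_divide norm_power power_mult power2_eq_square power_mult_distrib)
    also have "\<dots> \<le> of_nat k * (cmod (a k (Suc j)) / \<rho> ^ Suc j) * B"
      using B[OF z] \<rho>0 by (intro mult_left_mono) auto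
    finally show ?thesis by (simp add: mult_ac)
  qed
  have sM: "summable (\<lambda>j. of_nat k * B * (cmod (a k (Suc j)) / \<rho> ^ Suc j))"
    by (intro summable_mult summable_Grunsky_coeffs \<rho> k)
  have ch: "continuous_on ?S (h j)" for j
    unfolding h_def by (intro continuous_intros cd) (use \<rho> in auto)
  note S = contour_integral_circlepath_sums[OF \<rho>0 ch hM sM hf]
  have ih: "contour_integral (circlepath 0 \<rho>) (h j)
      = - 2 * pi * \<i> * of_nat m * of_nat k * (Grunsky_term m k j / of_real \<rho> ^ (2 * Suc j))" for j
    unfolding h_def
    by (subst contour_integral_unique[OF has_contour_integral_lmul[OF has_contour_integral_powi_deriv_Faber_pullback[OF \<rho> m]]])
      (simp add: Grunsky_term_def nat_add_distrib mult_ac)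
  have "(\<lambda>z. deriv (Faber_pullback m) z * cnj (Faber_pullback k z)) = (\<lambda>z. deriv (Faber_pullback m) z * cnj (z ^ k) + f z)"
    by (auto simp: Faber_pullback_def f_def algebra_simps)
  then have "contour_integral (circlepath 0 \<rho>) (\<lambda>z. deriv (Faber_pullback m) z * cnj (Faber_pullback k z))
      = contour_integral (circlepath 0 \<rho>) (\<lambda>z. deriv (Faber_pullback m) z * cnj (z ^ k)) + contour_integral (circlepath 0 \<rho>) f"
    by (simp only:, intro contour_integral_add S(2) contour_integrable_continuous_circlepath continuous_intros)
      (use cd \<rho>0 in auto)
  moreover have "contour_integral (circlepath 0 \<rho>) (\<lambda>z. deriv (Faber_pullback m) z * cnj (z ^ k))
      = (if m = k then 2 * pi * \<i> * of_nat m * of_real \<rho> ^ (2 * k) else 0)"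
  proof -
    have "contour_integral (circlepath 0 \<rho>) (\<lambda>z. deriv (Faber_pullback m) z * cnj (z ^ k))
       = contour_integral (circlepath 0 \<rho>) (\<lambda>z. of_real \<rho> ^ (2 * k) * (z powi (- int k) * deriv (Faber_pullback m) z))"
    proof (rule contour_integral_eq)
      fix z assume "z \<in> path_image (circlepath 0 \<rho>)"
      then have z: "cmod z = \<rho>" using \<rho>0 by auto
      have "cnj (z ^ k) = of_real \<rho> ^ (2 * k) / z ^ k"
        using cnjz[OF z] by (simp only: complex_cnj_power power_divide power_mult)
      then show "deriv (Faber_pullback m) z * cnj (z ^ k) = of_real \<rho> ^ (2 * k) * (z powi (- int k) * deriv (Faber_pullback m) z)"
        by (simp only: power_int_minus power_int_of_nat) (simp add: divide_inverse mult_ac)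
    qed
    also have "\<dots> = of_real \<rho> ^ (2 * k) * (2 * pi * \<i> * ((if int m = - (- int k) then of_nat m else 0)
        - (if 1 \<le> - int k then of_int (- int k) * of_nat m * a m (nat (- int k)) else 0)))"
      by (intro contour_integral_unique has_contour_integral_lmul has_contour_integral_powi_deriv_Faber_pullback \<rho> m)
    finally show ?thesis by simp
  qed
  ultimately show ?thesis using S(1) unfolding ih by simp
qed

end

section \<open>The Gram matrix of the derivatives of Faber polynomials\<close>

context exterior_map begin

lemma cmod_Grunsky_term_le:
  "cmod (Grunsky_term m k j) \<le> real (Suc j) * (cmod (a m (Suc j)))\<^sup>2 + real (Suc j) * (cmod (a k (Suc j)))\<^sup>2"
proof -
  let ?x = "cmod (a m (Suc j))" and ?y = "cmod (a k (Suc j))"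
  have "?x * ?y \<le> ?x\<^sup>2 + ?y\<^sup>2"
    using sum_squares_bound[of ?x ?y] mult_nonneg_nonneg[OF norm_ge_zero norm_ge_zero, of "a m (Suc j)" "a k (Suc j)"] by linarith
  then have "real (Suc j) * (?x * ?y) \<le> real (Suc j) * (?x\<^sup>2 + ?y\<^sup>2)"
    by (intro mult_left_mono) auto
  moreover have "cmod (Grunsky_term m k j) = real (Suc j) * (?x * ?y)"
    unfolding Grunsky_term_def norm_mult norm_of_nat complex_mod_cnj by (simp only: mult.assoc)
  ultimately show ?thesis by (simp only: distrib_left)
qed

lemma Grunsky_term_diag:
  "Grunsky_term m m j = of_real (real (Suc j) * (cmod (a m (Suc j)))\<^sup>2)"
  unfolding Grunsky_term_def of_real_mult complex_norm_square[symmetric] mult.assoc by simp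

context
  fixes F :: "nat \<Rightarrow> complex poly"
  assumes F: "\<And>m z. 1 \<le> m \<Longrightarrow> 1 < cmod z \<Longrightarrow> poly (F m) (g z) = Faber_pullback m z"
begin

lemma deriv_Faber_pullback_Faber:
  assumes "1 \<le> m" "1 < cmod z"
  shows "deriv (Faber_pullback m) z = poly (pderiv (F m)) (g z) * deriv g z"
proof -
  have "((\<lambda>z. poly (F m) (g z)) has_field_derivative poly (pderiv (F m)) (g z) * deriv g z) (at z)"
    by (rule DERIV_chain2[OF poly_DERIV deriv_g[OF assms(2)]])
  then have "(Faber_pullback m has_field_derivative poly (pderiv (F m)) (g z) * deriv g z) (at z)"
    by (rule has_field_derivative_transform_within_open[OF _ open_exterior_disc])
      (use assms F in auto)
  then show ?thesis by (rule DERIV_imp_deriv)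
qed

lemma sums_integral_region_Faber:
  assumes \<rho>: "1 < \<rho>" and m: "1 \<le> m" and k: "1 \<le> k"
  shows "(\<lambda>j. Grunsky_term m k j / of_real \<rho> ^ (2 * Suc j)) sums
    (((if m = k then of_nat m * of_real \<rho> ^ (2 * k) else 0)
      - (LINT w : region \<rho> | lborel. poly (pderiv (F m)) w * cnj (poly (pderiv (F k)) w)) / pi) / (of_nat m * of_nat k))"
proof -
  define J where "J = (LINT w : region \<rho> | lborel. poly (pderiv (F m)) w * cnj (poly (pderiv (F k)) w))"
  define c where "c = - 2 * pi * \<i> * of_nat m * of_nat k"
  have c: "c \<noteq> 0" using m k by (simp add: c_def)
  have "contour_integral (circlepath 0 \<rho>) (\<lambda>z. poly (pderiv (F m)) (g z) * deriv g z * cnj (poly (F k) (g z)))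
      = contour_integral (circlepath 0 \<rho>) (\<lambda>z. deriv (Faber_pullback m) z * cnj (Faber_pullback k z))"
    by (rule contour_integral_eq) (use \<rho> m k F deriv_Faber_pullback_Faber in auto)
  then have J: "contour_integral (circlepath 0 \<rho>) (\<lambda>z. deriv (Faber_pullback m) z * cnj (Faber_pullback k z)) = 2 * \<i> * J"
    unfolding J_def integral_region_pderiv[OF \<rho>] by simp
  have "(\<lambda>j. c * (Grunsky_term m k j / of_real \<rho> ^ (2 * Suc j)) / c) sums
     ((2 * \<i> * J - (if m = k then 2 * pi * \<i> * of_nat m * of_real \<rho> ^ (2 * k) else 0)) / c)"
    unfolding c_def J[symmetric] by (intro sums_divide sums_contour_integral_Faber_pullback \<rho> m k)
  moreover have "(2 * \<i> * J - (if m = k then 2 * pi * \<i> * of_nat m * of_real \<rho> ^ (2 * k) else 0)) / c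
    = ((if m = k then of_nat m * of_real \<rho> ^ (2 * k) else 0) - J / pi) / (of_nat m * of_nat k)"
    using m k by (simp add: c_def field_simps)
  ultimately show ?thesis using c unfolding J_def[symmetric] by simp
qed

text \<open>
  This is the area theorem: the integral of \<open>|F m'|\<^sup>2\<close> over a level region is non-negative, which bounds
  the series damped by powers of \<open>\<rho>\<close> uniformly for \<open>1 < \<rho> \<le> 2\<close>.
\<close>

lemma summable_Grunsky_diag:
  assumes m: "1 \<le> m"
  shows "summable (\<lambda>j. real (Suc j) * (cmod (a m (Suc j)))\<^sup>2)"
proof (rule bounded_imp_summable)
  show "0 \<le> real (Suc j) * (cmod (a m (Suc j)))\<^sup>2" for j by simp
  fix N
  define \<rho> where "\<rho> = (\<lambda>n::nat. 1 + 1 / real (Suc n))"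
  have \<rho>: "1 < \<rho> n" "\<rho> n \<le> 2" for n by (auto simp: \<rho>_def)
  have lim: "\<rho> \<longlonglongrightarrow> 1"
    unfolding \<rho>_def using tendsto_add[OF tendsto_const[of 1] LIMSEQ_inverse_real_of_nat] by (simp add: divide_inverse)
  have le: "(\<Sum>j\<le>N. real (Suc j) * (cmod (a m (Suc j)))\<^sup>2 / \<rho> n ^ (2 * Suc j)) \<le> 2 ^ (2 * m)" for n
  proof -
    define q where "q = (\<lambda>w. (cmod (poly (pderiv (F m)) w))\<^sup>2)"
    define J where "J = (LINT w : region (\<rho> n) | lborel. q w)"
    have J0: "0 \<le> J" unfolding J_def set_lebesgue_integral_def by (intro integral_nonneg_AE) (auto simp: q_def)
    have "(LINT w : region (\<rho> n) | lborel. poly (pderiv (F m)) w * cnj (poly (pderiv (F m)) w)) = of_real J"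
      unfolding J_def set_lebesgue_integral_def q_def integral_complex_of_real[symmetric]
      by (intro Bochner_Integration.integral_cong refl) (auto simp: indicator_def complex_norm_square simp del: of_real_power)
    with sums_integral_region_Faber[OF \<rho>(1) m m, of n]
    have "(\<lambda>j. of_real (real (Suc j) * (cmod (a m (Suc j)))\<^sup>2) / of_real (\<rho> n) ^ (2 * Suc j)) sums
       ((of_nat m * of_real (\<rho> n) ^ (2 * m) - complex_of_real J / pi) / (of_nat m * of_nat m))"
      by (simp only: Grunsky_term_diag simp_thms if_True)
    then have "(\<lambda>j. complex_of_real (real (Suc j) * (cmod (a m (Suc j)))\<^sup>2 / \<rho> n ^ (2 * Suc j))) sums
       complex_of_real ((of_nat m * \<rho> n ^ (2 * m) - J / pi) / (of_nat m * of_nat m))"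
      by simp
    then have s: "(\<lambda>j. real (Suc j) * (cmod (a m (Suc j)))\<^sup>2 / \<rho> n ^ (2 * Suc j)) sums
       ((of_nat m * \<rho> n ^ (2 * m) - J / pi) / (of_nat m * of_nat m))"
      unfolding sums_of_real_iff .
    have "(\<Sum>j\<le>N. real (Suc j) * (cmod (a m (Suc j)))\<^sup>2 / \<rho> n ^ (2 * Suc j)) \<le> (of_nat m * \<rho> n ^ (2 * m) - J / pi) / (of_nat m * of_nat m)"
      unfolding sums_unique[OF s]
      using \<rho>(1)[of n] sums_summable[OF s] by (intro sum_le_suminf) auto
    also have "\<dots> \<le> (of_nat m * \<rho> n ^ (2 * m)) / (of_nat m * of_nat m)"
      using J0 by (intro divide_right_mono) auto
    also have "\<dots> \<le> \<rho> n ^ (2 * m) / 1"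
      using m \<rho>(1)[of n] by (simp add: field_simps)
    also have "\<dots> \<le> 2 ^ (2 * m)"
      using \<rho>[of n] power_mono[of "\<rho> n" 2 "2 * m"] by simp
    finally show ?thesis .
  qed
  have "(\<lambda>n. \<Sum>j\<le>N. real (Suc j) * (cmod (a m (Suc j)))\<^sup>2 / \<rho> n ^ (2 * Suc j))
     \<longlonglongrightarrow> (\<Sum>j\<le>N. real (Suc j) * (cmod (a m (Suc j)))\<^sup>2 / 1 ^ (2 * Suc j))"
    by (intro tendsto_intros lim) auto
  then have "(\<Sum>j\<le>N. real (Suc j) * (cmod (a m (Suc j)))\<^sup>2 / 1 ^ (2 * Suc j)) \<le> 2 ^ (2 * m)"
    using le by (intro LIMSEQ_le_const2) auto
  then show "(\<Sum>j\<le>N. real (Suc j) * (cmod (a m (Suc j)))\<^sup>2) \<le> 2 ^ (2 * m)" by simp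
qed

text \<open>
  The limit \<open>\<rho> \<rightarrow> 1\<close> is taken inside the series by dominated convergence; the dominating series is
  provided by the two diagonal ones.
\<close>

lemma integral_D_Faber:
  assumes m: "1 \<le> m" and k: "1 \<le> k"
  shows "summable (\<lambda>j. cmod (Grunsky_term m k j))"
    and "(LINT w : D | lborel. poly (pderiv (F m)) w * cnj (poly (pderiv (F k)) w))
      = pi * ((if m = k then of_nat m else 0) - of_nat m * of_nat k * (\<Sum>j. Grunsky_term m k j))"
proof -
  define M where "M = (\<lambda>j. real (Suc j) * (cmod (a m (Suc j)))\<^sup>2 + real (Suc j) * (cmod (a k (Suc j)))\<^sup>2)"
  have M: "summable M" unfolding M_def by (intro summable_add summable_Grunsky_diag m k)
  have le: "cmod (Grunsky_term m k j) \<le> M j" for j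
    using cmod_Grunsky_term_le unfolding M_def .
  show "summable (\<lambda>j. cmod (Grunsky_term m k j))"
    by (rule summable_comparison_test'[OF M]) (use le in simp)
  define \<rho> where "\<rho> = (\<lambda>n::nat. 1 + 1 / real (Suc n))"
  have \<rho>: "1 < \<rho> n" "\<rho> n \<le> 2" for n by (auto simp: \<rho>_def)
  have lim: "\<rho> \<longlonglongrightarrow> 1"
    unfolding \<rho>_def using tendsto_add[OF tendsto_const[of 1] LIMSEQ_inverse_real_of_nat] by (simp add: divide_inverse)
  let ?f = "\<lambda>w. poly (pderiv (F m)) w * cnj (poly (pderiv (F k)) w)"
  have 1: "(\<lambda>n. LINT w : region (\<rho> n) | lborel. ?f w) \<longlonglongrightarrow> (LINT w : D | lborel. ?f w)"
    by (intro integral_region_tendsto \<rho> lim continuous_intros)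
  have sm: "(\<Sum>j. Grunsky_term m k j / of_real (\<rho> n) ^ (2 * Suc j)) = ((if m = k then of_nat m * of_real (\<rho> n) ^ (2 * k) else 0)
      - (LINT w : region (\<rho> n) | lborel. ?f w) / pi) / (of_nat m * of_nat k)" for n
    using sums_unique[OF sums_integral_region_Faber[OF \<rho>(1) m k]] by simp
  have "(\<lambda>n. \<Sum>j. Grunsky_term m k j / of_real (\<rho> n) ^ (2 * Suc j)) \<longlonglongrightarrow> (\<Sum>j. Grunsky_term m k j)"
  proof -
    have "(\<lambda>n. Grunsky_term m k j / of_real (\<rho> n) ^ (2 * Suc j)) \<longlonglongrightarrow> Grunsky_term m k j / of_real 1 ^ (2 * Suc j)" for j
      by (intro tendsto_intros lim) auto
    then have l: "(\<lambda>n. Grunsky_term m k j / of_real (\<rho> n) ^ (2 * Suc j)) \<longlonglongrightarrow> Grunsky_term m k j" for j by simp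
    have "cmod (Grunsky_term m k j / of_real (\<rho> n) ^ (2 * Suc j)) \<le> M j" for j n
    proof -
      have "cmod (Grunsky_term m k j / of_real (\<rho> n) ^ (2 * Suc j)) = cmod (Grunsky_term m k j) / \<rho> n ^ (2 * Suc j)"
        using \<rho>(1)[of n] unfolding norm_divide norm_power norm_of_real by simp
      also have "\<dots> \<le> cmod (Grunsky_term m k j) / 1"
        using \<rho>(1)[of n] by (intro divide_left_mono one_le_power) auto
      finally show ?thesis using le[of j] by simp
    qed
    then have "\<forall>\<^sub>F (j, n) in at_top \<times>\<^sub>F sequentially. cmod (Grunsky_term m k j / of_real (\<rho> n) ^ (2 * Suc j)) \<le> M j"
      by (intro always_eventually) auto
    from tannerys_theorem[OF l this M] show ?thesis by simp
  qed
  then have "(\<lambda>n. ((if m = k then of_nat m * of_real (\<rho> n) ^ (2 * k) else 0)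
      - (LINT w : region (\<rho> n) | lborel. ?f w) / pi) / (of_nat m * of_nat k)) \<longlonglongrightarrow> (\<Sum>j. Grunsky_term m k j)"
    unfolding sm .
  moreover have "(\<lambda>n. ((if m = k then of_nat m * of_real (\<rho> n) ^ (2 * k) else 0)
      - (LINT w : region (\<rho> n) | lborel. ?f w) / pi) / (of_nat m * of_nat k))
    \<longlonglongrightarrow> ((if m = k then of_nat m * of_real 1 ^ (2 * k) else 0)
      - (LINT w : D | lborel. ?f w) / pi) / (of_nat m * of_nat k)"
  proof (intro tendsto_divide tendsto_diff tendsto_const 1)
    have "(\<lambda>n. of_nat m * complex_of_real (\<rho> n) ^ (2 * k)) \<longlonglongrightarrow> of_nat m * of_real 1 ^ (2 * k)"
      by (intro tendsto_intros lim)
    then show "(\<lambda>n. if m = k then of_nat m * complex_of_real (\<rho> n) ^ (2 * k) else 0)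
        \<longlonglongrightarrow> (if m = k then of_nat m * of_real 1 ^ (2 * k) else 0)"
      by (cases "m = k") simp_all
  qed (use m k in auto)
  ultimately have "(\<Sum>j. Grunsky_term m k j) = ((if m = k then of_nat m else 0)
      - (LINT w : D | lborel. ?f w) / pi) / (of_nat m * of_nat k)"
    using LIMSEQ_unique by fastforce
  then show "(LINT w : D | lborel. ?f w)
      = pi * ((if m = k then of_nat m else 0) - of_nat m * of_nat k * (\<Sum>j. Grunsky_term m k j))"
    using m k by (simp add: field_simps)
qed

end
end

section \<open>Vandermonde determinants and Andreief's identity\<close>

lemma det_mat_Leibniz:
  "Determinant.det (Matrix.mat n n f) = (\<Sum>p | p permutes {0..<n}. signof p * (\<Prod>i = 0..<n. f (i, p i)))"
proof -
  have "(\<Prod>i = 0..<n. Matrix.mat n n f $$ (i, p i)) = (\<Prod>i = 0..<n. f (i, p i))"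
    if "p permutes {0..<n}" for p
    using permutes_in_image[OF that] by (intro prod.cong) auto
  then show ?thesis unfolding Determinant.det_def by simp
qed

lemma det_mat_scale:
  fixes A :: "nat \<times> nat \<Rightarrow> 'a :: comm_ring_1"
  shows "Determinant.det (Matrix.mat n n (\<lambda>(i, j). u i * A (i, j) * v j))
    = (\<Prod>i<n. u i) * (\<Prod>i<n. v i) * Determinant.det (Matrix.mat n n A)"
proof -
  have "(\<Prod>i = 0..<n. u i * A (i, p i) * v (p i)) = (\<Prod>i<n. u i) * (\<Prod>i<n. v i) * (\<Prod>i = 0..<n. A (i, p i))"
    if "p permutes {0..<n}" for p
  proof -
    have "(\<Prod>i = 0..<n. v (p i)) = (\<Prod>i = 0..<n. v i)"
      using prod.permute[OF that, of v] by (simp add: o_def)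
    then show ?thesis by (simp add: prod.distrib lessThan_atLeast0 mult_ac)
  qed
  then show ?thesis
    by (simp add: det_mat_Leibniz sum_distrib_left mult.left_commute)
qed

lemma cnj_det_mat: "cnj (Determinant.det (Matrix.mat n n f)) = Determinant.det (Matrix.mat n n (\<lambda>ij. cnj (f ij)))"
  by (simp add: det_mat_Leibniz)

text \<open>
  The products form the Newton basis with nodes \<open>x i\<close>.  Subtracting a multiple of the top one lowers
  the degree of \<open>p\<close>.
\<close>

lemma poly_Newton_expansion:
  fixes p :: "'a :: field poly" and x :: "nat \<Rightarrow> 'a"
  assumes "degree p \<le> j"
  shows "\<exists>T. p = (\<Sum>l\<le>j. Polynomial.smult (T l) (\<Prod>i<l. [:- x i, 1:])) \<and> T j = Polynomial.coeff p j"
  using assms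
proof (induction j arbitrary: p)
  case 0
  then obtain c where "p = [:c:]" using degree_eq_zeroE[of p] by blast
  then show ?case by (intro exI[of _ "\<lambda>_. c"]) simp
next
  case (Suc j)
  define q where "q = (\<Prod>i<Suc j. [:- x i, 1:])"
  have dq: "degree q = Suc j" unfolding q_def by (subst degree_prod_eq_sum_degree) auto
  have mq: "Polynomial.coeff q (Suc j) = 1"
  proof -
    have "lead_coeff q = 1" unfolding q_def by (subst lead_coeff_prod) simp
    then show ?thesis by (simp add: dq)
  qed
  define p' where "p' = p - Polynomial.smult (Polynomial.coeff p (Suc j)) q"
  have "degree p' \<le> j"
  proof (rule degree_le, intro allI impI)
    fix i assume "j < i"
    then show "Polynomial.coeff p' i = 0"
      using Suc.prems dq mq by (cases "i = Suc j") (auto simp: p'_def coeff_eq_0)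
  qed
  from Suc.IH[OF this] obtain T where T: "p' = (\<Sum>l\<le>j. Polynomial.smult (T l) (\<Prod>i<l. [:- x i, 1:]))" by blast
  have "p = p' + Polynomial.smult (Polynomial.coeff p (Suc j)) q" by (simp add: p'_def)
  then show ?case
    using T by (intro exI[of _ "T(Suc j := Polynomial.coeff p (Suc j))"]) (simp add: q_def del: prod.lessThan_Suc)
qed

text \<open>
  In the Newton basis with the same nodes the evaluation matrix is lower triangular, with the
  products of differences of the nodes on the diagonal, and the change of basis is upper triangular.
\<close>

lemma det_Vandermonde_poly:
  fixes p :: "nat \<Rightarrow> 'a :: field poly" and x :: "nat \<Rightarrow> 'a"
  assumes deg: "\<And>j. j < n \<Longrightarrow> degree (p j) \<le> j"
  shows "Determinant.det (Matrix.mat n n (\<lambda>(i, j). poly (p j) (x i)))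
    = (\<Prod>j<n. Polynomial.coeff (p j) j) * (\<Prod>i<n. \<Prod>k<i. x i - x k)"
proof -
  define q where "q = (\<lambda>l. \<Prod>i<l. [:- x i, 1:])"
  have "\<forall>j\<in>{..<n}. \<exists>T. p j = (\<Sum>l\<le>j. Polynomial.smult (T l) (q l)) \<and> T j = Polynomial.coeff (p j) j"
    using poly_Newton_expansion deg unfolding q_def by blast
  then obtain T where T: "\<And>j. j < n \<Longrightarrow> p j = (\<Sum>l\<le>j. Polynomial.smult (T j l) (q l))"
      "\<And>j. j < n \<Longrightarrow> T j j = Polynomial.coeff (p j) j"
    unfolding Ball_def lessThan_iff by metis
  define Q where "Q = Matrix.mat n n (\<lambda>(i, l). poly (q l) (x i))"
  define U where "U = Matrix.mat n n (\<lambda>(l, j). if l \<le> j then T j l else 0)"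
  have c: "Q \<in> carrier_mat n n" "U \<in> carrier_mat n n" by (simp_all add: Q_def U_def)
  have "Matrix.mat n n (\<lambda>(i, j). poly (p j) (x i)) = Q * U"
  proof (rule eq_matI)
    fix i j assume "i < dim_row (Q * U)" "j < dim_col (Q * U)"
    then have ij: "i < n" "j < n" using c by auto
    have "poly (p j) (x i) = (\<Sum>l\<le>j. T j l * poly (q l) (x i))"
      using T(1)[OF ij(2)] by (simp add: poly_sum)
    also have "\<dots> = (\<Sum>l = 0..<n. poly (q l) (x i) * (if l \<le> j then T j l else 0))"
      using ij by (intro sum.mono_neutral_cong_left) auto
    also have "\<dots> = (Q * U) $$ (i, j)"
      using ij c by (simp add: scalar_prod_def Q_def U_def)
    finally show "Matrix.mat n n (\<lambda>(i, j). poly (p j) (x i)) $$ (i, j) = (Q * U) $$ (i, j)"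
      using ij by simp
  qed (use c in auto)
  then have "Determinant.det (Matrix.mat n n (\<lambda>(i, j). poly (p j) (x i))) = Determinant.det Q * Determinant.det U"
    using Determinant.det_mult[OF c] by simp
  also have "Determinant.det Q = (\<Prod>i<n. \<Prod>k<i. x i - x k)"
  proof -
    have "Q $$ (i, j) = 0" if "i < j" "j < n" for i j
      using that by (auto simp: Q_def q_def poly_prod)
    then have "Determinant.det Q = prod_list (diag_mat Q)"
      using c(1) by (rule det_lower_triangular)
    also have "\<dots> = (\<Prod>i<n. Q $$ (i, i))"
      using c by (simp add: diag_mat_def prod.list_conv_set_nth lessThan_atLeast0)
    also have "\<dots> = (\<Prod>i<n. \<Prod>k<i. x i - x k)"
      by (rule prod.cong) (auto simp: Q_def q_def poly_prod)
    finally show ?thesis .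
  qed
  also have "Determinant.det U = (\<Prod>j<n. Polynomial.coeff (p j) j)"
  proof -
    have "upper_triangular U" by (auto simp: upper_triangular_def U_def)
    then have "Determinant.det U = prod_list (diag_mat U)"
      using c(2) by (rule det_upper_triangular)
    also have "\<dots> = (\<Prod>i<n. U $$ (i, i))"
      using c by (simp add: diag_mat_def prod.list_conv_set_nth lessThan_atLeast0)
    also have "\<dots> = (\<Prod>j<n. Polynomial.coeff (p j) j)"
      by (rule prod.cong) (auto simp: U_def T(2))
    finally show ?thesis .
  qed
  finally show ?thesis by (simp add: mult.commute)
qed

text \<open>
  Expanding both determinants by permutations \<open>p\<close> and \<open>q\<close> makes the integral of each term a product of
  integrals over a single variable.  The sum over \<open>q\<close> is the determinant of the Gram matrix with rows
  permuted by \<open>p\<close>, so that each of the \<open>n!\<close> permutations \<open>p\<close> contributes the same amount.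
\<close>

lemma Andreief_identity:
  fixes f :: "nat \<Rightarrow> 'a \<Rightarrow> complex"
  assumes sf: "sigma_finite_measure M"
    and int: "\<And>j k. j < n \<Longrightarrow> k < n \<Longrightarrow> set_integrable M D (\<lambda>w. f j w * cnj (f k w))"
  defines "V \<equiv> \<lambda>z. Determinant.det (Matrix.mat n n (\<lambda>(i, j). f j (z (Suc i))))"
  shows "set_integrable (Pi\<^sub>M {1..n} (\<lambda>_. M)) (Pi\<^sub>E {1..n} (\<lambda>_. D)) (\<lambda>z. V z * cnj (V z))"
    and "(LINT z : Pi\<^sub>E {1..n} (\<lambda>_. D) | Pi\<^sub>M {1..n} (\<lambda>_. M). V z * cnj (V z))
      = fact n * Determinant.det (Matrix.mat n n (\<lambda>(j, k). LINT w : D | M. f j w * cnj (f k w)))"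
proof -
  let ?M = "Pi\<^sub>M {1..n} (\<lambda>_. M)"
  let ?S = "{p. p permutes {0..<n}}"
  interpret product_sigma_finite "\<lambda>_::nat. M"
    using sf by (simp add: product_sigma_finite_def)
  define G where "G = (\<lambda>j k. LINT w : D | M. f j w * cnj (f k w))"
  define h where "h = (\<lambda>p q i w. indicator D w *\<^sub>R (f (p (i - Suc 0)) w * cnj (f (q (i - Suc 0)) w)))"
  have hint: "integrable M (h p q i)" if "p permutes {0..<n}" "q permutes {0..<n}" "i \<in> {1..n}" for p q i
  proof -
    have "i - Suc 0 \<in> {0..<n}" using that(3) by auto
    then have "p (i - Suc 0) < n" "q (i - Suc 0) < n"
      using permutes_in_image[OF that(1)] permutes_in_image[OF that(2)] by auto
    from int[OF this] show ?thesis unfolding h_def set_integrable_def .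
  qed
  have shift: "(\<Prod>i = 0..<n. c (Suc i)) = (\<Prod>i\<in>{1..n}. c i)" for c :: "nat \<Rightarrow> complex"
    by (rule prod.reindex_bij_witness[of _ "\<lambda>i. i - 1" Suc]) auto
  have eq: "indicator (Pi\<^sub>E {1..n} (\<lambda>_. D)) z *\<^sub>R (V z * cnj (V z))
      = (\<Sum>p\<in>?S. \<Sum>q\<in>?S. (signof p * signof q) * (\<Prod>i\<in>{1..n}. h p q i (z i)))"
    if z: "z \<in> space ?M" for z
  proof (cases "z \<in> Pi\<^sub>E {1..n} (\<lambda>_. D)")
    case True
    then have zD: "z i \<in> D" if "i \<in> {1..n}" for i using that by auto
    have "V z * cnj (V z) = (\<Sum>p\<in>?S. \<Sum>q\<in>?S. (signof p * (\<Prod>i = 0..<n. f (p i) (z (Suc i))))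
        * (signof q * (\<Prod>i = 0..<n. cnj (f (q i) (z (Suc i))))))"
      unfolding V_def cnj_det_mat det_mat_Leibniz by (simp add: sum_product)
    also have "\<dots> = (\<Sum>p\<in>?S. \<Sum>q\<in>?S. (signof p * signof q) * (\<Prod>i = 0..<n. h p q (Suc i) (z (Suc i))))"
    proof (intro sum.cong refl)
      fix p q
      have "(\<Prod>i = 0..<n. h p q (Suc i) (z (Suc i))) = (\<Prod>i = 0..<n. f (p i) (z (Suc i)) * cnj (f (q i) (z (Suc i))))"
        using zD by (intro prod.cong) (auto simp: h_def)
      then show "(signof p * (\<Prod>i = 0..<n. f (p i) (z (Suc i)))) * (signof q * (\<Prod>i = 0..<n. cnj (f (q i) (z (Suc i)))))
        = (signof p * signof q) * (\<Prod>i = 0..<n. h p q (Suc i) (z (Suc i)))"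
        by (simp add: prod.distrib mult_ac)
    qed
    finally have "V z * cnj (V z)
        = (\<Sum>p\<in>?S. \<Sum>q\<in>?S. (signof p * signof q) * (\<Prod>i\<in>{1..n}. h p q i (z i)))"
      unfolding shift[of "\<lambda>i. h _ _ i (z i)"] .
    then show ?thesis using True by simp
  next
    case False
    then obtain i where "i \<in> {1..n}" "z i \<notin> D"
      using z by (auto simp: space_PiM PiE_iff)
    then have pz: "(\<Prod>i\<in>{1..n}. h p q i (z i)) = 0" for p q
      by (intro prod_zero bexI[of _ i]) (auto simp: h_def)
    show ?thesis using False unfolding pz by simp
  qed
  have int2: "integrable ?M (\<lambda>z. \<Sum>p\<in>?S. \<Sum>q\<in>?S. (signof p * signof q) * (\<Prod>i\<in>{1..n}. h p q i (z i)))"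
    using hint by (intro Bochner_Integration.integrable_sum integrable_mult_right product_integrable_prod) auto
  then show "set_integrable ?M (Pi\<^sub>E {1..n} (\<lambda>_. D)) (\<lambda>z. V z * cnj (V z))"
    unfolding set_integrable_def using eq by (subst Bochner_Integration.integrable_cong[OF refl]) auto
  have "(LINT z : Pi\<^sub>E {1..n} (\<lambda>_. D) | ?M. V z * cnj (V z))
      = (LINT z | ?M. (\<Sum>p\<in>?S. \<Sum>q\<in>?S. (signof p * signof q) * (\<Prod>i\<in>{1..n}. h p q i (z i))))"
    unfolding set_lebesgue_integral_def using eq by (intro Bochner_Integration.integral_cong) auto
  also have "\<dots> = (\<Sum>p\<in>?S. \<Sum>q\<in>?S. (signof p * signof q) * (LINT z | ?M. (\<Prod>i\<in>{1..n}. h p q i (z i))))"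
  proof -
    have it: "integrable ?M (\<lambda>z. \<Prod>i\<in>{1..n}. h p q i (z i))" if "p \<in> ?S" "q \<in> ?S" for p q
      using hint that by (intro product_integrable_prod) auto
    have "(LINT z | ?M. (\<Sum>p\<in>?S. \<Sum>q\<in>?S. (signof p * signof q) * (\<Prod>i\<in>{1..n}. h p q i (z i))))
        = (\<Sum>p\<in>?S. LINT z | ?M. (\<Sum>q\<in>?S. (signof p * signof q) * (\<Prod>i\<in>{1..n}. h p q i (z i))))"
      by (intro Bochner_Integration.integral_sum Bochner_Integration.integrable_sum integrable_mult_right it)
    also have "\<dots> = (\<Sum>p\<in>?S. \<Sum>q\<in>?S. LINT z | ?M. (signof p * signof q) * (\<Prod>i\<in>{1..n}. h p q i (z i)))"
      by (intro sum.cong refl Bochner_Integration.integral_sum integrable_mult_right it)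
    finally show ?thesis by (simp only: integral_mult_right_zero)
  qed
  also have "\<dots> = (\<Sum>p\<in>?S. \<Sum>q\<in>?S. (signof p * signof q) * (\<Prod>i = 0..<n. G (p i) (q i)))"
  proof (intro sum.cong refl)
    fix p q assume pq: "p \<in> ?S" "q \<in> ?S"
    have "(LINT z | ?M. (\<Prod>i\<in>{1..n}. h p q i (z i))) = (\<Prod>i\<in>{1..n}. integral\<^sup>L M (h p q i))"
      using hint pq by (intro product_integral_prod) auto
    also have "\<dots> = (\<Prod>i = 0..<n. G (p i) (q i))"
      unfolding shift[symmetric] by (simp add: G_def h_def set_lebesgue_integral_def)
    finally show "(signof p * signof q) * (LINT z | ?M. (\<Prod>i\<in>{1..n}. h p q i (z i)))
      = (signof p * signof q) * (\<Prod>i = 0..<n. G (p i) (q i))" by simp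
  qed
  also have "\<dots> = (\<Sum>p\<in>?S. signof p * (signof p * Determinant.det (Matrix.mat n n (\<lambda>(j, k). G j k))))"
  proof (rule sum.cong[OF refl])
    fix p assume "p \<in> ?S"
    then have p: "p permutes {0..<n}" by simp
    have "Determinant.det (Matrix.mat n n (\<lambda>(i, j). Matrix.mat n n (\<lambda>(j, k). G j k) $$ (p i, j)))
        = signof p * Determinant.det (Matrix.mat n n (\<lambda>(j, k). G j k))"
      by (rule det_permute_rows[OF _ p]) simp
    moreover have "Matrix.mat n n (\<lambda>(i, j). Matrix.mat n n (\<lambda>(j, k). G j k) $$ (p i, j)) = Matrix.mat n n (\<lambda>(i, j). G (p i) j)"
      using permutes_in_image[OF p] by (intro eq_matI) auto
    ultimately have "(\<Sum>q\<in>?S. signof q * (\<Prod>i = 0..<n. G (p i) (q i)))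
        = signof p * Determinant.det (Matrix.mat n n (\<lambda>(j, k). G j k))"
      by (simp add: det_mat_Leibniz)
    then show "(\<Sum>q\<in>?S. (signof p * signof q) * (\<Prod>i = 0..<n. G (p i) (q i)))
        = signof p * (signof p * Determinant.det (Matrix.mat n n (\<lambda>(j, k). G j k)))"
      by (simp add: mult.assoc flip: sum_distrib_left)
  qed
  also have "\<dots> = (\<Sum>p\<in>?S. Determinant.det (Matrix.mat n n (\<lambda>(j, k). G j k)))"
    by (intro sum.cong refl) (simp add: sign_def)
  also have "\<dots> = fact n * Determinant.det (Matrix.mat n n (\<lambda>(j, k). G j k))"
    by (simp add: card_permutations[of _ n])
  finally show "(LINT z : Pi\<^sub>E {1..n} (\<lambda>_. D) | ?M. V z * cnj (V z))
      = fact n * Determinant.det (Matrix.mat n n (\<lambda>(j, k). LINT w : D | M. f j w * cnj (f k w)))"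
    unfolding G_def .
qed

section \<open>The partition function and the finite-section determinant\<close>

lemma prod_ordered_pairs:
  fixes h :: "nat \<Rightarrow> nat \<Rightarrow> 'b :: comm_monoid_mult"
  shows "(\<Prod>(k, l)\<in>{(k, l). 1 \<le> k \<and> k < l \<and> l \<le> n}. h k l) = (\<Prod>i<n. \<Prod>k<i. h (Suc k) (Suc i))"
proof -
  have "(\<Prod>i<n. \<Prod>k<i. h (Suc k) (Suc i)) = (\<Prod>(i, k)\<in>Sigma {..<n} (\<lambda>i. {..<i}). h (Suc k) (Suc i))"
    by (rule prod.Sigma) auto
  also have "\<dots> = (\<Prod>(k, l)\<in>{(k, l). 1 \<le> k \<and> k < l \<and> l \<le> n}. h k l)"
    by (rule prod.reindex_bij_witness[of _ "\<lambda>(k, l). (l - 1, k - 1)" "\<lambda>(i, k). (Suc k, Suc i)"]) auto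
  finally show ?thesis by simp
qed

lemma Vandermonde_poly_norm:
  fixes p :: "nat \<Rightarrow> complex poly"
  assumes "\<And>j. j < n \<Longrightarrow> degree (p j) \<le> j"
  defines "V \<equiv> \<lambda>z. Determinant.det (Matrix.mat n n (\<lambda>(i, j). poly (p j) (z (Suc i))))"
  shows "V z * cnj (V z) = of_real ((\<Prod>j<n. (cmod (Polynomial.coeff (p j) j))\<^sup>2)
    * (\<Prod>(k, l)\<in>{(k, l). 1 \<le> k \<and> k < l \<and> l \<le> n}. (cmod (z k - z l))\<^sup>2))"
proof -
  have V: "V z = (\<Prod>j<n. Polynomial.coeff (p j) j) * (\<Prod>i<n. \<Prod>k<i. z (Suc i) - z (Suc k))"
    unfolding V_def using det_Vandermonde_poly[of n p "\<lambda>i. z (Suc i)"] assms(1) by simp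
  have "V z * cnj (V z) = of_real ((cmod (V z))\<^sup>2)" by (simp only: complex_norm_square)
  also have "(cmod (V z))\<^sup>2 = (\<Prod>j<n. (cmod (Polynomial.coeff (p j) j))\<^sup>2)
      * (\<Prod>i<n. \<Prod>k<i. (cmod (z (Suc k) - z (Suc i)))\<^sup>2)"
    unfolding V norm_mult power_mult_distrib by (simp add: prod_norm[symmetric] prod_power_distrib norm_minus_commute)
  finally show ?thesis unfolding prod_ordered_pairs .
qed

lemma set_integrable_continuous_bounded:
  fixes f :: "'a :: euclidean_space \<Rightarrow> 'b :: {banach, second_countable_topology}"
  assumes "bounded D" "D \<in> sets borel" "continuous_on UNIV f"
  shows "set_integrable lborel D f"
proof (rule set_integrable_subset)
  show "set_integrable lborel (closure D) f"
    unfolding set_integrable_def using assms(1,3)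
    by (intro borel_integrable_compact) (auto simp: compact_closure intro: continuous_on_subset)
qed (use assms closure_subset in auto)

lemma emeasure_lborel_open_nonzero:
  fixes S :: "'a :: euclidean_space set"
  assumes "open S" "S \<noteq> {}"
  shows "emeasure lborel S \<noteq> 0"
proof
  assume "emeasure lborel S = 0"
  then have "S \<in> null_sets lborel" using assms(1) by (auto intro: null_setsI)
  then have "negligible S" by (simp add: negligible_iff_null_sets null_sets_completionI)
  then show False using open_not_negligible assms by blast
qed

lemma exists_disjoint_balls:
  fixes D :: "complex set"
  assumes "open D" "D \<noteq> {}"
  shows "\<exists>(x :: nat \<Rightarrow> complex) \<delta>. 0 < \<delta> \<and> (\<forall>i\<in>{1..n}. ball (x i) \<delta> \<subseteq> D)
    \<and> (\<forall>i j. i \<noteq> j \<longrightarrow> ball (x i) \<delta> \<inter> ball (x j) \<delta> = {})"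
proof -
  obtain c e where e: "0 < e" "ball c e \<subseteq> D"
    using assms open_contains_ball by (metis ex_in_conv)
  define \<delta> where "\<delta> = e / (2 * (real n + 1))"
  \<comment> \<open>The balls touch one another along a radius of the ball around \<open>c\<close>; the factor \<open>n + 1\<close> leaves room
    for the last one.\<close>
  define x where "x = (\<lambda>i::nat. c + of_real (2 * \<delta> * real i))"
  have \<delta>: "0 < \<delta>" "2 * \<delta> * (real n + 1) = e"
    using e by (auto simp: \<delta>_def field_simps)
  show ?thesis
  proof (intro exI[of _ x] exI[of _ \<delta>] conjI ballI allI impI \<delta>(1))
    fix i assume i: "i \<in> {1..n}"
    have "dist c (x i) = 2 * \<delta> * real i"
      using \<delta> by (simp add: x_def dist_norm norm_mult)
    moreover have "2 * \<delta> * real i \<le> 2 * \<delta> * real n" using i \<delta> by (intro mult_left_mono) auto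
    moreover have "2 * \<delta> * (real n + 1) = 2 * \<delta> * real n + 2 * \<delta>" by (simp add: algebra_simps)
    ultimately have "dist c (x i) + \<delta> \<le> e" using \<delta> by linarith
    then have "ball (x i) \<delta> \<subseteq> ball c e" by (simp add: ball_subset_ball_iff dist_commute)
    then show "ball (x i) \<delta> \<subseteq> D" using e by blast
  next
    fix i j :: nat assume ij: "i \<noteq> j"
    have "x i - x j = of_real (2 * \<delta> * (real i - real j))"
      by (simp add: x_def algebra_simps)
    then have "dist (x i) (x j) = 2 * \<delta> * \<bar>real i - real j\<bar>"
      using \<delta> by (simp only: dist_norm norm_of_real abs_mult)
    moreover have "1 \<le> \<bar>real i - real j\<bar>" using ij by linarith
    then have "2 * \<delta> * 1 \<le> 2 * \<delta> * \<bar>real i - real j\<bar>" using \<delta> by (intro mult_left_mono) auto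
    ultimately have far: "2 * \<delta> \<le> dist (x i) (x j)" by simp
    have False if "u \<in> ball (x i) \<delta>" "u \<in> ball (x j) \<delta>" for u
      using dist_triangle2[of "x i" "x j" u] that far by simp
    then show "ball (x i) \<delta> \<inter> ball (x j) \<delta> = {}" by blast
  qed
qed

text \<open>
  The integrand is positive on a product of disjoint balls in \<open>D\<close>.
\<close>

lemma partition_function_pos:
  assumes D: "open D" "D \<noteq> {}"
    and int: "set_integrable (Pi\<^sub>M {1..n} (\<lambda>_. lborel)) (Pi\<^sub>E {1..n} (\<lambda>_. D))
      (\<lambda>z. \<Prod>(k, l)\<in>{(k, l). 1 \<le> k \<and> k < l \<and> l \<le> n}. (cmod (z k - z l))\<^sup>2)"
  shows "0 < partition_function n D"
proof -
  let ?M = "Pi\<^sub>M {1..n} (\<lambda>_. lborel :: complex measure)"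
  let ?f = "\<lambda>z. indicator (Pi\<^sub>E {1..n} (\<lambda>_. D)) z *\<^sub>R (\<Prod>(k, l)\<in>{(k, l). 1 \<le> k \<and> k < l \<and> l \<le> n}. (cmod (z k - z l))\<^sup>2)"
  interpret product_sigma_finite "\<lambda>_::nat. lborel :: complex measure" by standard
  have nn: "0 \<le> ?f z" for z by (intro scaleR_nonneg_nonneg prod_nonneg) auto
  have "integral\<^sup>L ?M ?f \<noteq> 0"
  proof
    assume "integral\<^sup>L ?M ?f = 0"
    then have ae: "AE z in ?M. ?f z = 0"
      using integral_nonneg_eq_0_iff_AE[OF int[unfolded set_integrable_def]] nn by simp
    obtain x \<delta> where x: "0 < \<delta>" "\<And>i. i \<in> {1..n} \<Longrightarrow> ball (x i) \<delta> \<subseteq> D"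
      "\<And>i j. i \<noteq> j \<Longrightarrow> ball (x i) \<delta> \<inter> ball (x j) \<delta> = {}"
      using exists_disjoint_balls[OF D, of n] by blast
    define E where "E = Pi\<^sub>E {1..n} (\<lambda>i. ball (x i) \<delta>)"
    have "?f z \<noteq> 0" if z: "z \<in> E" for z
    proof -
      have zb: "z i \<in> ball (x i) \<delta>" if "i \<in> {1..n}" for i using z that unfolding E_def PiE_iff by blast
      have zD: "z \<in> Pi\<^sub>E {1..n} (\<lambda>_. D)"
        using z x(2) unfolding E_def PiE_iff by blast
      have ne: "z k \<noteq> z l" if "1 \<le> k" "k < l" "l \<le> n" for k l
      proof -
        have k: "z k \<in> ball (x k) \<delta>" by (rule zb) (use that in simp)
        have l: "z l \<in> ball (x l) \<delta>" by (rule zb) (use that in simp)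
        have "ball (x k) \<delta> \<inter> ball (x l) \<delta> = {}" by (rule x(3)) (use that in simp)
        with k l show ?thesis unfolding disjoint_iff by metis
      qed
      have fin: "finite {(k, l). 1 \<le> k \<and> k < l \<and> l \<le> n}"
        by (rule finite_subset[of _ "{1..n} \<times> {1..n}"]) auto
      have "(\<Prod>(k, l)\<in>{(k, l). 1 \<le> k \<and> k < l \<and> l \<le> n}. (cmod (z k - z l))\<^sup>2) \<noteq> 0"
        unfolding prod_zero_iff[OF fin] using ne by auto
      with zD show ?thesis by simp
    qed
    then have "AE z in ?M. z \<notin> E" using ae by (auto elim: eventually_mono)
    moreover have E: "E \<in> sets ?M" unfolding E_def by (intro sets_PiM_I_finite) auto
    ultimately have "emeasure ?M E = 0" using AE_iff_null_sets by blast
    moreover have "emeasure ?M E = (\<Prod>i\<in>{1..n}. emeasure lborel (ball (x i) \<delta>))"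
      unfolding E_def by (intro emeasure_PiM) auto
    moreover have "emeasure lborel (ball (x i) \<delta>) \<noteq> 0" for i
      using x(1) by (intro emeasure_lborel_open_nonzero) auto
    then have "(\<Prod>i\<in>{1..n}. emeasure lborel (ball (x i) \<delta>)) \<noteq> 0"
      by (simp add: prod_zero_iff)
    ultimately show False by simp
  qed
  moreover have "0 \<le> integral\<^sup>L ?M ?f" using nn by (intro integral_nonneg_AE) auto
  ultimately have "0 < integral\<^sup>L ?M ?f" by simp
  then show ?thesis unfolding partition_function_def set_lebesgue_integral_def by simp
qed

text \<open>
  Beyond \<open>n\<close> the finite sections are block diagonal with an identity block, hence their determinants
  are eventually constant.
\<close>

lemma det_identity_minus_corner:
  fixes K :: "nat \<Rightarrow> nat \<Rightarrow> 'a :: idom"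
  assumes "n \<le> N"
  shows "Determinant.det (Matrix.mat N N (\<lambda>(i, j). (if i = j then 1 else 0) - (if i < n \<and> j < n then K i j else 0)))
    = Determinant.det (Matrix.mat n n (\<lambda>(i, j). (if i = j then 1 else 0) - K i j))"
proof -
  define m where "m = N - n"
  have N: "N = n + m" using assms by (simp add: m_def)
  let ?A = "Matrix.mat n n (\<lambda>(i, j). (if i = j then 1 else 0) - K i j)"
  have "Matrix.mat N N (\<lambda>(i, j). (if i = j then 1 else 0) - (if i < n \<and> j < n then K i j else 0))
      = four_block_mat ?A (0\<^sub>m n m) (0\<^sub>m m n) (1\<^sub>m m)"
    unfolding N by (rule eq_matI) auto
  then show ?thesis
    using det_four_block_mat_lower_left_zero[of ?A n "0\<^sub>m n m" m "0\<^sub>m m n" "1\<^sub>m m"] by simp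
qed

lemma infsum_single_term:
  assumes "k \<in> A" "\<And>j. j \<in> A \<Longrightarrow> j \<noteq> k \<Longrightarrow> f j = 0"
  shows "infsum f A = f k"
proof -
  have "infsum f A = infsum f {k}"
    using assms by (intro infsum_cong_neutral) auto
  then show ?thesis by simp
qed

lemma Grunsky_operator_unit_seq:
  "Grunsky_operator a (unit_seq k) m = (if 1 \<le> k then of_real (sqrt (real m * real k)) * a m k else 0)"
proof (cases "1 \<le> k")
  case True
  then show ?thesis
    unfolding Grunsky_operator_def by (subst infsum_single_term[of k]) (auto simp: unit_seq_def)
next
  case False
  then show ?thesis
    unfolding Grunsky_operator_def by (auto simp: unit_seq_def intro!: infsum_0)
qed

lemma adjoint_op_unit_seq:
  assumes "1 \<le> m"
  shows "adjoint_op T (unit_seq m) k = cnj (T (unit_seq k) m)"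
  unfolding adjoint_op_def inner_seq_def using assms
  by (subst infsum_single_term[of m]) (auto simp: unit_seq_def)

section \<open>The partition function in terms of Grunsky coefficients\<close>

context exterior_map begin

text \<open>
  The entry \<open>(i + 1, j + 1)\<close> of \<open>B B\<^sup>*\<close>.
\<close>

definition Grunsky_Gram :: "nat \<Rightarrow> nat \<Rightarrow> complex" where
  "Grunsky_Gram i j = of_real (sqrt (real (Suc i)) * sqrt (real (Suc j))) * (\<Sum>l. Grunsky_term (Suc i) (Suc j) l)"

lemma summable_Grunsky_term:
  assumes "1 \<le> m" "1 \<le> k"
  shows "summable (\<lambda>j. cmod (Grunsky_term m k j))"
proof -
  have "\<forall>m\<in>{1..}. \<exists>F. \<forall>z. 1 < cmod z \<longrightarrow> poly F (g z) = Faber_pullback m z"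
    using Faber_polynomial_exists by auto
  then obtain F where "\<And>m z. 1 \<le> m \<Longrightarrow> 1 < cmod z \<Longrightarrow> poly (F m) (g z) = Faber_pullback m z"
    unfolding Ball_def atLeast_iff by metis
  from integral_D_Faber(1)[OF this assms] show ?thesis by simp
qed

text \<open>
  The factor \<open>l = \<surd>l \<surd>l\<close> in the series of \<open>Grunsky_term\<close> is shared between the matrix \<open>B\<close> and its adjoint.
\<close>

lemma Grunsky_operator_adjoint_unit_seq:
  "Grunsky_operator a (adjoint_op (Grunsky_operator a) (unit_seq (Suc j))) (Suc i) = Grunsky_Gram i j"
proof -
  let ?t = "Grunsky_term (Suc i) (Suc j)"
  have "(?t has_sum (\<Sum>l. ?t l)) UNIV"
    using summable_Grunsky_term[of "Suc i" "Suc j"]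
    by (intro norm_summable_imp_has_sum) (auto simp: summable_norm_cancel summable_sums)
  then have "((\<lambda>l. of_nat l * a (Suc i) l * cnj (a (Suc j) l)) has_sum (\<Sum>l. ?t l)) (Suc ` UNIV)"
  proof (subst has_sum_reindex)
    have "?t = (\<lambda>l. of_nat l * a (Suc i) l * cnj (a (Suc j) l)) \<circ> Suc"
      by (simp only: o_def Grunsky_term_def[abs_def])
    then show "((\<lambda>l. of_nat l * a (Suc i) l * cnj (a (Suc j) l)) \<circ> Suc has_sum (\<Sum>l. ?t l)) UNIV"
      using \<open>(?t has_sum (\<Sum>l. ?t l)) UNIV\<close> by simp
  qed simp
  then have "((\<lambda>l. of_nat l * a (Suc i) l * cnj (a (Suc j) l)) has_sum (\<Sum>l. ?t l)) {1..}"
    by (simp add: atLeast_Suc_greaterThan greaterThan_0)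
  then have "((\<lambda>l. of_real (sqrt (real (Suc i)) * sqrt (real (Suc j))) * (of_nat l * a (Suc i) l * cnj (a (Suc j) l)))
      has_sum Grunsky_Gram i j) {1..}"
    unfolding Grunsky_Gram_def by (rule has_sum_cmult_right)
  moreover have "of_real (sqrt (real (Suc i)) * sqrt (real (Suc j))) * (of_nat l * a (Suc i) l * cnj (a (Suc j) l))
      = of_real (sqrt (real (Suc i) * real l)) * a (Suc i) l * adjoint_op (Grunsky_operator a) (unit_seq (Suc j)) l"
    if "l \<in> {1..}" for l
  proof -
    have "of_nat l = complex_of_real (sqrt (real l)) * complex_of_real (sqrt (real l))"
      by (simp flip: of_real_mult)
    then show ?thesis
      using that by (simp add: adjoint_op_unit_seq Grunsky_operator_unit_seq real_sqrt_mult mult_ac)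
  qed
  ultimately have "((\<lambda>l. of_real (sqrt (real (Suc i) * real l)) * a (Suc i) l * adjoint_op (Grunsky_operator a) (unit_seq (Suc j)) l)
      has_sum Grunsky_Gram i j) {1..}"
    by (rule has_sum_cong[THEN iffD1, rotated])
  then show ?thesis unfolding Grunsky_operator_def by (rule infsumI)
qed

lemma Fredholm_det_Grunsky:
  "Fredholm_det (\<lambda>x k. x k - (coord_proj n \<circ> Grunsky_operator a \<circ> adjoint_op (Grunsky_operator a) \<circ> coord_proj n) x k)
    = Determinant.det (Matrix.mat n n (\<lambda>(i, j). (if i = j then 1 else 0) - Grunsky_Gram i j))"
proof -
  let ?B = "Grunsky_operator a"
  let ?T = "\<lambda>x k. x k - (coord_proj n \<circ> ?B \<circ> adjoint_op ?B \<circ> coord_proj n) x k"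
  have us: "unit_seq (Suc j) (Suc i) = (if i = j then 1 else 0)" for i j
    by (simp add: unit_seq_def)
  have cp: "coord_proj n y (Suc i) = (if i < n then y (Suc i) else 0)" for y i
    by (simp add: coord_proj_def Suc_le_eq)
  have entry: "?T (unit_seq (Suc j)) (Suc i)
      = (if i = j then 1 else 0) - (if i < n \<and> j < n then Grunsky_Gram i j else 0)" for i j
  proof (cases "j < n")
    case True
    then have "coord_proj n (unit_seq (Suc j)) = unit_seq (Suc j)"
      by (auto simp: coord_proj_def unit_seq_def)
    then show ?thesis
      using True by (simp add: us cp Grunsky_operator_adjoint_unit_seq)
  next
    case False
    then have "coord_proj n (unit_seq (Suc j)) = (\<lambda>_. 0)"
      by (auto simp: coord_proj_def unit_seq_def)
    moreover have "adjoint_op ?B (\<lambda>_. 0) = (\<lambda>_. 0)"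
      by (simp add: adjoint_op_def inner_seq_def)
    moreover have "?B (\<lambda>_. 0) = (\<lambda>_. 0)"
      by (simp add: Grunsky_operator_def)
    ultimately show ?thesis using False by (simp add: coord_proj_def unit_seq_def)
  qed
  have "Determinant.det (Matrix.mat N N (\<lambda>(i, j). ?T (unit_seq (Suc j)) (Suc i)))
      = Determinant.det (Matrix.mat n n (\<lambda>(i, j). (if i = j then 1 else 0) - Grunsky_Gram i j))" if "n \<le> N" for N
    unfolding entry using det_identity_minus_corner[OF that] .
  then have "(\<lambda>N. Determinant.det (Matrix.mat N N (\<lambda>(i, j). ?T (unit_seq (Suc j)) (Suc i))))
      \<longlonglongrightarrow> Determinant.det (Matrix.mat n n (\<lambda>(i, j). (if i = j then 1 else 0) - Grunsky_Gram i j))"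
    by (intro tendsto_eventually eventually_sequentiallyI[of n])
  then show ?thesis unfolding Fredholm_det_def by (rule limI)
qed

text \<open>
  These are the powers of \<open>r\<close> in the squared leading coefficients of the Faber polynomials.
\<close>

lemma prod_powers_capacity: "(\<Prod>j<n. (1 / r ^ Suc j)\<^sup>2) = 1 / r ^ (n * (n + 1))"
proof (induction n)
  case (Suc n)
  have "Suc n * (Suc n + 1) = n * (n + 1) + Suc n * 2" by simp
  then have "r ^ (Suc n * (Suc n + 1)) = r ^ (n * (n + 1)) * (r ^ Suc n)\<^sup>2"
    by (simp only: power_add power_mult)
  then show ?case using Suc by (simp add: power_divide)
qed simp

text \<open>
  Andreief's identity is applied to the derivatives of the Faber polynomials.  Pulling \<open>\<pi> \<surd>(j + 1)\<close> out of
  the rows and \<open>\<surd>(k + 1)\<close> out of the columns of their Gram matrix yields \<open>\<pi>\<^sup>n n!\<close>, and the product \<open>C\<close> of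
  their squared leading coefficients is \<open>(n!)\<^sup>2\<close> divided by the power of \<open>r\<close>.
\<close>

lemma partition_function_Grunsky:
  shows "0 < partition_function n D"
    and "complex_of_real (partition_function n D) = of_real (pi ^ n / fact n * r ^ (n * (n + 1)))
      * Determinant.det (Matrix.mat n n (\<lambda>(i, j). (if i = j then 1 else 0) - Grunsky_Gram i j))"
proof -
  have "\<forall>m\<in>{1..}. \<exists>F. degree F \<le> m \<and> Polynomial.coeff F m = 1 / of_real r ^ m
      \<and> (\<forall>z. 1 < cmod z \<longrightarrow> poly F (g z) = Faber_pullback m z)"
    using Faber_polynomial_exists by auto
  then obtain F where F: "\<And>m. 1 \<le> m \<Longrightarrow> degree (F m) \<le> m"
    "\<And>m. 1 \<le> m \<Longrightarrow> Polynomial.coeff (F m) m = 1 / of_real r ^ m"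
    "\<And>m z. 1 \<le> m \<Longrightarrow> 1 < cmod z \<Longrightarrow> poly (F m) (g z) = Faber_pullback m z"
    unfolding Ball_def atLeast_iff by metis
  define p where "p = (\<lambda>j. pderiv (F (Suc j)))"
  have deg: "degree (p j) \<le> j" for j
    using F(1)[of "Suc j"] degree_pderiv[of "F (Suc j)"] unfolding p_def by linarith
  have lead: "(cmod (Polynomial.coeff (p j) j))\<^sup>2 = (real (Suc j))\<^sup>2 * (1 / r ^ Suc j)\<^sup>2" for j
    using F(2)[of "Suc j"] r_pos
    by (simp add: p_def coeff_pderiv norm_mult norm_divide norm_power power_mult_distrib power_divide del: of_nat_Suc)
  define q where "q = (\<lambda>z :: nat \<Rightarrow> complex. \<Prod>(k, l)\<in>{(k, l). 1 \<le> k \<and> k < l \<and> l \<le> n}. (cmod (z k - z l))\<^sup>2)"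
  define C where "C = (\<Prod>j<n. (cmod (Polynomial.coeff (p j) j))\<^sup>2)"
  have C: "C = (fact n)\<^sup>2 / r ^ (n * (n + 1))"
  proof -
    have "(\<Prod>j<n. real (Suc j)) = fact n"
      by (simp add: fact_prod_Suc lessThan_atLeast0)
    then show ?thesis
      unfolding C_def lead prod.distrib prod_powers_capacity by (simp add: prod_power_distrib[symmetric])
  qed
  then have C0: "C > 0" using r_pos by simp
  let ?M = "Pi\<^sub>M {1..n} (\<lambda>_. lborel :: complex measure)" and ?D = "Pi\<^sub>E {1..n} (\<lambda>_. D)"
  have ints: "set_integrable lborel D (\<lambda>w. poly (p j) w * cnj (poly (p k) w))" for j k
    using domain by (intro set_integrable_continuous_bounded continuous_intros) auto
  note A = Andreief_identity[OF lborel.sigma_finite_measure_axioms, of n D "\<lambda>j. poly (p j)", OF ints]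
  have V: "Determinant.det (Matrix.mat n n (\<lambda>(i, j). poly (p j) (z (Suc i))))
      * cnj (Determinant.det (Matrix.mat n n (\<lambda>(i, j). poly (p j) (z (Suc i))))) = of_real (C * q z)" for z
    unfolding C_def q_def by (rule Vandermonde_poly_norm[OF deg])
  have "integrable ?M (\<lambda>z. complex_of_real (C * (indicator ?D z *\<^sub>R q z)))"
    using A(1) unfolding V set_integrable_def by (simp add: scaleR_conv_of_real mult_ac)
  then have "integrable ?M (\<lambda>z. C * (indicator ?D z *\<^sub>R q z))"
    by (auto dest: integrable_Re)
  then have iq: "set_integrable ?M ?D q"
    using C0 unfolding set_integrable_def by simp
  show "0 < partition_function n D"
    using domain(1,4) iq unfolding q_def by (rule partition_function_pos)
  have "(LINT z : ?D | ?M. complex_of_real (C * q z)) = of_real (C * (LINT z : ?D | ?M. q z))"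
  proof -
    have "(LINT z : ?D | ?M. complex_of_real (C * q z)) = (LINT z | ?M. complex_of_real (C * (indicator ?D z *\<^sub>R q z)))"
      unfolding set_lebesgue_integral_def by (simp add: scaleR_conv_of_real mult_ac)
    also have "\<dots> = of_real (C * (LINT z : ?D | ?M. q z))"
      unfolding set_lebesgue_integral_def integral_complex_of_real integral_mult_right_zero ..
    finally show ?thesis .
  qed
  also have "(LINT z : ?D | ?M. q z) = fact n * partition_function n D"
    unfolding partition_function_def q_def by simp
  finally have "(LINT z : ?D | ?M. complex_of_real (C * q z)) = of_real (C * (fact n * partition_function n D))" .
  then have "of_real (C * (fact n * partition_function n D))
      = fact n * Determinant.det (Matrix.mat n n (\<lambda>(j, k). LINT w : D | lborel. poly (p j) w * cnj (poly (p k) w)))"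
    using A(2) unfolding V by (simp only:)
  moreover have "(LINT w : D | lborel. poly (p j) w * cnj (poly (p k) w))
      = (of_real pi * of_real (sqrt (real (Suc j)))) * ((if j = k then 1 else 0) - Grunsky_Gram j k) * of_real (sqrt (real (Suc k)))" for j k
  proof -
    have s: "of_nat (Suc l) = complex_of_real (sqrt (real (Suc l))) * complex_of_real (sqrt (real (Suc l)))" for l
      by (simp flip: of_real_mult del: of_nat_Suc)
    have "(LINT w : D | lborel. poly (p j) w * cnj (poly (p k) w))
      = pi * ((if Suc j = Suc k then of_nat (Suc j) else 0) - of_nat (Suc j) * of_nat (Suc k) * (\<Sum>l. Grunsky_term (Suc j) (Suc k) l))"
      unfolding p_def by (rule integral_D_Faber(2)[OF F(3)]) auto
    then show ?thesis
      unfolding s Grunsky_Gram_def by (simp add: algebra_simps del: of_nat_Suc)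
  qed
  ultimately have "of_real (C * (fact n * partition_function n D))
      = fact n * ((\<Prod>i<n. of_real pi * of_real (sqrt (real (Suc i)))) * (\<Prod>i<n. of_real (sqrt (real (Suc i))))
        * Determinant.det (Matrix.mat n n (\<lambda>(i, j). (if i = j then 1 else 0) - Grunsky_Gram i j)))"
    by (simp only:) (use det_mat_scale[of n "\<lambda>i. of_real pi * of_real (sqrt (real (Suc i)))"
      "\<lambda>(i, j). (if i = j then 1 else 0) - Grunsky_Gram i j" "\<lambda>i. of_real (sqrt (real (Suc i)))"] in simp)
  moreover have "(\<Prod>i<n. complex_of_real pi * of_real (sqrt (real (Suc i)))) * (\<Prod>i<n. of_real (sqrt (real (Suc i))))
      = of_real (pi ^ n * fact n)"
  proof -
    have "(\<Prod>i<n. complex_of_real pi * of_real (sqrt (real (Suc i)))) * (\<Prod>i<n. of_real (sqrt (real (Suc i))))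
       = (\<Prod>i<n. complex_of_real (pi * real (Suc i)))"
      unfolding prod.distrib[symmetric] by (intro prod.cong refl) (simp flip: of_real_mult add: mult.assoc del: of_nat_Suc)
    also have "\<dots> = of_real (\<Prod>i<n. pi * real (Suc i))" by (simp only: of_real_prod)
    also have "(\<Prod>i<n. pi * real (Suc i)) = pi ^ n * fact n"
      by (simp add: prod.distrib fact_prod_Suc lessThan_atLeast0)
    finally show ?thesis .
  qed
  ultimately have eq: "of_real (C * (fact n * partition_function n D))
      = fact n * (of_real (pi ^ n * fact n) * Determinant.det (Matrix.mat n n (\<lambda>(i, j). (if i = j then 1 else 0) - Grunsky_Gram i j)))"
    by (simp only:)
  have "complex_of_real (partition_function n D) = of_real (C * (fact n * partition_function n D)) / of_real (C * fact n)"
    using C0 by simp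
  also have "\<dots> = of_real (pi ^ n / fact n * r ^ (n * (n + 1)))
      * Determinant.det (Matrix.mat n n (\<lambda>(i, j). (if i = j then 1 else 0) - Grunsky_Gram i j))"
    unfolding eq unfolding C using r_pos by (simp add: field_simps power2_eq_square)
  finally show "complex_of_real (partition_function n D) = of_real (pi ^ n / fact n * r ^ (n * (n + 1)))
      * Determinant.det (Matrix.mat n n (\<lambda>(i, j). (if i = j then 1 else 0) - Grunsky_Gram i j))" .
qed

end

theorem proposition1p1:
  fixes D :: "complex set" and g :: "complex \<Rightarrow> complex" and r :: real
    and a :: "nat \<Rightarrow> nat \<Rightarrow> complex" and n :: nat
  defines "B \<equiv> Grunsky_operator a"
  defines "P \<equiv> coord_proj n"
  defines "\<Delta> \<equiv> Fredholm_det (\<lambda>x k. x k - (P \<circ> B \<circ> adjoint_op B \<circ> P) x k)"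
  assumes "bounded_Jordan_domain D" and "0 \<in> D"
    and "negligible (frontier D)"
    and "exterior_conformal_map D g r"
    and "Grunsky_coefficients g r a"
    and "1 \<le> n"
  shows "0 < partition_function n D \<and> \<Delta> \<in> \<real> \<and> 0 < Re \<Delta> \<and>
         ln (partition_function n D) =
           ln (pi ^ n / fact n) + real (n * (n + 1)) * ln r + ln (Re \<Delta>)"
proof -
  interpret exterior_map D g r a
    by unfold_locales (use assms(4-8) in \<open>auto simp: bounded_Jordan_domain_def\<close>)
  define c where "c = pi ^ n / fact n * r ^ (n * (n + 1))"
  have c: "0 < c" using r_pos by (simp add: c_def)
  note Z = partition_function_Grunsky[of n]
  have "complex_of_real (partition_function n D) = of_real c * \<Delta>"
    unfolding Z(2) \<Delta>_def P_def B_def Fredholm_det_Grunsky c_def ..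
  then have \<Delta>: "\<Delta> = of_real (partition_function n D / c)"
    using c by (simp add: field_simps)
  have Re: "0 < Re \<Delta>" unfolding \<Delta> using Z(1) c by simp
  have "partition_function n D = c * Re \<Delta>" unfolding \<Delta> using c by simp
  then have "ln (partition_function n D) = ln c + ln (Re \<Delta>)"
    using c Re by (simp add: ln_mult)
  also have "ln c = ln (pi ^ n / fact n) + real (n * (n + 1)) * ln r"
    unfolding c_def using r_pos by (subst ln_mult) (simp_all add: ln_realpow del: of_nat_mult)
  finally show ?thesis using Z(1) Re \<Delta> by simp
qed

end
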